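(* Let $n\ge1$, let $(\mathcal D,\Sigma,\mathcal P)$ be an $(n+2)$-angulated category with class of $(n+2)$-angles $\mathcal P$, and let $\mathcal B\subseteq\mathcal D$ be an $n$-extension closed additive subcategory with $\mathcal D(\Sigma\mathcal B,\mathcal B)=0$, i.e. $\mathcal D(\Sigma B,B')=0$ for all $B,B'\in\mathcal B$. Let $\mathcal X_{\mathcal B}$ be the class of all sequences $A\xrightarrow{d^X_0}X_1\xrightarrow{d^X_1}\cdots\xrightarrow{d^X_{n-1}}X_n\xrightarrow{d^X_n}C$ with $A,X_1,\dots,X_n,C\in\mathcal B$ for which there exists a morphism $\delta\colon C\to\Sigma A$ such that $A\xrightarrow{d^X_0}X_1\to\cdots\to X_n\xrightarrow{d^X_n}C\xrightarrow{\delta}\Sigma A$ is an $(n+2)$-angle in $\mathcal P$. Then $(\mathcal B,\mathcal X_{\mathcal B})$ is an $n$-exact category with small extension groups.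
   Context: **$(n+2)$-angulated categories (Geiss–Keller–Oppermann).** Let $\mathcal D$ be additive with an additive automorphism $\Sigma$. An $(n+2)$-$\Sigma$-sequence is a sequence of morphisms $X_0\xrightarrow{\alpha_0}X_1\xrightarrow{\alpha_1}\cdots\xrightarrow{\alpha_n}X_{n+1}\xrightarrow{\alpha_{n+1}}\Sigma X_0$; its left rotation is $X_1\xrightarrow{\alpha_1}\cdots\to X_{n+1}\xrightarrow{\alpha_{n+1}}\Sigma X_0\xrightarrow{(-1)^{n}\Sigma\alpha_0}\Sigma X_1$. A morphism of such sequences is $(\varphi_0,\dots,\varphi_{n+1})$ making all squares commute, including the last one with $\Sigma\varphi_0$. $(\mathcal D,\Sigma,\mathcal P)$ is $(n+2)$-angulated if $\mathcal P$ is a class of $(n+2)$-$\Sigma$-sequences (called $(n+2)$-angles) with: (F1) $\mathcal P$ is closed under isomorphisms, direct sums and direct summands; for all $X$ the sequence $X\xrightarrow{\mathrm{id}}X\to0\to\cdots\to0\to\Sigma X$ is in $\mathcal P$; every morphism of $\mathcal D$ is the first morphism of some member of $\mathcal P$; (F2) a sequence is in $\mathcal P$ iff its left rotation is; (F3) given two members $(X,\alpha)$, $(Y,\beta)$ of $\mathcal P$ and $\varphi_0,\varphi_1$ with $\varphi_1\alpha_0=\beta_0\varphi_0$, there are $\varphi_2,\dots,\varphi_{n+1}$ completing these to a morphism of sequences; (F4) in (F3) these can be chosen so that the cone $X_1\oplus Y_0\to X_2\oplus Y_1\to\cdots\to X_{n+1}\oplus Y_n\to\Sigma X_0\oplus Y_{n+1}\to\Sigma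 X_1\oplus\Sigma Y_0$ with maps $\begin{bmatrix}-\alpha_{i}&0\\ \varphi_{i}&\beta_{i-1}\end{bmatrix}$ ($i=1,\dots,n+1$) and last map $\begin{bmatrix}-\Sigma\alpha_0&0\\ \Sigma\varphi_0&\beta_{n+1}\end{bmatrix}$ is in $\mathcal P$. **Subcategories.** An additive subcategory is a full subcategory closed under isomorphisms and finite direct sums and containing $0$ (not necessarily closed under direct summands). An additive subcategory $\mathcal B\subseteq\mathcal D$ is $n$-extension closed if for all $A,C\in\mathcal B$ and $\delta\in\mathcal D(C,\Sigma A)$ there is an $(n+2)$-angle $A\to X_1\to\cdots\to X_n\to C\xrightarrow{\delta}\Sigma A$ with $X_1,\dots,X_n\in\mathcal B$. **Complexes.** For an additive category $\mathcal D$, $\mathbf C^{n+2}_{\mathcal D}$ is the category of complexes $X_\bullet\colon X_0\xrightarrow{d^X_0}X_1\to\cdots\to X_n\xrightarrow{d^X_n}X_{n+1}$ over $\mathcal D$ concentrated in degrees $0,\dots,n+1$, with chain maps $f_\bullet=(f_0,\dots,f_{n+1})$. For $A,C\in\mathcal D$, $\mathbf C^{n+2}_{(\mathcal D;A,C)}$ is its subcategory of complexes with $X_0=A$, $X_{n+1}=C$ and chain maps with $f_0=\mathrm{id}_A$, $f_{n+1}=\mathrm{id}_C$; two of its morphisms are homotopic if their difference is null-homotopic as a chain map, and $[X_\bullet]_{\mathcal D}$ is the resulting homotopy equivalence class of $X_\bullet$ in $\mathbf C^{n+2}_{(\mathcal D;A,C)}$. **$n$-exact categories (Jasso).** Let $\mathcal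 D$ be any additive category. $X_\bullet\in\mathbf C^{n+2}_{\mathcal D}$ is an $n$-exact sequence if for all $X\in\mathcal D$ the sequences $0\to\mathcal D(X,X_0)\to\cdots\to\mathcal D(X,X_{n+1})$ and $0\to\mathcal D(X_{n+1},X)\to\cdots\to\mathcal D(X_0,X)$ are exact. A weak isomorphism of $n$-exact sequences is a chain map $f_\bullet$ such that $f_k$ and $f_{k+1}$ are isomorphisms for some $k\in\{0,\dots,n+1\}$, where $f_{n+2}:=f_0$. Given a chain map $(f_0,\dots,f_n)$ from $X_0\to\cdots\to X_n$ to $Y_0\to\cdots\to Y_n$, its cone is $X_0\to X_1\oplus Y_0\to\cdots\to X_n\oplus Y_{n-1}\to Y_n$ with differentials $\begin{bmatrix}-d^X_0\\ f_0\end{bmatrix}$, $\begin{bmatrix}-d^X_i&0\\ f_i&d^Y_{i-1}\end{bmatrix}$ ($1\le i\le n-1$), $\begin{bmatrix}f_n&d^Y_{n-1}\end{bmatrix}$. It is an $n$-pushout diagram (of $X_0\to\cdots\to X_n$ along $f_0$) if for all $X\in\mathcal D$ applying $\mathcal D(-,X)$ to the cone gives an exact sequence $0\to\mathcal D(Y_n,X)\to\mathcal D(X_n\oplus Y_{n-1},X)\to\cdots\to\mathcal D(X_0,X)$. Dually, it is an $n$-pullback diagram (of $Y_0\to\cdots\to Y_n$ along $f_n$) if for all $X$ applying $\mathcal D(X,-)$ to the cone gives an exact sequence $0\to\mathcal D(X,X_0)\to\cdots\to\mathcal D(X,Y_n)$. An $n$-exact structure on $\mathcal D$ is a class $\mathcal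 X$ of $n$-exact sequences closed under weak isomorphisms of $n$-exact sequences (if one of two $n$-exact sequences connected by a weak isomorphism is in $\mathcal X$, so is the other) such that, calling $d^X_0$ (resp. $d^X_n$) for $X_\bullet\in\mathcal X$ an admissible monomorphism (resp. admissible epimorphism): (E0) the zero complex is in $\mathcal X$; (E1) admissible monomorphisms are closed under composition; (E1$^{\mathrm{op}}$) admissible epimorphisms are closed under composition; (E2) for $X_\bullet\in\mathcal X$ and $f\colon X_0\to Y_0$ there is an $n$-pushout diagram of $X_0\to\cdots\to X_n$ along $f$, with target $Y_0\to\cdots\to Y_n$, such that $Y_0\to Y_1$ is an admissible monomorphism; (E2$^{\mathrm{op}}$) for $X_\bullet\in\mathcal X$ and $g\colon Y_{n+1}\to X_{n+1}$ there is an $n$-pullback diagram of $X_1\to\cdots\to X_{n+1}$ along $g$, with source $Y_1\to\cdots\to Y_{n+1}$, such that $Y_n\to Y_{n+1}$ is an admissible epimorphism. The pair $(\mathcal D,\mathcal X)$ is then an $n$-exact category. It has small extension groups if for all $A,C\in\mathcal D$ the class $\{[X_\bullet]_{\mathcal D}: X_\bullet\in\mathcal X\cap\mathbf C^{n+2}_{(\mathcal D;A,C)}\}$ is a set. *)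

theory Defs
  imports "HOL-Algebra.Coset" "HOL-Library.Equipollence"
begin

section \<open>Additive categories\<close>

text \<open>
  A category is given by a set of objects and pairwise disjoint hom-sets (every morphism has a
  unique source and target), so composition needs no object arguments.  For an additive category
  the record also carries a zero object and, for all objects \<open>A\<close>, \<open>B\<close>, a
  biproduct \<open>A \<oplus> B\<close> with its injections and projections; this is a choice of
  witnesses for the existence axioms.  Values of the fields outside the objects (respectively
  hom-sets) are irrelevant.
\<close>

record ('o, 'm) addcat =
  Obj :: "'o set"
  Hom :: "'o \<Rightarrow> 'o \<Rightarrow> 'm set"
  Idm :: "'o \<Rightarrow> 'm"
  Comp :: "'m \<Rightarrow> 'm \<Rightarrow> 'm"  (infixl "\<odot>\<index>" 70)
  Madd :: "'m \<Rightarrow> 'm \<Rightarrow> 'm"  (infixl "\<boxplus>\<index>" 65)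
  Mzero :: "'o \<Rightarrow> 'o \<Rightarrow> 'm"
  Zobj :: "'o"
  Dsum :: "'o \<Rightarrow> 'o \<Rightarrow> 'o"
  Inl :: "'o \<Rightarrow> 'o \<Rightarrow> 'm"
  Inr :: "'o \<Rightarrow> 'o \<Rightarrow> 'm"
  Prl :: "'o \<Rightarrow> 'o \<Rightarrow> 'm"
  Prr :: "'o \<Rightarrow> 'o \<Rightarrow> 'm"

definition hom_group :: "('o, 'm) addcat \<Rightarrow> 'o \<Rightarrow> 'o \<Rightarrow> 'm monoid" where
  "hom_group D A B = \<lparr>carrier = Hom D A B, mult = Madd D, one = Mzero D A B\<rparr>"

definition mneg :: "('o, 'm) addcat \<Rightarrow> 'o \<Rightarrow> 'o \<Rightarrow> 'm \<Rightarrow> 'm" where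
  "mneg D A B f = inv\<^bsub>hom_group D A B\<^esub> f"

locale category =
  fixes D :: "('o, 'm) addcat" (structure)
  assumes Idm_in: "A \<in> Obj D \<Longrightarrow> Idm D A \<in> Hom D A A"
    and Comp_in: "\<lbrakk>A \<in> Obj D; B \<in> Obj D; C \<in> Obj D; f \<in> Hom D A B; g \<in> Hom D B C\<rbrakk>
      \<Longrightarrow> g \<odot> f \<in> Hom D A C"
    and Comp_assoc: "\<lbrakk>A \<in> Obj D; B \<in> Obj D; C \<in> Obj D; E \<in> Obj D;
        f \<in> Hom D A B; g \<in> Hom D B C; h \<in> Hom D C E\<rbrakk>
      \<Longrightarrow> (h \<odot> g) \<odot> f = h \<odot> (g \<odot> f)"
    and Comp_Idm: "\<lbrakk>A \<in> Obj D; B \<in> Obj D; f \<in> Hom D A B\<rbrakk> \<Longrightarrow> f \<odot> Idm D A = f"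
    and Idm_Comp: "\<lbrakk>A \<in> Obj D; B \<in> Obj D; f \<in> Hom D A B\<rbrakk> \<Longrightarrow> Idm D B \<odot> f = f"
    and Hom_disjoint: "\<lbrakk>A \<in> Obj D; B \<in> Obj D; A' \<in> Obj D; B' \<in> Obj D;
        f \<in> Hom D A B; f \<in> Hom D A' B'\<rbrakk> \<Longrightarrow> A = A' \<and> B = B'"

locale additive_category = category D for D :: "('o, 'm) addcat" (structure) +
  assumes hom_comm_group: "\<lbrakk>A \<in> Obj D; B \<in> Obj D\<rbrakk> \<Longrightarrow> comm_group (hom_group D A B)"
    and Comp_Madd_right: "\<lbrakk>A \<in> Obj D; B \<in> Obj D; C \<in> Obj D;
        f \<in> Hom D A B; f' \<in> Hom D A B; g \<in> Hom D B C\<rbrakk>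
      \<Longrightarrow> g \<odot> (f \<boxplus> f') = (g \<odot> f) \<boxplus> (g \<odot> f')"
    and Comp_Madd_left: "\<lbrakk>A \<in> Obj D; B \<in> Obj D; C \<in> Obj D;
        f \<in> Hom D A B; g \<in> Hom D B C; g' \<in> Hom D B C\<rbrakk>
      \<Longrightarrow> (g \<boxplus> g') \<odot> f = (g \<odot> f) \<boxplus> (g' \<odot> f)"
    and Zobj_in: "Zobj D \<in> Obj D"
    and Zobj_zero: "Idm D (Zobj D) = Mzero D (Zobj D) (Zobj D)"
    and Dsum_in: "\<lbrakk>A \<in> Obj D; B \<in> Obj D\<rbrakk> \<Longrightarrow> Dsum D A B \<in> Obj D"
    and Inl_in: "\<lbrakk>A \<in> Obj D; B \<in> Obj D\<rbrakk> \<Longrightarrow> Inl D A B \<in> Hom D A (Dsum D A B)"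
    and Inr_in: "\<lbrakk>A \<in> Obj D; B \<in> Obj D\<rbrakk> \<Longrightarrow> Inr D A B \<in> Hom D B (Dsum D A B)"
    and Prl_in: "\<lbrakk>A \<in> Obj D; B \<in> Obj D\<rbrakk> \<Longrightarrow> Prl D A B \<in> Hom D (Dsum D A B) A"
    and Prr_in: "\<lbrakk>A \<in> Obj D; B \<in> Obj D\<rbrakk> \<Longrightarrow> Prr D A B \<in> Hom D (Dsum D A B) B"
    and Prl_Inl: "\<lbrakk>A \<in> Obj D; B \<in> Obj D\<rbrakk> \<Longrightarrow> Prl D A B \<odot> Inl D A B = Idm D A"
    and Prr_Inr: "\<lbrakk>A \<in> Obj D; B \<in> Obj D\<rbrakk> \<Longrightarrow> Prr D A B \<odot> Inr D A B = Idm D B"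
    and Prl_Inr: "\<lbrakk>A \<in> Obj D; B \<in> Obj D\<rbrakk> \<Longrightarrow> Prl D A B \<odot> Inr D A B = Mzero D B A"
    and Prr_Inl: "\<lbrakk>A \<in> Obj D; B \<in> Obj D\<rbrakk> \<Longrightarrow> Prr D A B \<odot> Inl D A B = Mzero D A B"
    and Dsum_decomp: "\<lbrakk>A \<in> Obj D; B \<in> Obj D\<rbrakk>
      \<Longrightarrow> (Inl D A B \<odot> Prl D A B) \<boxplus> (Inr D A B \<odot> Prr D A B) = Idm D (Dsum D A B)"

definition isomor :: "('o, 'm) addcat \<Rightarrow> 'o \<Rightarrow> 'o \<Rightarrow> 'm \<Rightarrow> bool" where
  "isomor D A B f \<longleftrightarrow> f \<in> Hom D A B \<and>
    (\<exists>g \<in> Hom D B A. g \<odot>\<^bsub>D\<^esub> f = Idm D A \<and> f \<odot>\<^bsub>D\<^esub> g = Idm D B)"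

text \<open>
  The row \<open>[a b] : A1 \<oplus> A2 \<rightarrow> B\<close>, the column with entries
  \<open>a : A \<rightarrow> B1\<close>, \<open>b : A \<rightarrow> B2\<close>, and the matrix with rows
  \<open>[a b]\<close>, \<open>[c d]\<close> from \<open>A1 \<oplus> A2\<close> to \<open>B1 \<oplus> B2\<close>.
\<close>

definition row :: "('o, 'm) addcat \<Rightarrow> 'o \<Rightarrow> 'o \<Rightarrow> 'm \<Rightarrow> 'm \<Rightarrow> 'm" where
  "row D A1 A2 a b = (a \<odot>\<^bsub>D\<^esub> Prl D A1 A2) \<boxplus>\<^bsub>D\<^esub> (b \<odot>\<^bsub>D\<^esub> Prr D A1 A2)"

definition col :: "('o, 'm) addcat \<Rightarrow> 'o \<Rightarrow> 'o \<Rightarrow> 'm \<Rightarrow> 'm \<Rightarrow> 'm" where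
  "col D B1 B2 a b = (Inl D B1 B2 \<odot>\<^bsub>D\<^esub> a) \<boxplus>\<^bsub>D\<^esub> (Inr D B1 B2 \<odot>\<^bsub>D\<^esub> b)"

definition mat :: "('o, 'm) addcat \<Rightarrow> 'o \<Rightarrow> 'o \<Rightarrow> 'o \<Rightarrow> 'o \<Rightarrow> 'm \<Rightarrow> 'm \<Rightarrow> 'm \<Rightarrow> 'm \<Rightarrow> 'm" where
  "mat D A1 A2 B1 B2 a b c d = col D B1 B2 (row D A1 A2 a b) (row D A1 A2 c d)"

definition full_sub :: "('o, 'm) addcat \<Rightarrow> 'o set \<Rightarrow> ('o, 'm) addcat" where
  "full_sub D B = D\<lparr>Obj := B\<rparr>"

definition additive_subcategory :: "('o, 'm) addcat \<Rightarrow> 'o set \<Rightarrow> bool" where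
  "additive_subcategory D B \<longleftrightarrow> B \<subseteq> Obj D \<and>
    (\<forall>A \<in> B. \<forall>A' \<in> Obj D. (\<exists>f. isomor D A A' f) \<longrightarrow> A' \<in> B) \<and>
    Zobj D \<in> B \<and> (\<forall>A \<in> B. \<forall>A' \<in> B. Dsum D A A' \<in> B)"


section \<open>Complexes and \<open>n\<close>-exact categories\<close>

text \<open>
  A sequence \<open>X 0 \<rightarrow> X 1 \<rightarrow> \<dots>\<close> is a pair of functions on the naturals,
  \<open>d i\<close> being the morphism that starts at \<open>X i\<close>.  Only a finite initial
  segment is ever constrained; the values beyond it are irrelevant.
\<close>

type_synonym ('o, 'm) sq = "(nat \<Rightarrow> 'o) \<times> (nat \<Rightarrow> 'm)"

definition is_complex :: "('o, 'm) addcat \<Rightarrow> nat \<Rightarrow> (nat \<Rightarrow> 'o) \<Rightarrow> (nat \<Rightarrow> 'm) \<Rightarrow> bool" where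
  "is_complex D m X d \<longleftrightarrow> (\<forall>i\<le>m. X i \<in> Obj D) \<and> (\<forall>i<m. d i \<in> Hom D (X i) (X (i + 1))) \<and>
    (\<forall>i. i + 1 < m \<longrightarrow> d (i + 1) \<odot>\<^bsub>D\<^esub> d i = Mzero D (X i) (X (i + 2)))"

definition chain_map :: "('o, 'm) addcat \<Rightarrow> nat \<Rightarrow> (nat \<Rightarrow> 'o) \<Rightarrow> (nat \<Rightarrow> 'm) \<Rightarrow>
    (nat \<Rightarrow> 'o) \<Rightarrow> (nat \<Rightarrow> 'm) \<Rightarrow> (nat \<Rightarrow> 'm) \<Rightarrow> bool" where
  "chain_map D m X d Y e f \<longleftrightarrow> (\<forall>i\<le>m. f i \<in> Hom D (X i) (Y i)) \<and>
    (\<forall>i<m. f (i + 1) \<odot>\<^bsub>D\<^esub> d i = e i \<odot>\<^bsub>D\<^esub> f i)"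

text \<open>
  \<open>cov_exact\<close>: \<open>0 \<rightarrow> D(T, X 0) \<rightarrow> \<dots> \<rightarrow> D(T, X m)\<close> is
  exact for all \<open>T\<close>; \<open>contra_exact\<close>:
  \<open>0 \<rightarrow> D(X m, T) \<rightarrow> \<dots> \<rightarrow> D(X 0, T)\<close> is exact for all
  \<open>T\<close>.
\<close>

definition cov_exact :: "('o, 'm) addcat \<Rightarrow> nat \<Rightarrow> (nat \<Rightarrow> 'o) \<Rightarrow> (nat \<Rightarrow> 'm) \<Rightarrow> bool" where
  "cov_exact D m X d \<longleftrightarrow> (\<forall>T \<in> Obj D.
    kernel (hom_group D T (X 0)) (hom_group D T (X 1)) (\<lambda>h. d 0 \<odot>\<^bsub>D\<^esub> h) = {Mzero D T (X 0)} \<and>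
    (\<forall>i. i + 1 < m \<longrightarrow>
      kernel (hom_group D T (X (i + 1))) (hom_group D T (X (i + 2))) (\<lambda>h. d (i + 1) \<odot>\<^bsub>D\<^esub> h)
        = (\<lambda>h. d i \<odot>\<^bsub>D\<^esub> h) ` Hom D T (X i)))"

definition contra_exact :: "('o, 'm) addcat \<Rightarrow> nat \<Rightarrow> (nat \<Rightarrow> 'o) \<Rightarrow> (nat \<Rightarrow> 'm) \<Rightarrow> bool" where
  "contra_exact D m X d \<longleftrightarrow> (\<forall>T \<in> Obj D.
    kernel (hom_group D (X m) T) (hom_group D (X (m - 1)) T) (\<lambda>h. h \<odot>\<^bsub>D\<^esub> d (m - 1))
      = {Mzero D (X m) T} \<and>
    (\<forall>i. i + 1 < m \<longrightarrow>
      kernel (hom_group D (X (i + 1)) T) (hom_group D (X i) T) (\<lambda>h. h \<odot>\<^bsub>D\<^esub> d i)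
        = (\<lambda>h. h \<odot>\<^bsub>D\<^esub> d (i + 1)) ` Hom D (X (i + 2)) T))"

definition n_exact_seq :: "nat \<Rightarrow> ('o, 'm) addcat \<Rightarrow> (nat \<Rightarrow> 'o) \<Rightarrow> (nat \<Rightarrow> 'm) \<Rightarrow> bool" where
  "n_exact_seq n D X d \<longleftrightarrow>
    is_complex D (n + 1) X d \<and> cov_exact D (n + 1) X d \<and> contra_exact D (n + 1) X d"

definition weak_iso :: "nat \<Rightarrow> ('o, 'm) addcat \<Rightarrow> (nat \<Rightarrow> 'o) \<Rightarrow> (nat \<Rightarrow> 'm) \<Rightarrow>
    (nat \<Rightarrow> 'o) \<Rightarrow> (nat \<Rightarrow> 'm) \<Rightarrow> (nat \<Rightarrow> 'm) \<Rightarrow> bool" where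
  "weak_iso n D X d Y e f \<longleftrightarrow> chain_map D (n + 1) X d Y e f \<and>
    (\<exists>k\<le>n + 1. let l = (k + 1) mod (n + 2) in
      isomor D (X k) (Y k) (f k) \<and> isomor D (X l) (Y l) (f l))"

text \<open>
  The cone of a chain map \<open>(f 0, \<dots>, f n)\<close> from
  \<open>X 0 \<rightarrow> \<dots> \<rightarrow> X n\<close> to
  \<open>Y 0 \<rightarrow> \<dots> \<rightarrow> Y n\<close>, for \<open>n \<ge> 1\<close>; it has
  \<open>n + 2\<close> terms.
\<close>

definition cone_obj :: "nat \<Rightarrow> ('o, 'm) addcat \<Rightarrow> (nat \<Rightarrow> 'o) \<Rightarrow> (nat \<Rightarrow> 'o) \<Rightarrow> nat \<Rightarrow> 'o" where
  "cone_obj n D X Y i =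
    (if i = 0 then X 0 else if i \<le> n then Dsum D (X i) (Y (i - 1)) else Y n)"

definition cone_map :: "nat \<Rightarrow> ('o, 'm) addcat \<Rightarrow> (nat \<Rightarrow> 'o) \<Rightarrow> (nat \<Rightarrow> 'm) \<Rightarrow>
    (nat \<Rightarrow> 'o) \<Rightarrow> (nat \<Rightarrow> 'm) \<Rightarrow> (nat \<Rightarrow> 'm) \<Rightarrow> nat \<Rightarrow> 'm" where
  "cone_map n D X d Y e f i =
    (if i = 0 then col D (X 1) (Y 0) (mneg D (X 0) (X 1) (d 0)) (f 0)
     else if i < n then
       mat D (X i) (Y (i - 1)) (X (i + 1)) (Y i)
         (mneg D (X i) (X (i + 1)) (d i)) (Mzero D (Y (i - 1)) (X (i + 1)))
         (f i) (e (i - 1))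
     else row D (X n) (Y (n - 1)) (f n) (e (n - 1)))"

definition n_pushout :: "nat \<Rightarrow> ('o, 'm) addcat \<Rightarrow> (nat \<Rightarrow> 'o) \<Rightarrow> (nat \<Rightarrow> 'm) \<Rightarrow>
    (nat \<Rightarrow> 'o) \<Rightarrow> (nat \<Rightarrow> 'm) \<Rightarrow> (nat \<Rightarrow> 'm) \<Rightarrow> bool" where
  "n_pushout n D X d Y e f \<longleftrightarrow>
    is_complex D n X d \<and> is_complex D n Y e \<and> chain_map D n X d Y e f \<and>
    contra_exact D (n + 1) (cone_obj n D X Y) (cone_map n D X d Y e f)"

definition n_pullback :: "nat \<Rightarrow> ('o, 'm) addcat \<Rightarrow> (nat \<Rightarrow> 'o) \<Rightarrow> (nat \<Rightarrow> 'm) \<Rightarrow>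
    (nat \<Rightarrow> 'o) \<Rightarrow> (nat \<Rightarrow> 'm) \<Rightarrow> (nat \<Rightarrow> 'm) \<Rightarrow> bool" where
  "n_pullback n D X d Y e f \<longleftrightarrow>
    is_complex D n X d \<and> is_complex D n Y e \<and> chain_map D n X d Y e f \<and>
    cov_exact D (n + 1) (cone_obj n D X Y) (cone_map n D X d Y e f)"

definition adm_mono :: "('o, 'm) sq set \<Rightarrow> 'm set" where
  "adm_mono \<X> = {d 0 | X d. (X, d) \<in> \<X>}"

definition adm_epi :: "nat \<Rightarrow> ('o, 'm) sq set \<Rightarrow> 'm set" where
  "adm_epi n \<X> = {d n | X d. (X, d) \<in> \<X>}"

text \<open>
  In \<open>E2_op\<close> the source of the pullback diagram is indexed from \<open>0\<close> to
  \<open>n\<close>, and the \<open>X\<close>-sequence is shifted accordingly.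
\<close>

locale n_exact_category = additive_category D
  for n :: nat and D :: "('o, 'm) addcat" (structure) and \<X> :: "('o, 'm) sq set" +
  assumes n_exact: "(X, d) \<in> \<X> \<Longrightarrow> n_exact_seq n D X d"
    and weak_iso_closed:
      "\<lbrakk>n_exact_seq n D X d; n_exact_seq n D Y e; weak_iso n D X d Y e \<phi>\<rbrakk>
        \<Longrightarrow> (X, d) \<in> \<X> \<longleftrightarrow> (Y, e) \<in> \<X>"
    and E0: "((\<lambda>i. Zobj D), (\<lambda>i. Mzero D (Zobj D) (Zobj D))) \<in> \<X>"
    and E1: "\<lbrakk>A \<in> Obj D; B \<in> Obj D; C \<in> Obj D; f \<in> Hom D A B; g \<in> Hom D B C;
        f \<in> adm_mono \<X>; g \<in> adm_mono \<X>\<rbrakk> \<Longrightarrow> g \<odot> f \<in> adm_mono \<X>"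
    and E1_op: "\<lbrakk>A \<in> Obj D; B \<in> Obj D; C \<in> Obj D; f \<in> Hom D A B; g \<in> Hom D B C;
        f \<in> adm_epi n \<X>; g \<in> adm_epi n \<X>\<rbrakk> \<Longrightarrow> g \<odot> f \<in> adm_epi n \<X>"
    and E2: "\<lbrakk>(X, d) \<in> \<X>; Y0 \<in> Obj D; f \<in> Hom D (X 0) Y0\<rbrakk> \<Longrightarrow>
        \<exists>Y e \<phi>. n_pushout n D X d Y e \<phi> \<and> Y 0 = Y0 \<and> \<phi> 0 = f \<and> e 0 \<in> adm_mono \<X>"
    and E2_op: "\<lbrakk>(X, d) \<in> \<X>; Y' \<in> Obj D; g \<in> Hom D Y' (X (n + 1))\<rbrakk> \<Longrightarrow>
        \<exists>Y e \<phi>. n_pullback n D Y e (\<lambda>i. X (i + 1)) (\<lambda>i. d (i + 1)) \<phi> \<and>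
          Y n = Y' \<and> \<phi> n = g \<and> e (n - 1) \<in> adm_epi n \<X>"


section \<open>Homotopy classes and smallness\<close>

definition complexes_between :: "nat \<Rightarrow> ('o, 'm) addcat \<Rightarrow> 'o \<Rightarrow> 'o \<Rightarrow> ('o, 'm) sq set" where
  "complexes_between n D A C =
    {(X, d). is_complex D (n + 1) X d \<and> X 0 = A \<and> X (n + 1) = C}"

definition null_homotopic :: "nat \<Rightarrow> ('o, 'm) addcat \<Rightarrow> (nat \<Rightarrow> 'o) \<Rightarrow> (nat \<Rightarrow> 'm) \<Rightarrow>
    (nat \<Rightarrow> 'o) \<Rightarrow> (nat \<Rightarrow> 'm) \<Rightarrow> (nat \<Rightarrow> 'm) \<Rightarrow> bool" where
  "null_homotopic n D X d Y e f \<longleftrightarrow> (\<exists>h.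
    (\<forall>i\<in>{1..n + 1}. h i \<in> Hom D (X i) (Y (i - 1))) \<and>
    f 0 = h 1 \<odot>\<^bsub>D\<^esub> d 0 \<and>
    (\<forall>i\<in>{1..n}. f i = (e (i - 1) \<odot>\<^bsub>D\<^esub> h i) \<boxplus>\<^bsub>D\<^esub> (h (i + 1) \<odot>\<^bsub>D\<^esub> d i)) \<and>
    f (n + 1) = e n \<odot>\<^bsub>D\<^esub> h (n + 1))"

definition homotopic :: "nat \<Rightarrow> ('o, 'm) addcat \<Rightarrow> (nat \<Rightarrow> 'o) \<Rightarrow> (nat \<Rightarrow> 'm) \<Rightarrow>
    (nat \<Rightarrow> 'o) \<Rightarrow> (nat \<Rightarrow> 'm) \<Rightarrow> (nat \<Rightarrow> 'm) \<Rightarrow> (nat \<Rightarrow> 'm) \<Rightarrow> bool" where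
  "homotopic n D X d Y e f g \<longleftrightarrow>
    null_homotopic n D X d Y e (\<lambda>i. f i \<boxplus>\<^bsub>D\<^esub> mneg D (X i) (Y i) (g i))"

definition map_between :: "nat \<Rightarrow> ('o, 'm) addcat \<Rightarrow> 'o \<Rightarrow> 'o \<Rightarrow> (nat \<Rightarrow> 'o) \<Rightarrow> (nat \<Rightarrow> 'm) \<Rightarrow>
    (nat \<Rightarrow> 'o) \<Rightarrow> (nat \<Rightarrow> 'm) \<Rightarrow> (nat \<Rightarrow> 'm) \<Rightarrow> bool" where
  "map_between n D A C X d Y e f \<longleftrightarrow>
    chain_map D (n + 1) X d Y e f \<and> f 0 = Idm D A \<and> f (n + 1) = Idm D C"

definition htpy_class :: "nat \<Rightarrow> ('o, 'm) addcat \<Rightarrow> 'o \<Rightarrow> 'o \<Rightarrow> ('o, 'm) sq \<Rightarrow> ('o, 'm) sq set" where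
  "htpy_class n D A C = (\<lambda>(X, d). {(Y, e) \<in> complexes_between n D A C.
    \<exists>f g. map_between n D A C X d Y e f \<and> map_between n D A C Y e X d g \<and>
      homotopic n D X d X d (\<lambda>i. g i \<odot>\<^bsub>D\<^esub> f i) (\<lambda>i. Idm D (X i)) \<and>
      homotopic n D Y e Y e (\<lambda>i. f i \<odot>\<^bsub>D\<^esub> g i) (\<lambda>i. Idm D (Y i))})"

text \<open>
  Size is measured against a set \<open>U\<close>, the universe of small sets: a collection is small
  (``is a set'') if it has strictly smaller cardinality than \<open>U\<close>, which for a
  Grothendieck universe \<open>U\<close> means that it is in bijection with an element of
  \<open>U\<close>.  No property of \<open>U\<close> is needed.  The objects of a category need not be
  small.
\<close>

definition small :: "'u set \<Rightarrow> 'a set \<Rightarrow> bool" where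
  "small U S \<longleftrightarrow> S \<prec> U"

definition locally_small :: "'u set \<Rightarrow> ('o, 'm) addcat \<Rightarrow> bool" where
  "locally_small U D \<longleftrightarrow> (\<forall>A \<in> Obj D. \<forall>B \<in> Obj D. small U (Hom D A B))"

definition small_extension_groups ::
    "'u set \<Rightarrow> nat \<Rightarrow> ('o, 'm) addcat \<Rightarrow> ('o, 'm) sq set \<Rightarrow> bool" where
  "small_extension_groups U n D \<X> \<longleftrightarrow> (\<forall>A \<in> Obj D. \<forall>C \<in> Obj D.
    small U (htpy_class n D A C ` (\<X> \<inter> complexes_between n D A C)))"


section \<open>\<open>(n + 2)\<close>-angulated categories\<close>

text \<open>
  The automorphism is given by its object part \<open>SO\<close> and its morphism part \<open>SM\<close>.
\<close>

definition additive_automorphism ::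
    "('o, 'm) addcat \<Rightarrow> ('o \<Rightarrow> 'o) \<Rightarrow> ('m \<Rightarrow> 'm) \<Rightarrow> bool" where
  "additive_automorphism D SO SM \<longleftrightarrow>
    bij_betw SO (Obj D) (Obj D) \<and>
    (\<forall>A \<in> Obj D. \<forall>B \<in> Obj D. bij_betw SM (Hom D A B) (Hom D (SO A) (SO B))) \<and>
    (\<forall>A \<in> Obj D. SM (Idm D A) = Idm D (SO A)) \<and>
    (\<forall>A \<in> Obj D. \<forall>B \<in> Obj D. \<forall>C \<in> Obj D. \<forall>f \<in> Hom D A B. \<forall>g \<in> Hom D B C.
      SM (g \<odot>\<^bsub>D\<^esub> f) = SM g \<odot>\<^bsub>D\<^esub> SM f) \<and>
    (\<forall>A \<in> Obj D. \<forall>B \<in> Obj D. \<forall>f \<in> Hom D A B. \<forall>g \<in> Hom D A B.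
      SM (f \<boxplus>\<^bsub>D\<^esub> g) = SM f \<boxplus>\<^bsub>D\<^esub> SM g)"

definition sigma_seq :: "nat \<Rightarrow> ('o, 'm) addcat \<Rightarrow> ('o \<Rightarrow> 'o) \<Rightarrow>
    (nat \<Rightarrow> 'o) \<Rightarrow> (nat \<Rightarrow> 'm) \<Rightarrow> bool" where
  "sigma_seq n D SO X \<alpha> \<longleftrightarrow> (\<forall>i\<le>n + 1. X i \<in> Obj D) \<and>
    (\<forall>i\<le>n. \<alpha> i \<in> Hom D (X i) (X (i + 1))) \<and> \<alpha> (n + 1) \<in> Hom D (X (n + 1)) (SO (X 0))"

definition sigma_map :: "nat \<Rightarrow> ('o, 'm) addcat \<Rightarrow> ('m \<Rightarrow> 'm) \<Rightarrow> (nat \<Rightarrow> 'o) \<Rightarrow> (nat \<Rightarrow> 'm) \<Rightarrow>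
    (nat \<Rightarrow> 'o) \<Rightarrow> (nat \<Rightarrow> 'm) \<Rightarrow> (nat \<Rightarrow> 'm) \<Rightarrow> bool" where
  "sigma_map n D SM X \<alpha> Y \<beta> \<phi> \<longleftrightarrow> (\<forall>i\<le>n + 1. \<phi> i \<in> Hom D (X i) (Y i)) \<and>
    (\<forall>i\<le>n. \<phi> (i + 1) \<odot>\<^bsub>D\<^esub> \<alpha> i = \<beta> i \<odot>\<^bsub>D\<^esub> \<phi> i) \<and>
    SM (\<phi> 0) \<odot>\<^bsub>D\<^esub> \<alpha> (n + 1) = \<beta> (n + 1) \<odot>\<^bsub>D\<^esub> \<phi> (n + 1)"

definition sigma_iso :: "nat \<Rightarrow> ('o, 'm) addcat \<Rightarrow> ('m \<Rightarrow> 'm) \<Rightarrow> (nat \<Rightarrow> 'o) \<Rightarrow> (nat \<Rightarrow> 'm) \<Rightarrow>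
    (nat \<Rightarrow> 'o) \<Rightarrow> (nat \<Rightarrow> 'm) \<Rightarrow> (nat \<Rightarrow> 'm) \<Rightarrow> bool" where
  "sigma_iso n D SM X \<alpha> Y \<beta> \<phi> \<longleftrightarrow>
    sigma_map n D SM X \<alpha> Y \<beta> \<phi> \<and> (\<forall>i\<le>n + 1. isomor D (X i) (Y i) (\<phi> i))"

definition rot_obj :: "nat \<Rightarrow> ('o \<Rightarrow> 'o) \<Rightarrow> (nat \<Rightarrow> 'o) \<Rightarrow> nat \<Rightarrow> 'o" where
  "rot_obj n SO X i = (if i \<le> n then X (i + 1) else SO (X 0))"

definition rot_map :: "nat \<Rightarrow> ('o, 'm) addcat \<Rightarrow> ('o \<Rightarrow> 'o) \<Rightarrow> ('m \<Rightarrow> 'm) \<Rightarrow>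
    (nat \<Rightarrow> 'o) \<Rightarrow> (nat \<Rightarrow> 'm) \<Rightarrow> nat \<Rightarrow> 'm" where
  "rot_map n D SO SM X \<alpha> i =
    (if i \<le> n then \<alpha> (i + 1)
     else if even n then SM (\<alpha> 0) else mneg D (SO (X 0)) (SO (X 1)) (SM (\<alpha> 0)))"

text \<open>
  The canonical isomorphism \<open>SO A \<oplus> SO B \<rightarrow> SO (A \<oplus> B)\<close>, which is
  suppressed in the usual notation for direct sums and cones of sequences.
\<close>

definition sigma_dsum ::
    "('o, 'm) addcat \<Rightarrow> ('o \<Rightarrow> 'o) \<Rightarrow> ('m \<Rightarrow> 'm) \<Rightarrow> 'o \<Rightarrow> 'o \<Rightarrow> 'm" where
  "sigma_dsum D SO SM A B = row D (SO A) (SO B) (SM (Inl D A B)) (SM (Inr D A B))"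

definition sum_obj :: "('o, 'm) addcat \<Rightarrow> (nat \<Rightarrow> 'o) \<Rightarrow> (nat \<Rightarrow> 'o) \<Rightarrow> nat \<Rightarrow> 'o" where
  "sum_obj D X Y i = Dsum D (X i) (Y i)"

definition sum_map :: "nat \<Rightarrow> ('o, 'm) addcat \<Rightarrow> ('o \<Rightarrow> 'o) \<Rightarrow> ('m \<Rightarrow> 'm) \<Rightarrow>
    (nat \<Rightarrow> 'o) \<Rightarrow> (nat \<Rightarrow> 'm) \<Rightarrow> (nat \<Rightarrow> 'o) \<Rightarrow> (nat \<Rightarrow> 'm) \<Rightarrow> nat \<Rightarrow> 'm" where
  "sum_map n D SO SM X \<alpha> Y \<beta> i =
    (if i \<le> n then
       mat D (X i) (Y i) (X (i + 1)) (Y (i + 1))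
         (\<alpha> i) (Mzero D (Y i) (X (i + 1)))
         (Mzero D (X i) (Y (i + 1))) (\<beta> i)
     else sigma_dsum D SO SM (X 0) (Y 0) \<odot>\<^bsub>D\<^esub>
       mat D (X (n + 1)) (Y (n + 1)) (SO (X 0)) (SO (Y 0))
         (\<alpha> (n + 1)) (Mzero D (Y (n + 1)) (SO (X 0)))
         (Mzero D (X (n + 1)) (SO (Y 0))) (\<beta> (n + 1)))"

definition triv_obj :: "('o, 'm) addcat \<Rightarrow> 'o \<Rightarrow> nat \<Rightarrow> 'o" where
  "triv_obj D A i = (if i \<le> 1 then A else Zobj D)"

definition triv_map :: "nat \<Rightarrow> ('o, 'm) addcat \<Rightarrow> ('o \<Rightarrow> 'o) \<Rightarrow> 'o \<Rightarrow> nat \<Rightarrow> 'm" where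
  "triv_map n D SO A i =
    (if i = 0 then Idm D A
     else if i \<le> n then Mzero D (triv_obj D A i) (triv_obj D A (i + 1))
     else Mzero D (triv_obj D A (n + 1)) (SO A))"

text \<open>
  The mapping cone of a morphism of \<open>(n + 2)\<close>-angles; position \<open>i\<close> of the
  cone is \<open>X (i + 1) \<oplus> Y i\<close>, read with \<open>X (n + 2) = SO (X 0)\<close>.
\<close>

definition angle_cone_obj ::
    "nat \<Rightarrow> ('o, 'm) addcat \<Rightarrow> ('o \<Rightarrow> 'o) \<Rightarrow> (nat \<Rightarrow> 'o) \<Rightarrow> (nat \<Rightarrow> 'o) \<Rightarrow> nat \<Rightarrow> 'o" where
  "angle_cone_obj n D SO X Y i =
    (if i \<le> n then Dsum D (X (i + 1)) (Y i) else Dsum D (SO (X 0)) (Y (n + 1)))"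

definition angle_cone_map :: "nat \<Rightarrow> ('o, 'm) addcat \<Rightarrow> ('o \<Rightarrow> 'o) \<Rightarrow> ('m \<Rightarrow> 'm) \<Rightarrow>
    (nat \<Rightarrow> 'o) \<Rightarrow> (nat \<Rightarrow> 'm) \<Rightarrow> (nat \<Rightarrow> 'o) \<Rightarrow> (nat \<Rightarrow> 'm) \<Rightarrow> (nat \<Rightarrow> 'm) \<Rightarrow> nat \<Rightarrow> 'm" where
  "angle_cone_map n D SO SM X \<alpha> Y \<beta> \<phi> i =
    (if i < n then
       mat D (X (i + 1)) (Y i) (X (i + 2)) (Y (i + 1))
         (mneg D (X (i + 1)) (X (i + 2)) (\<alpha> (i + 1))) (Mzero D (Y i) (X (i + 2)))
         (\<phi> (i + 1)) (\<beta> i)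
     else if i = n then
       mat D (X (n + 1)) (Y n) (SO (X 0)) (Y (n + 1))
         (mneg D (X (n + 1)) (SO (X 0)) (\<alpha> (n + 1))) (Mzero D (Y n) (SO (X 0)))
         (\<phi> (n + 1)) (\<beta> n)
     else sigma_dsum D SO SM (X 1) (Y 0) \<odot>\<^bsub>D\<^esub>
       mat D (SO (X 0)) (Y (n + 1)) (SO (X 1)) (SO (Y 0))
         (mneg D (SO (X 0)) (SO (X 1)) (SM (\<alpha> 0))) (Mzero D (Y (n + 1)) (SO (X 1)))
         (SM (\<phi> 0)) (\<beta> (n + 1)))"

text \<open>
  Closure under direct summands is expressed for the chosen direct sum of two sequences; with
  closure under isomorphisms this covers every decomposition.
\<close>

locale n_angulated_category = additive_category D
  for n :: nat and D :: "('o, 'm) addcat" (structure)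
    and SO :: "'o \<Rightarrow> 'o" and SM :: "'m \<Rightarrow> 'm" and P :: "('o, 'm) sq set" +
  assumes automorphism: "additive_automorphism D SO SM"
    and P_seq: "(X, \<alpha>) \<in> P \<Longrightarrow> sigma_seq n D SO X \<alpha>"
    and F1_iso: "\<lbrakk>(X, \<alpha>) \<in> P; sigma_seq n D SO Y \<beta>; sigma_iso n D SM X \<alpha> Y \<beta> \<phi>\<rbrakk>
      \<Longrightarrow> (Y, \<beta>) \<in> P"
    and F1_sum: "\<lbrakk>(X, \<alpha>) \<in> P; (Y, \<beta>) \<in> P\<rbrakk>
      \<Longrightarrow> (sum_obj D X Y, sum_map n D SO SM X \<alpha> Y \<beta>) \<in> P"
    and F1_summand: "\<lbrakk>sigma_seq n D SO X \<alpha>; sigma_seq n D SO Y \<beta>;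
        (sum_obj D X Y, sum_map n D SO SM X \<alpha> Y \<beta>) \<in> P\<rbrakk> \<Longrightarrow> (X, \<alpha>) \<in> P \<and> (Y, \<beta>) \<in> P"
    and F1_triv: "A \<in> Obj D \<Longrightarrow> (triv_obj D A, triv_map n D SO A) \<in> P"
    and F1_first: "\<lbrakk>A \<in> Obj D; B \<in> Obj D; f \<in> Hom D A B\<rbrakk>
      \<Longrightarrow> \<exists>X \<alpha>. (X, \<alpha>) \<in> P \<and> X 0 = A \<and> X 1 = B \<and> \<alpha> 0 = f"
    and F2: "sigma_seq n D SO X \<alpha>
      \<Longrightarrow> (X, \<alpha>) \<in> P \<longleftrightarrow> (rot_obj n SO X, rot_map n D SO SM X \<alpha>) \<in> P"
    and F3: "\<lbrakk>(X, \<alpha>) \<in> P; (Y, \<beta>) \<in> P; \<phi>0 \<in> Hom D (X 0) (Y 0); \<phi>1 \<in> Hom D (X 1) (Y 1);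
        \<phi>1 \<odot> \<alpha> 0 = \<beta> 0 \<odot> \<phi>0\<rbrakk>
      \<Longrightarrow> \<exists>\<phi>. \<phi> 0 = \<phi>0 \<and> \<phi> 1 = \<phi>1 \<and> sigma_map n D SM X \<alpha> Y \<beta> \<phi>"
    and F4: "\<lbrakk>(X, \<alpha>) \<in> P; (Y, \<beta>) \<in> P; \<phi>0 \<in> Hom D (X 0) (Y 0); \<phi>1 \<in> Hom D (X 1) (Y 1);
        \<phi>1 \<odot> \<alpha> 0 = \<beta> 0 \<odot> \<phi>0\<rbrakk>
      \<Longrightarrow> \<exists>\<phi>. \<phi> 0 = \<phi>0 \<and> \<phi> 1 = \<phi>1 \<and> sigma_map n D SM X \<alpha> Y \<beta> \<phi> \<and>
        (angle_cone_obj n D SO X Y, angle_cone_map n D SO SM X \<alpha> Y \<beta> \<phi>) \<in> P"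

definition n_extension_closed :: "nat \<Rightarrow> ('o, 'm) addcat \<Rightarrow> ('o \<Rightarrow> 'o) \<Rightarrow>
    ('o, 'm) sq set \<Rightarrow> 'o set \<Rightarrow> bool" where
  "n_extension_closed n D SO P B \<longleftrightarrow>
    (\<forall>A \<in> B. \<forall>C \<in> B. \<forall>\<delta> \<in> Hom D C (SO A). \<exists>X \<alpha>. (X, \<alpha>) \<in> P \<and>
      X 0 = A \<and> X (n + 1) = C \<and> \<alpha> (n + 1) = \<delta> \<and> (\<forall>i\<in>{1..n}. X i \<in> B))"

definition ext_sequences :: "nat \<Rightarrow> ('o, 'm) addcat \<Rightarrow> ('o \<Rightarrow> 'o) \<Rightarrow>
    ('o, 'm) sq set \<Rightarrow> 'o set \<Rightarrow> ('o, 'm) sq set" where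
  "ext_sequences n D SO P B = {(X, d). (\<forall>i\<le>n + 1. X i \<in> B) \<and>
    (\<exists>\<delta> \<in> Hom D (X (n + 1)) (SO (X 0)). (X, d(n + 1 := \<delta>)) \<in> P)}"

end

theory Submission
  imports Defs "HOL-Algebra.Ring"
begin

text \<open>
  Angles are exact under \<open>D(T, -)\<close> and \<open>D(-, T)\<close>, and since there are no nonzero
  morphisms from \<open>\<Sigma>B\<close> to \<open>B\<close>, an angle with all terms in \<open>B\<close> becomes an
  \<open>n\<close>-exact sequence when its last map is forgotten.

  The class of angles is closed under homotopy retracts: adding elementary angles
  \<open>0 \<rightarrow> \<dots> \<rightarrow> A = A \<rightarrow> \<dots> \<rightarrow> 0\<close> absorbs the homotopy and turns a homotopy retract into a
  direct summand.  Applied to mapping cones this removes the summands on which a differential is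
  invertible, so a good morphism of angles with identical first or last terms has an angle as
  reduced cone.  These cones are the \<open>n\<close>-pushouts and \<open>n\<close>-pullbacks.  Taking such a
  cone twice, with all terms in \<open>B\<close>, shows that a composite of admissible monomorphisms (or
  epimorphisms) is admissible.

  For the closure under weak isomorphisms, exactness lifts the inverses of two consecutive
  components to a homotopy inverse.  If only the outer components are invertible, the obstruction to
  lifting is the class of an extension in \<open>B\<close>, which is shown to be split.

  Finally, the homotopy class of a sequence with connecting morphism \<open>\<delta>\<close> consists of all
  sequences that \<open>\<delta>\<close> completes to an angle.  So there are at most as many classes as
  morphisms \<open>C \<rightarrow> \<Sigma>A\<close>.
\<close>

section \<open>Calculus of morphisms\<close>

text \<open>An \<open>n\<close>-exact sequence weakly isomorphic to a member of the class comes
  without a connecting morphism, and its comparison with the member is only a homotopy equivalence.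
  (F1) speaks of isomorphisms and direct summands, and idempotents need not split, so homotopy
  retracts have to be made into summands. An angle that (F1) provides on a composite of admissible
  morphisms may have middle terms outside \<open>B\<close>. It is therefore assembled from cones,
  whose terms are direct sums of known terms. The mapping cone of (F4) is too large in two
  cyclically neighbouring positions, where a prescribed identity component links equal summands.
  Cancelling them leaves the cone of the truncated sequences, and the correction made in the
  cancellation produces its connecting morphism. The vanishing of \<open>D(\<Sigma>B, B)\<close>
  makes the outer maps of an angle monic and epic as seen from \<open>B\<close>. Two neighbouring
  invertible components then lift, but positions \<open>n + 1\<close> and \<open>0\<close> are
  neighbours only cyclically and no differential joins them; hence the separate obstruction.\<close>

text \<open>
  The type of a morphism is kept as one term \<open>Arw A B\<close>, so that a conditional rewrite rule can
  compute it and use both objects in its later premises.  For this the injectivity rule must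
  not be applied to the premises.
\<close>

datatype 'o arw = Arw 'o 'o | NoArw

declare arw.inject [simp del]

text \<open>The description is unambiguous because hom-sets are disjoint; \<open>NoArw\<close> takes
  the values outside all hom-sets, so that \<open>ty\<close> is total.\<close>

definition (in category) ty :: "'m \<Rightarrow> 'o arw" where
  "ty f = (if \<exists>A B. A \<in> Obj D \<and> B \<in> Obj D \<and> f \<in> Hom D A B
    then (THE t. \<exists>A B. t = Arw A B \<and> A \<in> Obj D \<and> B \<in> Obj D \<and> f \<in> Hom D A B) else NoArw)"

text \<open>Carrying the two object memberships along lets the simplifier, which unfolds
  \<open>hm_def\<close> through \<open>cat_simps\<close>, discharge the side conditions of rules
  such as \<open>zero_comp\<close> and \<open>ty_Dsum\<close>.\<close>

definition (in category) hm :: "'m \<Rightarrow> 'o \<Rightarrow> 'o \<Rightarrow> bool" where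
  "hm f A B \<longleftrightarrow> ty f = Arw A B \<and> A \<in> Obj D \<and> B \<in> Obj D"

context category
begin

lemma ty_iff: "ty f = Arw A B \<longleftrightarrow> A \<in> Obj D \<and> B \<in> Obj D \<and> f \<in> Hom D A B"
proof -
  have "(THE t. \<exists>A B. t = Arw A B \<and> A \<in> Obj D \<and> B \<in> Obj D \<and> f \<in> Hom D A B) = Arw A B"
    if "A \<in> Obj D \<and> B \<in> Obj D \<and> f \<in> Hom D A B" for A B
    using that by (intro the_equality) (auto simp: arw.inject dest: Hom_disjoint)
  then show ?thesis unfolding ty_def by (auto simp: arw.inject)
qed

lemma hm_ty: "hm f A B \<longleftrightarrow> ty f = Arw A B"
  by (auto simp: hm_def ty_iff)

lemma hm_iff: "hm f A B \<longleftrightarrow> A \<in> Obj D \<and> B \<in> Obj D \<and> f \<in> Hom D A B"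
  by (simp add: hm_ty ty_iff)

lemma ty_Obj: "ty f = Arw A B \<Longrightarrow> A \<in> Obj D" "ty f = Arw A B \<Longrightarrow> B \<in> Obj D"
  by (simp_all add: ty_iff)

lemma ty_comp: "ty f = Arw A B \<Longrightarrow> ty g = Arw B C \<Longrightarrow> ty (g \<odot> f) = Arw A C"
  unfolding ty_iff by (auto intro: Comp_in)

lemma ty_id: "A \<in> Obj D \<Longrightarrow> ty (Idm D A) = Arw A A"
  by (simp add: ty_iff Idm_in)

lemma comp_assoc:
  "\<lbrakk>ty f = Arw A B; ty g = Arw B C; ty h = Arw C E\<rbrakk> \<Longrightarrow> (h \<odot> g) \<odot> f = h \<odot> (g \<odot> f)"
  unfolding ty_iff by (auto intro: Comp_assoc)

lemma id_comp: "ty f = Arw A B \<Longrightarrow> Idm D B \<odot> f = f"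
  and comp_id: "ty f = Arw A B \<Longrightarrow> f \<odot> Idm D A = f"
  unfolding ty_iff by (auto intro: Idm_Comp Comp_Idm)

end

text \<open>\<open>mneg\<close> takes source and target as arguments. Reading them off
  \<open>ty\<close> gives a unary operation, for which rewrite rules like \<open>neg_comp\<close>
  and the normalisation by \<open>algebra\<close> can be stated.\<close>

definition (in additive_category) neg :: "'m \<Rightarrow> 'm" where
  "neg f = (case ty f of Arw A B \<Rightarrow> mneg D A B f | NoArw \<Rightarrow> f)"

context additive_category
begin

lemma hom_group_simps [simp]:
  "carrier (hom_group D A B) = Hom D A B"
  "mult (hom_group D A B) = Madd D"
  "one (hom_group D A B) = Mzero D A B"
  by (simp_all add: hom_group_def)

lemma mneg_eq: "ty f = Arw A B \<Longrightarrow> mneg D A B f = neg f"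
  by (auto simp: neg_def)

lemma ty_zero: "A \<in> Obj D \<Longrightarrow> B \<in> Obj D \<Longrightarrow> ty (Mzero D A B) = Arw A B"
  using monoid.one_closed[OF group.is_monoid[OF comm_group.axioms(2)[OF hom_comm_group]], of A B]
  by (simp add: ty_iff)

lemma ty_add: "ty f = Arw A B \<Longrightarrow> ty g = Arw A B \<Longrightarrow> ty (f \<boxplus> g) = Arw A B"
  using monoid.m_closed[OF group.is_monoid[OF comm_group.axioms(2)[OF hom_comm_group]], of A B f g]
  by (simp add: ty_iff)

lemma ty_neg: "ty f = Arw A B \<Longrightarrow> ty (neg f) = Arw A B"
  using group.inv_closed[OF comm_group.axioms(2)[OF hom_comm_group], of A B f]
    mneg_eq[of f A B] by (simp add: ty_iff mneg_def)

lemma hom_group_ty: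
  assumes "ty f = Arw A B"
  shows "comm_group (hom_group D A B)"
  using assms by (intro hom_comm_group) (auto simp: ty_iff)

lemma add_assoc:
  assumes "ty f = Arw A B" "ty g = Arw A B" "ty h = Arw A B"
  shows "(f \<boxplus> g) \<boxplus> h = f \<boxplus> (g \<boxplus> h)"
proof -
  interpret comm_group "hom_group D A B" using hom_group_ty[OF assms(1)] .
  from assms show ?thesis using m_assoc[of f g h] by (simp add: ty_iff)
qed

lemma add_comm:
  assumes "ty f = Arw A B" "ty g = Arw A B"
  shows "f \<boxplus> g = g \<boxplus> f"
proof -
  interpret comm_group "hom_group D A B" using hom_group_ty[OF assms(1)] .
  from assms show ?thesis using m_comm[of f g] by (simp add: ty_iff)
qed

lemma add_left_comm:
  assumes "ty f = Arw A B" "ty g = Arw A B" "ty h = Arw A B"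
  shows "f \<boxplus> (g \<boxplus> h) = g \<boxplus> (f \<boxplus> h)"
  using add_assoc[of f A B g h] add_assoc[of g A B f h] add_comm[of f A B g] assms by simp

lemma zero_add:
  assumes "ty f = Arw A B"
  shows "Mzero D A B \<boxplus> f = f"
proof -
  interpret comm_group "hom_group D A B" using hom_group_ty[OF assms(1)] .
  from assms show ?thesis using l_one[of f] by (simp add: ty_iff)
qed

lemma add_zero:
  assumes "ty f = Arw A B"
  shows "f \<boxplus> Mzero D A B = f"
  using zero_add[OF assms] add_comm[OF assms ty_zero] ty_Obj[OF assms] by simp

lemma add_neg:
  assumes "ty f = Arw A B"
  shows "f \<boxplus> neg f = Mzero D A B"
proof -
  interpret comm_group "hom_group D A B" using hom_group_ty[OF assms(1)] .
  from assms show ?thesis using r_inv[of f] mneg_eq[OF assms] by (simp add: ty_iff mneg_def)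
qed

lemma neg_add:
  assumes "ty f = Arw A B"
  shows "neg f \<boxplus> f = Mzero D A B"
  using add_neg[OF assms] add_comm[OF assms ty_neg[OF assms]] by simp

lemma add_neg_cancel:
  assumes "ty f = Arw A B" "ty g = Arw A B"
  shows "f \<boxplus> (neg f \<boxplus> g) = g" "neg f \<boxplus> (f \<boxplus> g) = g"
  using add_assoc[of f A B "neg f" g] add_assoc[of "neg f" A B f g] assms
  by (simp_all add: ty_neg zero_add add_neg neg_add)

lemma add_right_cancel:
  assumes "f \<boxplus> h = g \<boxplus> h" and "ty f = Arw A B" "ty g = Arw A B" "ty h = Arw A B"
  shows "f = g"
proof -
  interpret comm_group "hom_group D A B" using hom_group_ty[OF assms(2)] .
  show ?thesis using right_cancel[of h f g] assms by (simp add: ty_iff)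
qed

lemma eq_neg_if:
  assumes "f \<boxplus> g = Mzero D A B" "ty f = Arw A B" "ty g = Arw A B"
  shows "f = neg g"
  using assms by (intro add_right_cancel[of f g "neg g" A B]) (auto simp: ty_neg neg_add)

lemma neg_neg: "ty f = Arw A B \<Longrightarrow> neg (neg f) = f"
  using eq_neg_if[of f "neg f" A B] by (simp add: ty_neg add_neg)

lemma neg_zero: "A \<in> Obj D \<Longrightarrow> B \<in> Obj D \<Longrightarrow> neg (Mzero D A B) = Mzero D A B"
  using eq_neg_if[of "Mzero D A B" "Mzero D A B" A B]
  by (simp add: ty_zero zero_add)

lemma comp_add:
  assumes "ty f = Arw A B" "ty f' = Arw A B" "ty g = Arw B C"
  shows "g \<odot> (f \<boxplus> f') = (g \<odot> f) \<boxplus> (g \<odot> f')"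
  using assms unfolding ty_iff by (auto intro: Comp_Madd_right)

lemma add_comp:
  assumes "ty f = Arw A B" "ty g = Arw B C" "ty g' = Arw B C"
  shows "(g \<boxplus> g') \<odot> f = (g \<odot> f) \<boxplus> (g' \<odot> f)"
  using assms unfolding ty_iff by (auto intro: Comp_Madd_left)

lemma zero_comp:
  assumes "ty f = Arw A B" "C \<in> Obj D"
  shows "Mzero D B C \<odot> f = Mzero D A C"
proof (rule add_right_cancel)
  note o = ty_Obj[OF assms(1)]
  let ?z = "Mzero D B C \<odot> f"
  show "?z \<boxplus> ?z = Mzero D A C \<boxplus> ?z"
    using add_comp[OF assms(1), of "Mzero D B C" C "Mzero D B C"] assms o
    by (simp add: ty_zero ty_comp zero_add)
  show "ty ?z = Arw A C" "ty (Mzero D A C) = Arw A C" "ty ?z = Arw A C"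
    using assms o by (simp_all add: ty_zero ty_comp)
qed

lemma comp_zero:
  assumes "ty f = Arw B C" "A \<in> Obj D"
  shows "f \<odot> Mzero D A B = Mzero D A C"
proof (rule add_right_cancel)
  note o = ty_Obj[OF assms(1)]
  let ?z = "f \<odot> Mzero D A B"
  show "?z \<boxplus> ?z = Mzero D A C \<boxplus> ?z"
    using comp_add[of "Mzero D A B" A B "Mzero D A B", OF _ _ assms(1)] assms o
    by (simp add: ty_zero ty_comp zero_add)
  show "ty ?z = Arw A C" "ty (Mzero D A C) = Arw A C" "ty ?z = Arw A C"
    using assms o by (simp_all add: ty_zero ty_comp)
qed

lemma neg_comp:
  assumes "ty f = Arw A B" "ty g = Arw B C"
  shows "neg g \<odot> f = neg (g \<odot> f)"
proof (rule eq_neg_if)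
  show "neg g \<odot> f \<boxplus> g \<odot> f = Mzero D A C"
    using assms add_comp[of f A B "neg g" C g] ty_Obj[OF assms(2)]
    by (simp add: ty_neg neg_add zero_comp)
qed (use assms in \<open>auto simp: ty_comp ty_neg\<close>)

lemma comp_neg:
  assumes "ty f = Arw A B" "ty g = Arw B C"
  shows "g \<odot> neg f = neg (g \<odot> f)"
proof (rule eq_neg_if)
  show "g \<odot> neg f \<boxplus> g \<odot> f = Mzero D A C"
    using assms comp_add[of "neg f" A B f g C] ty_Obj[OF assms(1)]
    by (simp add: ty_neg neg_add comp_zero)
qed (use assms in \<open>auto simp: ty_comp ty_neg\<close>)

lemma neg_add_distrib:
  assumes "ty f = Arw A B" "ty g = Arw A B"
  shows "neg (f \<boxplus> g) = neg f \<boxplus> neg g"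
proof (rule eq_neg_if[symmetric])
  have "neg f \<boxplus> neg g \<boxplus> (f \<boxplus> g) = neg f \<boxplus> (f \<boxplus> (neg g \<boxplus> g))"
    using assms add_assoc[of "neg f" A B "neg g" "f \<boxplus> g"] add_left_comm[of "neg g" A B f g]
    by (simp add: ty_add ty_neg)
  then show "neg f \<boxplus> neg g \<boxplus> (f \<boxplus> g) = Mzero D A B"
    using assms ty_Obj[OF assms(1)] by (simp add: ty_neg ty_zero add_zero neg_add)
qed (use assms in \<open>auto simp: ty_add ty_neg\<close>)

lemma ty_Dsum:
  assumes "A \<in> Obj D" "B \<in> Obj D"
  shows "ty (Inl D A B) = Arw A (Dsum D A B)" "ty (Inr D A B) = Arw B (Dsum D A B)"
    "ty (Prl D A B) = Arw (Dsum D A B) A" "ty (Prr D A B) = Arw (Dsum D A B) B"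
  using assms by (auto simp: ty_iff Dsum_in Inl_in Inr_in Prl_in Prr_in)

text \<open>Composites are normalised with brackets to the right, so a known equation
  \<open>g \<odot> f = h\<close> applies inside a longer word only in this form.\<close>

lemma comp_reduce:
  assumes "g \<odot> f = h" "hm f A B" "hm g B C" "ty x = Arw T A"
  shows "g \<odot> (f \<odot> x) = h \<odot> x"
  using comp_assoc[of x T A f B g C] assms by (simp add: hm_def)

lemma Pr_In_comp:
  assumes "A \<in> Obj D" "B \<in> Obj D"
  shows "ty f = Arw C A \<Longrightarrow> Prl D A B \<odot> (Inl D A B \<odot> f) = f"
    "ty f = Arw C A \<Longrightarrow> Prr D A B \<odot> (Inl D A B \<odot> f) = Mzero D C B"
    "ty f = Arw C B \<Longrightarrow> Prr D A B \<odot> (Inr D A B \<odot> f) = f"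
    "ty f = Arw C B \<Longrightarrow> Prl D A B \<odot> (Inr D A B \<odot> f) = Mzero D C A"
  using assms comp_reduce[OF Prl_Inl, of A B] comp_reduce[OF Prr_Inl, of A B]
    comp_reduce[OF Prl_Inr, of A B] comp_reduce[OF Prr_Inr, of A B]
  by (auto simp: hm_ty ty_Dsum id_comp zero_comp)

lemmas cat_simps = hm_def ty_comp ty_id ty_add ty_neg ty_zero ty_Dsum Dsum_in Zobj_in
  comp_assoc id_comp comp_id zero_comp comp_zero comp_add add_comp zero_add add_zero
  add_neg neg_add add_neg_cancel neg_neg neg_zero neg_comp comp_neg neg_add_distrib
  Prl_Inl Prr_Inr Prl_Inr Prr_Inl Pr_In_comp add_assoc

lemmas [algebra add: additive_category "Mzero D" "Madd D" "neg" "Idm D" "Comp D"] =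
  cat_simps add_comm add_left_comm

lemma into_Dsum_eqI:
  assumes "hm f C (Dsum D A B)" "hm g C (Dsum D A B)" "A \<in> Obj D" "B \<in> Obj D"
    "Prl D A B \<odot> f = Prl D A B \<odot> g" "Prr D A B \<odot> f = Prr D A B \<odot> g"
  shows "f = g"
proof -
  have *: "h = Inl D A B \<odot> (Prl D A B \<odot> h) \<boxplus> Inr D A B \<odot> (Prr D A B \<odot> h)"
    if "hm h C (Dsum D A B)" for h
  proof -
    have "h = (Inl D A B \<odot> Prl D A B \<boxplus> Inr D A B \<odot> Prr D A B) \<odot> h"
      using that assms(3,4) by (simp only: Dsum_decomp) (simp add: cat_simps)
    also have "\<dots> = Inl D A B \<odot> (Prl D A B \<odot> h) \<boxplus> Inr D A B \<odot> (Prr D A B \<odot> h)"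
      using that assms(3,4) by (simp add: cat_simps)
    finally show ?thesis .
  qed
  show ?thesis using *[OF assms(1)] *[OF assms(2)] assms(5,6) by simp
qed

lemma out_Dsum_eqI:
  assumes "hm f (Dsum D A B) C" "hm g (Dsum D A B) C" "A \<in> Obj D" "B \<in> Obj D"
    "f \<odot> Inl D A B = g \<odot> Inl D A B" "f \<odot> Inr D A B = g \<odot> Inr D A B"
  shows "f = g"
proof -
  have *: "h = (h \<odot> Inl D A B) \<odot> Prl D A B \<boxplus> (h \<odot> Inr D A B) \<odot> Prr D A B"
    if "hm h (Dsum D A B) C" for h
  proof -
    have "h = h \<odot> (Inl D A B \<odot> Prl D A B \<boxplus> Inr D A B \<odot> Prr D A B)"
      using that assms(3,4) by (simp only: Dsum_decomp) (simp add: cat_simps)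
    also have "\<dots> = (h \<odot> Inl D A B) \<odot> Prl D A B \<boxplus> (h \<odot> Inr D A B) \<odot> Prr D A B"
      using that assms(3,4) by (simp add: cat_simps)
    finally show ?thesis .
  qed
  show ?thesis using *[OF assms(1)] *[OF assms(2)] assms(5,6) by simp
qed

lemma Dsum_Dsum_eqI:
  assumes "hm f (Dsum D A B) (Dsum D A' B')" "hm g (Dsum D A B) (Dsum D A' B')"
    and "A \<in> Obj D" "B \<in> Obj D" "A' \<in> Obj D" "B' \<in> Obj D"
    and "Prl D A' B' \<odot> (f \<odot> Inl D A B) = Prl D A' B' \<odot> (g \<odot> Inl D A B)"
    and "Prr D A' B' \<odot> (f \<odot> Inl D A B) = Prr D A' B' \<odot> (g \<odot> Inl D A B)"
    and "Prl D A' B' \<odot> (f \<odot> Inr D A B) = Prl D A' B' \<odot> (g \<odot> Inr D A B)"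
    and "Prr D A' B' \<odot> (f \<odot> Inr D A B) = Prr D A' B' \<odot> (g \<odot> Inr D A B)"
  shows "f = g"
  by (rule out_Dsum_eqI[OF assms(1-4)]; rule into_Dsum_eqI[of _ _ A' B'])
    (use assms in \<open>auto simp: cat_simps\<close>)

section \<open>Zero objects and isomorphisms\<close>

definition zero_object :: "'o \<Rightarrow> bool" where
  "zero_object A \<longleftrightarrow> A \<in> Obj D \<and> Idm D A = Mzero D A A"

lemma zero_object_Zobj: "zero_object (Zobj D)"
  by (simp add: zero_object_def Zobj_in Zobj_zero)

lemma zero_object_into:
  assumes "zero_object B" "hm f A B" shows "f = Mzero D A B"
  using assms id_comp[of f A B] zero_comp[of f A B B] by (auto simp: zero_object_def hm_def)

lemma zero_object_from:
  assumes "zero_object A" "hm f A B" shows "f = Mzero D A B"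
  using assms comp_id[of f A B] comp_zero[of f A B A] by (auto simp: zero_object_def hm_def)

lemma isomor_iff:
  assumes "A \<in> Obj D" "B \<in> Obj D"
  shows "isomor D A B f \<longleftrightarrow> hm f A B \<and> (\<exists>g. hm g B A \<and> g \<odot> f = Idm D A \<and> f \<odot> g = Idm D B)"
  using assms by (auto simp: isomor_def hm_iff)

lemma isomorI:
  assumes "hm f A B" "hm g B A" "g \<odot> f = Idm D A" "f \<odot> g = Idm D B"
  shows "isomor D A B f"
  using assms by (auto simp: isomor_def hm_iff)

lemma isomor_id: "A \<in> Obj D \<Longrightarrow> isomor D A A (Idm D A)"
  by (rule isomorI[of _ _ _ "Idm D A"]) (auto simp: cat_simps)

section \<open>Sequences over an angulated category\<close>

lemma row_typing:
  assumes "hm a A1 B" "hm b A2 B"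
  shows "hm (row D A1 A2 a b) (Dsum D A1 A2) B"
  using assms by (simp add: row_def cat_simps)

lemma col_typing:
  assumes "hm a A B1" "hm b A B2"
  shows "hm (col D B1 B2 a b) A (Dsum D B1 B2)"
  using assms by (simp add: col_def cat_simps)

text \<open>
  Idempotents of \<open>D\<close> need not split, so a retract of an angle is not yet a direct summand;
  complements in all positions make it one.
\<close>

definition has_complement :: "'m \<Rightarrow> 'o \<Rightarrow> 'o \<Rightarrow> bool" where
  "has_complement g A B \<longleftrightarrow> hm g A B \<and> (\<exists>W w s r. hm w W B \<and> hm s B A \<and> hm r B W \<and>
    s \<odot> g = Idm D A \<and> r \<odot> w = Idm D W \<and> s \<odot> w = Mzero D W A \<and> r \<odot> g = Mzero D A W \<and>
    g \<odot> s \<boxplus> w \<odot> r = Idm D B)"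

text \<open>The column is \<open>Inl \<odot> g\<close> followed by the shear of
  \<open>B \<oplus> C\<close> with entry \<open>u \<odot> s\<close>, where \<open>s\<close> is the
  retraction of \<open>g\<close>. The shear is invertible, so \<open>W \<oplus> C\<close> is a
  complement.\<close>

lemma has_complement_col:
  assumes g: "has_complement g A B" and u: "hm u A C"
  shows "has_complement (col D B C g u) A (Dsum D B C)"
proof -
  obtain W w s r where t: "hm w W B" "hm s B A" "hm r B W" "hm g A B"
    and e: "s \<odot> g = Idm D A" "r \<odot> w = Idm D W" "s \<odot> w = Mzero D W A" "r \<odot> g = Mzero D A W"
    and d: "g \<odot> s \<boxplus> w \<odot> r = Idm D B"
    using g unfolding has_complement_def by blast
  note e' = comp_reduce[OF e(1) t(4,2)] comp_reduce[OF e(2) t(1,3)] comp_reduce[OF e(3) t(1,2)]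
    comp_reduce[OF e(4) t(4,3)]
  let ?w = "Inl D B C \<odot> (w \<odot> Prl D W C) \<boxplus> Inr D B C \<odot> Prr D W C"
  let ?s = "s \<odot> Prl D B C"
  let ?r = "Inl D W C \<odot> (r \<odot> Prl D B C) \<boxplus> Inr D W C \<odot> (Prr D B C \<boxplus> neg (u \<odot> (s \<odot> Prl D B C)))"
  have d': "g \<odot> (s \<odot> Prl D B C) \<boxplus> w \<odot> (r \<odot> Prl D B C) = Prl D B C"
    using arg_cong[OF d, of "\<lambda>x. x \<odot> Prl D B C"] t u by (simp add: cat_simps)
  have "?r \<odot> ?w = Idm D (Dsum D W C)"
    by (rule Dsum_Dsum_eqI[where A = W and B = C and A' = W and B' = C])
      (use t u e e' in \<open>simp_all add: cat_simps\<close>)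
  moreover have "hm ?w (Dsum D W C) (Dsum D B C)" "hm ?s (Dsum D B C) A"
      "hm ?r (Dsum D B C) (Dsum D W C)"
    "hm (col D B C g u) A (Dsum D B C)"
    "?s \<odot> col D B C g u = Idm D A" "?s \<odot> ?w = Mzero D (Dsum D W C) A"
    "?r \<odot> col D B C g u = Mzero D A (Dsum D W C)"
    using t u e e' by (simp_all add: cat_simps col_def)
  moreover have "col D B C g u \<odot> ?s \<boxplus> ?w \<odot> ?r = Idm D (Dsum D B C)"
  proof (rule into_Dsum_eqI[where A = B and B = C])
    show "Prl D B C \<odot> (col D B C g u \<odot> ?s \<boxplus> ?w \<odot> ?r) = Prl D B C \<odot> Idm D (Dsum D B C)"
      using t u e e' d' by (simp add: cat_simps col_def)
    show "Prr D B C \<odot> (col D B C g u \<odot> ?s \<boxplus> ?w \<odot> ?r) = Prr D B C \<odot> Idm D (Dsum D B C)"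
      using t u e e' by (simp add: cat_simps col_def) algebra
  qed (use t u in \<open>auto simp: cat_simps col_def\<close>)
  ultimately show ?thesis unfolding has_complement_def by blast
qed

text \<open>This column is the graph of \<open>g\<close>: \<open>Prr\<close> is a retraction and the
  first summand is a complement. So an added summand that receives the identity gives any morphism a
  complement.\<close>

lemma has_complement_col_id:
  assumes "hm g A B"
  shows "has_complement (col D B A g (Idm D A)) A (Dsum D B A)"
proof -
  let ?r = "Prl D B A \<boxplus> neg (g \<odot> Prr D B A)"
  have "col D B A g (Idm D A) \<odot> Prr D B A \<boxplus> Inl D B A \<odot> ?r = Idm D (Dsum D B A)"
    by (rule Dsum_Dsum_eqI[where A = B and B = A and A' = B and B' = A])
      (use assms in \<open>simp_all add: cat_simps col_def\<close>)
  moreover have "hm (Inl D B A) B (Dsum D B A)" "hm (Prr D B A) (Dsum D B A) A"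
      "hm ?r (Dsum D B A) B"
    "hm (col D B A g (Idm D A)) A (Dsum D B A)"
    "Prr D B A \<odot> col D B A g (Idm D A) = Idm D A" "?r \<odot> Inl D B A = Idm D B"
    "Prr D B A \<odot> Inl D B A = Mzero D B A" "?r \<odot> col D B A g (Idm D A) = Mzero D A B"
    using assms by (simp_all add: cat_simps col_def)
  ultimately show ?thesis unfolding has_complement_def by blast
qed

text \<open>The retraction that comes with a complement need not be the component \<open>f\<close>
  of a given morphism of sequences. Replacing \<open>w\<close> by
  \<open>(1 - g \<odot> f) \<odot> w\<close> and keeping \<open>r\<close> adapts the complement to
  \<open>f\<close>.\<close>

lemma has_complement_adjust:
  assumes g: "has_complement g A B" and f: "hm f B A" "f \<odot> g = Idm D A"
  shows "\<exists>W w r. hm w W B \<and> hm r B W \<and> r \<odot> w = Idm D W \<and> f \<odot> w = Mzero D W A \<and>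
    r \<odot> g = Mzero D A W \<and> g \<odot> f \<boxplus> w \<odot> r = Idm D B"
proof -
  obtain W w s r where t: "hm w W B" "hm s B A" "hm r B W" "hm g A B"
    and e: "s \<odot> g = Idm D A" "r \<odot> w = Idm D W" "s \<odot> w = Mzero D W A" "r \<odot> g = Mzero D A W"
    and d: "g \<odot> s \<boxplus> w \<odot> r = Idm D B"
    using g unfolding has_complement_def by blast
  note e' = f(2) comp_reduce[OF e(1) t(4,2)] comp_reduce[OF e(2) t(1,3)] comp_reduce[OF e(3) t(1,2)]
    comp_reduce[OF e(4) t(4,3)] comp_reduce[OF f(2) t(4) f(1)]
  let ?w = "w \<boxplus> neg (g \<odot> (f \<odot> w))"
  have "f = f \<odot> (g \<odot> s \<boxplus> w \<odot> r)" using d f by (simp add: cat_simps)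
  then have fs: "f = s \<boxplus> f \<odot> (w \<odot> r)" using t f e' by (simp add: cat_simps)
  have "g \<odot> f \<boxplus> ?w \<odot> r = g \<odot> (s \<boxplus> f \<odot> (w \<odot> r)) \<boxplus> ?w \<odot> r"
    using fs by simp
  also have "\<dots> = g \<odot> s \<boxplus> w \<odot> r"
    using t f by algebra
  finally have "g \<odot> f \<boxplus> ?w \<odot> r = Idm D B" using d by simp
  moreover have "hm ?w W B" "r \<odot> ?w = Idm D W" "f \<odot> ?w = Mzero D W A"
    using t f e e' by (simp_all add: cat_simps)
  ultimately show ?thesis using t(3) e(4) by blast
qed

lemma chain_map_hm:
  assumes "\<And>i. i \<le> m \<Longrightarrow> X i \<in> Obj D" "\<And>i. i \<le> m \<Longrightarrow> Y i \<in> Obj D"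
  shows "chain_map D m X d Y e f \<longleftrightarrow> (\<forall>i\<le>m. hm (f i) (X i) (Y i)) \<and>
    (\<forall>i<m. f (Suc i) \<odot> d i = e i \<odot> f i)"
  using assms by (auto simp: chain_map_def hm_iff)

lemma eq_add_if_diff: "f \<boxplus> neg g = h \<Longrightarrow> ty f = Arw A B \<Longrightarrow> ty g = Arw A B \<Longrightarrow> f = h \<boxplus> g"
  by (auto simp: cat_simps)

lemma eq_if_neg_add:
  assumes "neg f \<boxplus> g = Mzero D A A'" "ty f = Arw A A'" "ty g = Arw A A'"
  shows "g = f"
  using add_neg_cancel(1)[OF assms(2,3)] add_zero[OF assms(2)] assms(1) by simp

end

section \<open>The automorphism, and sequences continued past position \<open>n + 1\<close>\<close>

context n_angulated_category
begin

lemma SO_in: "A \<in> Obj D \<Longrightarrow> SO A \<in> Obj D"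
  using automorphism by (auto simp: additive_automorphism_def bij_betw_def)

lemma SO_surj: "A \<in> Obj D \<Longrightarrow> \<exists>A'\<in>Obj D. SO A' = A"
  using automorphism unfolding additive_automorphism_def bij_betw_def by (metis imageE)

lemma SM_bij: "A \<in> Obj D \<Longrightarrow> B \<in> Obj D \<Longrightarrow> bij_betw SM (Hom D A B) (Hom D (SO A) (SO B))"
  using automorphism by (auto simp: additive_automorphism_def)

lemma hm_SM: "hm f A B \<Longrightarrow> hm (SM f) (SO A) (SO B)"
  using SM_bij SO_in by (auto simp: bij_betw_def hm_iff)

lemma SM_surj: "hm g (SO A) (SO B) \<Longrightarrow> A \<in> Obj D \<Longrightarrow> B \<in> Obj D \<Longrightarrow> \<exists>f. hm f A B \<and> SM f = g"
  using SM_bij[of A B] unfolding bij_betw_def hm_iff by (metis imageE)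

lemma SM_inj: "SM f = SM g \<Longrightarrow> hm f A B \<Longrightarrow> hm g A B \<Longrightarrow> f = g"
  using SM_bij[of A B] by (auto simp: bij_betw_def hm_iff inj_on_def)

lemma ty_SM: "ty f = Arw A B \<Longrightarrow> ty (SM f) = Arw (SO A) (SO B)"
  using hm_SM by (simp add: hm_ty)

lemma SM_id: "A \<in> Obj D \<Longrightarrow> SM (Idm D A) = Idm D (SO A)"
  using automorphism unfolding additive_automorphism_def by blast

lemma SM_comp:
  assumes "ty f = Arw A B" "ty g = Arw B C"
  shows "SM (g \<odot> f) = SM g \<odot> SM f"
  using assms automorphism unfolding additive_automorphism_def ty_iff by metis

lemma SM_add:
  assumes "ty f = Arw A B" "ty g = Arw A B"
  shows "SM (f \<boxplus> g) = SM f \<boxplus> SM g"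
  using assms automorphism unfolding additive_automorphism_def ty_iff by metis

lemma SM_zero: "A \<in> Obj D \<Longrightarrow> B \<in> Obj D \<Longrightarrow> SM (Mzero D A B) = Mzero D (SO A) (SO B)"
proof (rule add_right_cancel)
  assume "A \<in> Obj D" "B \<in> Obj D"
  then show "SM (Mzero D A B) \<boxplus> SM (Mzero D A B) = Mzero D (SO A) (SO B) \<boxplus> SM (Mzero D A B)"
    using SM_add[of "Mzero D A B" A B "Mzero D A B"] by (simp add: cat_simps ty_SM SO_in)
qed (auto simp: cat_simps ty_SM SO_in)

lemma SM_neg: "ty f = Arw A B \<Longrightarrow> SM (neg f) = neg (SM f)"
  using SM_add[of "neg f" A B f] ty_Obj[of f A B]
  by (intro eq_neg_if[of _ _ "SO A" "SO B"]) (auto simp: cat_simps ty_SM SO_in SM_zero)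

lemma zero_object_SO: "zero_object A \<Longrightarrow> zero_object (SO A)"
  using SM_id SM_zero by (metis zero_object_def SO_in)

lemma SM_Pr_In:
  assumes "A \<in> Obj D" "B \<in> Obj D"
  shows "SM (Prl D A B) \<odot> SM (Inl D A B) = Idm D (SO A)"
    "SM (Prr D A B) \<odot> SM (Inl D A B) = Mzero D (SO A) (SO B)"
    "SM (Prr D A B) \<odot> SM (Inr D A B) = Idm D (SO B)"
    "SM (Prl D A B) \<odot> SM (Inr D A B) = Mzero D (SO B) (SO A)"
  using assms
  by (simp_all add: Prl_Inl Prr_Inl Prl_Inr Prr_Inr SM_id SM_zero
      flip: SM_comp[OF ty_Dsum(1) ty_Dsum(3)] SM_comp[OF ty_Dsum(1) ty_Dsum(4)]
        SM_comp[OF ty_Dsum(2) ty_Dsum(3)] SM_comp[OF ty_Dsum(2) ty_Dsum(4)])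

lemma SM_Pr_In_comp:
  assumes "A \<in> Obj D" "B \<in> Obj D"
  shows "ty f = Arw C (SO A) \<Longrightarrow> SM (Prl D A B) \<odot> (SM (Inl D A B) \<odot> f) = f"
    "ty f = Arw C (SO A) \<Longrightarrow> SM (Prr D A B) \<odot> (SM (Inl D A B) \<odot> f) = Mzero D C (SO B)"
    "ty f = Arw C (SO B) \<Longrightarrow> SM (Prr D A B) \<odot> (SM (Inr D A B) \<odot> f) = f"
    "ty f = Arw C (SO B) \<Longrightarrow> SM (Prl D A B) \<odot> (SM (Inr D A B) \<odot> f) = Mzero D C (SO A)"
proof -
  have t: "hm (SM (Inl D A B)) (SO A) (SO (Dsum D A B))"
      "hm (SM (Inr D A B)) (SO B) (SO (Dsum D A B))"
    "hm (SM (Prl D A B)) (SO (Dsum D A B)) (SO A)" "hm (SM (Prr D A B)) (SO (Dsum D A B)) (SO B)"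
    using assms by (auto simp: cat_simps ty_SM SO_in)
  note SM_Pr_In[OF assms, THEN comp_reduce]
  from this(1)[OF t(1,3)] this(2)[OF t(1,4)] this(3)[OF t(2,4)] this(4)[OF t(2,3)]
  show "ty f = Arw C (SO A) \<Longrightarrow> SM (Prl D A B) \<odot> (SM (Inl D A B) \<odot> f) = f"
    "ty f = Arw C (SO A) \<Longrightarrow> SM (Prr D A B) \<odot> (SM (Inl D A B) \<odot> f) = Mzero D C (SO B)"
    "ty f = Arw C (SO B) \<Longrightarrow> SM (Prr D A B) \<odot> (SM (Inr D A B) \<odot> f) = f"
    "ty f = Arw C (SO B) \<Longrightarrow> SM (Prl D A B) \<odot> (SM (Inr D A B) \<odot> f) = Mzero D C (SO A)"
    using assms by (simp_all add: id_comp zero_comp SO_in)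
qed

lemmas ang_simps = SM_Pr_In SM_Pr_In_comp cat_simps SO_in ty_SM SM_id SM_comp SM_add SM_zero SM_neg

lemmas [algebra add: n_angulated_category "Mzero D" "Madd D" "neg" "Idm D" "SM" "Comp D"] =
  ang_simps add_comm add_left_comm

text \<open>
  A \<open>\<Sigma>\<close>-sequence and a morphism of such are continued by \<open>X (n + 2) = SO (X 0)\<close> and
  \<open>f (n + 2) = SM (f 0)\<close>, so that the last square is treated as all others.
\<close>

definition xo :: "(nat \<Rightarrow> 'o) \<Rightarrow> nat \<Rightarrow> 'o" where
  "xo X i = (if i \<le> n + 1 then X i else SO (X 0))"

definition xm :: "(nat \<Rightarrow> 'm) \<Rightarrow> nat \<Rightarrow> 'm" where
  "xm f i = (if i \<le> n + 1 then f i else SM (f 0))"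

lemma xo_le [simp]: "i \<le> Suc n \<Longrightarrow> xo X i = X i" and xo_last: "xo X (Suc (Suc n)) = SO (X 0)"
  and xm_le [simp]: "i \<le> Suc n \<Longrightarrow> xm f i = f i" and xm_last: "xm f (Suc (Suc n)) = SM (f 0)"
  by (simp_all add: xo_def xm_def)

lemma all_le_Suc: "(\<forall>i\<le>Suc m. Q i) \<longleftrightarrow> (\<forall>i\<le>m. Q i) \<and> Q (Suc m)"
  by (auto simp: le_Suc_eq)

lemma seq_iff:
  "sigma_seq n D SO X \<alpha> \<longleftrightarrow> (\<forall>i\<le>Suc n. X i \<in> Obj D) \<and> (\<forall>i\<le>Suc n. hm (\<alpha> i) (X i) (xo X (Suc i)))"
proof -
  have "X (Suc i) \<in> Obj D" if "i \<le> n" "\<forall>i\<le>Suc n. X i \<in> Obj D" for i using that by auto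
  then show ?thesis
    unfolding sigma_seq_def Suc_eq_plus1[symmetric] all_le_Suc[of n
        "\<lambda>i. hm (\<alpha> i) (X i) (xo X (Suc i))"]
    by (auto simp: hm_iff SO_in xo_last)
qed

lemma map_iff:
  assumes "sigma_seq n D SO X \<alpha>" "sigma_seq n D SO Y \<beta>"
  shows "sigma_map n D SM X \<alpha> Y \<beta> f \<longleftrightarrow> (\<forall>i\<le>Suc n. hm (f i) (X i) (Y i)) \<and>
    (\<forall>i\<le>Suc n. xm f (Suc i) \<odot> \<alpha> i = \<beta> i \<odot> f i)"
  using assms unfolding sigma_map_def seq_iff Suc_eq_plus1[symmetric] all_le_Suc
  by (auto simp: hm_iff xm_last)

lemma xo_in: "(\<And>i. i \<le> Suc n \<Longrightarrow> X i \<in> Obj D) \<Longrightarrow> i \<le> Suc (Suc n) \<Longrightarrow> xo X i \<in> Obj D"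
  by (cases "i = Suc (Suc n)") (auto simp: xo_last SO_in)

lemma xm_hm:
  assumes "\<And>i. i \<le> Suc n \<Longrightarrow> hm (f i) (X i) (Y i)" "i \<le> Suc (Suc n)"
  shows "hm (xm f i) (xo X i) (xo Y i)"
  using assms(1)[of i] assms(1)[of 0] assms(2)
  by (cases "i = Suc (Suc n)") (auto simp: xm_last xo_last hm_SM)

lemma xm_cong: "(\<And>i. i \<le> Suc n \<Longrightarrow> f i = g i) \<Longrightarrow> i \<le> Suc (Suc n) \<Longrightarrow> xm f i = xm g i"
  by (auto simp: xm_def)

lemma xm_comp:
  assumes "\<And>i. i \<le> Suc n \<Longrightarrow> hm (f i) (X i) (Y i)" "\<And>i. i \<le> Suc n \<Longrightarrow> hm (g i) (Y i) (Z i)"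
  shows "xm (\<lambda>i. g i \<odot> f i) i = xm g i \<odot> xm f i"
  using assms(1)[of 0] assms(2)[of 0] by (auto simp: xm_def ang_simps)

lemma xm_add:
  assumes "\<And>i. i \<le> Suc n \<Longrightarrow> hm (f i) (X i) (Y i)" "\<And>i. i \<le> Suc n \<Longrightarrow> hm (g i) (X i) (Y i)"
  shows "xm (\<lambda>i. f i \<boxplus> g i) i = xm f i \<boxplus> xm g i"
  using assms(1)[of 0] assms(2)[of 0] by (auto simp: xm_def ang_simps)

lemma xm_id: "(\<And>i. i \<le> Suc n \<Longrightarrow> X i \<in> Obj D) \<Longrightarrow> xm (\<lambda>i. Idm D (X i)) i = Idm D (xo X i)"
  by (auto simp: xm_def xo_def ang_simps)

lemma xm_zero: "(\<And>i. i \<le> Suc n \<Longrightarrow> X i \<in> Obj D) \<Longrightarrow> (\<And>i. i \<le> Suc n \<Longrightarrow> Y i \<in> Obj D) \<Longrightarrow>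
    xm (\<lambda>i. Mzero D (X i) (Y i)) i = Mzero D (xo X i) (xo Y i)"
  by (auto simp: xm_def xo_def ang_simps)

text \<open>In position \<open>n + 2\<close> the continued injections are \<open>SM (Inl ..)\<close>
  and \<open>SM (Inr ..)\<close>, the two entries of \<open>sigma_dsum\<close>. This removes the
  case distinction from \<open>sum_map\<close>.\<close>

lemma sum_map_eq:
  assumes "sigma_seq n D SO X \<alpha>" "sigma_seq n D SO Y \<beta>" "i \<le> Suc n"
  shows "sum_map n D SO SM X \<alpha> Y \<beta> i =
    xm (\<lambda>i. Inl D (X i) (Y i)) (Suc i) \<odot> (\<alpha> i \<odot> Prl D (X i) (Y i)) \<boxplus>
    xm (\<lambda>i. Inr D (X i) (Y i)) (Suc i) \<odot> (\<beta> i \<odot> Prr D (X i) (Y i))"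
proof (cases "i \<le> n")
  case True
  moreover have "hm (\<alpha> i) (X i) (xo X (Suc i))" "hm (\<beta> i) (Y i) (xo Y (Suc i))"
    using assms by (auto simp: seq_iff)
  ultimately have "hm (\<alpha> i) (X i) (X (Suc i))" "hm (\<beta> i) (Y i) (Y (Suc i))" by auto
  then show ?thesis using True
    by (simp add: sum_map_def mat_def row_def col_def cat_simps)
next
  case False
  then have i: "i = Suc n" using assms by simp
  have "hm (\<alpha> (Suc n)) (X (Suc n)) (xo X (Suc (Suc n)))"
    "hm (\<beta> (Suc n)) (Y (Suc n)) (xo Y (Suc (Suc n)))"
    "X 0 \<in> Obj D" "Y 0 \<in> Obj D"
    using assms unfolding seq_iff by blast+
  then show ?thesis unfolding i
    by (simp add: sum_map_def sigma_dsum_def mat_def row_def col_def ang_simps xm_last xo_last)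
qed

lemma sum_seq:
  assumes X: "sigma_seq n D SO X \<alpha>" and Y: "sigma_seq n D SO Y \<beta>"
  shows "sigma_seq n D SO (sum_obj D X Y) (sum_map n D SO SM X \<alpha> Y \<beta>)"
  unfolding seq_iff
proof (intro conjI allI impI)
  fix i assume i: "i \<le> Suc n"
  have o: "X i \<in> Obj D" "Y i \<in> Obj D" if "i \<le> Suc n" for i using X Y that by (auto simp: seq_iff)
  then show "sum_obj D X Y i \<in> Obj D" using i by (simp add: sum_obj_def cat_simps)
  have "hm (\<alpha> i) (X i) (xo X (Suc i))" "hm (\<beta> i) (Y i) (xo Y (Suc i))"
    using X Y i by (auto simp: seq_iff)
  moreover have "hm (xm (\<lambda>i. Inl D (X i) (Y i)) (Suc i)) (xo X (Suc i)) (xo (sum_obj D X Y) (Suc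
      i))"
     "hm (xm (\<lambda>i. Inr D (X i) (Y i)) (Suc i)) (xo Y (Suc i)) (xo (sum_obj D X Y) (Suc i))"
    by (rule xm_hm; use i o in \<open>auto simp: sum_obj_def cat_simps\<close>)+
  ultimately show "hm (sum_map n D SO SM X \<alpha> Y \<beta> i) (sum_obj D X Y i) (xo (sum_obj D X Y) (Suc i))"
    using i o by (simp add: sum_map_eq[OF X Y] cat_simps sum_obj_def)
qed

lemma col_map:
  assumes X: "sigma_seq n D SO X \<alpha>" and Y: "sigma_seq n D SO Y \<beta>" and S: "sigma_seq n D SO S \<sigma>"
    and g: "sigma_map n D SM Y \<beta> X \<alpha> g" and u: "sigma_map n D SM Y \<beta> S \<sigma> u"
  shows "sigma_map n D SM Y \<beta> (sum_obj D X S) (sum_map n D SO SM X \<alpha> S \<sigma>)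
    (\<lambda>i. col D (X i) (S i) (g i) (u i))"
proof -
  have o: "X i \<in> Obj D" "S i \<in> Obj D" "Y i \<in> Obj D"
    "hm (\<alpha> i) (X i) (xo X (Suc i))" "hm (\<sigma> i) (S i) (xo S (Suc i))"
    "hm (g i) (Y i) (X i)" "hm (u i) (Y i) (S i)" "hm (\<beta> i) (Y i) (xo Y (Suc i))"
    "xm g (Suc i) \<odot> \<beta> i = \<alpha> i \<odot> g i" "xm u (Suc i) \<odot> \<beta> i = \<sigma> i \<odot> u i"
    if "i \<le> Suc n" for i using g u X Y S that
        by (auto simp: seq_iff map_iff[OF Y X] map_iff[OF Y S])
  show ?thesis unfolding map_iff[OF Y sum_seq[OF X S]]
  proof (intro conjI allI impI)
    fix i assume i: "i \<le> Suc n"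
    show "hm (col D (X i) (S i) (g i) (u i)) (Y i) (sum_obj D X S i)"
      using o[OF i] by (simp add: sum_obj_def col_typing)
    have h: "hm (xm (\<lambda>i. Inl D (X i) (S i)) (Suc i)) (xo X (Suc i)) (xo (sum_obj D X S) (Suc i))"
     "hm (xm (\<lambda>i. Inr D (X i) (S i)) (Suc i)) (xo S (Suc i)) (xo (sum_obj D X S) (Suc i))"
     "hm (xm g (Suc i)) (xo Y (Suc i)) (xo X (Suc i))"
     "hm (xm u (Suc i)) (xo Y (Suc i)) (xo S (Suc i))"
      by (rule xm_hm; use i o in \<open>auto simp: sum_obj_def cat_simps\<close>)+
    have c: "xm (\<lambda>i. col D (X i) (S i) (g i) (u i)) (Suc i) =
      xm (\<lambda>i. Inl D (X i) (S i)) (Suc i) \<odot> xm g (Suc i) \<boxplus> xm (\<lambda>i. Inr D (X i) (S i)) (Suc i) \<odot> xm u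
          (Suc i)"
      unfolding col_def using o
      apply (subst xm_add[of _ Y "sum_obj D X S"])
        apply (auto simp: cat_simps sum_obj_def)[2]
      apply (subst xm_comp[of _ Y X _ "sum_obj D X S"])
        apply (auto simp: cat_simps sum_obj_def)[2]
      apply (subst xm_comp[of _ Y S _ "sum_obj D X S"])
        apply (auto simp: cat_simps sum_obj_def)
      done
    show "xm (\<lambda>i. col D (X i) (S i) (g i) (u i)) (Suc i) \<odot> \<beta> i =
      sum_map n D SO SM X \<alpha> S \<sigma> i \<odot> col D (X i) (S i) (g i) (u i)"
      unfolding c sum_map_eq[OF X S i] using o[OF i] h by (simp add: cat_simps col_def)
  qed
qed

lemma row_map:
  assumes X: "sigma_seq n D SO X \<alpha>" and Y: "sigma_seq n D SO Y \<beta>" and S: "sigma_seq n D SO S \<sigma>"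
    and f: "sigma_map n D SM X \<alpha> Y \<beta> f" and v: "sigma_map n D SM S \<sigma> Y \<beta> v"
  shows "sigma_map n D SM (sum_obj D X S) (sum_map n D SO SM X \<alpha> S \<sigma>) Y \<beta>
    (\<lambda>i. row D (X i) (S i) (f i) (v i))"
proof -
  have o: "X i \<in> Obj D" "S i \<in> Obj D" "Y i \<in> Obj D"
    "hm (\<alpha> i) (X i) (xo X (Suc i))" "hm (\<sigma> i) (S i) (xo S (Suc i))"
    "hm (f i) (X i) (Y i)" "hm (v i) (S i) (Y i)" "hm (\<beta> i) (Y i) (xo Y (Suc i))"
    "xm f (Suc i) \<odot> \<alpha> i = \<beta> i \<odot> f i" "xm v (Suc i) \<odot> \<sigma> i = \<beta> i \<odot> v i"
    if "i \<le> Suc n" for i using f v X Y S that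
        by (auto simp: seq_iff map_iff[OF X Y] map_iff[OF S Y])
  show ?thesis unfolding map_iff[OF sum_seq[OF X S] Y]
  proof (intro conjI allI impI)
    fix i assume i: "i \<le> Suc n"
    show "hm (row D (X i) (S i) (f i) (v i)) (sum_obj D X S i) (Y i)"
      using o[OF i] by (simp add: sum_obj_def row_typing)
    have h: "hm (xm (\<lambda>i. Inl D (X i) (S i)) (Suc i)) (xo X (Suc i)) (xo (sum_obj D X S) (Suc i))"
     "hm (xm (\<lambda>i. Inr D (X i) (S i)) (Suc i)) (xo S (Suc i)) (xo (sum_obj D X S) (Suc i))"
     "hm (xm (\<lambda>i. row D (X i) (S i) (f i) (v i)) (Suc i)) (xo (sum_obj D X S) (Suc i)) (xo Y (Suc
         i))"
     "hm (xm f (Suc i)) (xo X (Suc i)) (xo Y (Suc i))"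
     "hm (xm v (Suc i)) (xo S (Suc i)) (xo Y (Suc i))"
      by (rule xm_hm; use i o in \<open>auto simp: sum_obj_def row_def cat_simps\<close>)+
    \<comment> \<open>In positions up to \<open>n + 1\<close> this is the evaluation of a row on an
      injection; \<open>xm_cong\<close> carries the equation over to position
      \<open>n + 2\<close>.\<close>
    have "xm (\<lambda>i. row D (X i) (S i) (f i) (v i)) (Suc i) \<odot> xm (\<lambda>i. Inl D (X i) (S i)) (Suc i) = xm f
        (Suc i)"
      apply (subst xm_comp[of _ X "sum_obj D X S" _ Y, symmetric])
      using o i by (auto intro!: xm_cong simp: cat_simps sum_obj_def row_def)
    moreover have "xm (\<lambda>i. row D (X i) (S i) (f i) (v i)) (Suc i) \<odot> xm (\<lambda>i. Inr D (X i) (S i)) (Suc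
        i) = xm v (Suc i)"
      apply (subst xm_comp[of _ S "sum_obj D X S" _ Y, symmetric])
      using o i by (auto intro!: xm_cong simp: cat_simps sum_obj_def row_def)
    ultimately show "xm (\<lambda>i. row D (X i) (S i) (f i) (v i)) (Suc i) \<odot> sum_map n D SO SM X \<alpha> S \<sigma> i =
      \<beta> i \<odot> row D (X i) (S i) (f i) (v i)"
      unfolding sum_map_eq[OF X S i] using o[OF i] h
      by (simp add: cat_simps row_def comp_reduce[of
          "xm (\<lambda>i. row D (X i) (S i) (f i) (v i)) (Suc i)"])
        (simp add: cat_simps flip: comp_assoc)
  qed
qed

end

section \<open>Homotopy retracts of angles\<close>

locale angulated = n_angulated_category n D SO SM P
  for n :: nat and D :: "('o, 'm) addcat" (structure)
    and SO :: "'o \<Rightarrow> 'o" and SM :: "'m \<Rightarrow> 'm" and P :: "('o, 'm) sq set" +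
  assumes n_pos: "1 \<le> n"
begin

lemma seqD:
  assumes "sigma_seq n D SO X \<alpha>"
  shows "i \<le> Suc n \<Longrightarrow> X i \<in> Obj D" "i \<le> Suc n \<Longrightarrow> hm (\<alpha> i) (X i) (xo X (Suc i))"
    "i \<le> Suc (Suc n) \<Longrightarrow> xo X i \<in> Obj D" "i \<le> n \<Longrightarrow> hm (\<alpha> i) (X i) (X (Suc i))"
    "hm (\<alpha> (Suc n)) (X (Suc n)) (SO (X 0))"
proof -
  have *: "X i \<in> Obj D" "hm (\<alpha> i) (X i) (xo X (Suc i))" if "i \<le> Suc n" for i
    using assms that by (auto simp: seq_iff)
  then show "i \<le> Suc n \<Longrightarrow> X i \<in> Obj D" "i \<le> Suc n \<Longrightarrow> hm (\<alpha> i) (X i) (xo X (Suc i))" by blast+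
  show "i \<le> Suc (Suc n) \<Longrightarrow> xo X i \<in> Obj D" by (rule xo_in) (use * in auto)
  show "i \<le> n \<Longrightarrow> hm (\<alpha> i) (X i) (X (Suc i))" using *(2)[of i] by simp
  show "hm (\<alpha> (Suc n)) (X (Suc n)) (SO (X 0))" using *(2)[of "Suc n"] by (simp add: xo_last)
qed

lemma mapD:
  assumes "sigma_map n D SM X \<alpha> Y \<beta> f" "sigma_seq n D SO X \<alpha>" "sigma_seq n D SO Y \<beta>"
  shows "i \<le> Suc n \<Longrightarrow> hm (f i) (X i) (Y i)"
    "i \<le> Suc (Suc n) \<Longrightarrow> hm (xm f i) (xo X i) (xo Y i)"
    "i \<le> Suc n \<Longrightarrow> xm f (Suc i) \<odot> \<alpha> i = \<beta> i \<odot> f i"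
    "i \<le> n \<Longrightarrow> f (Suc i) \<odot> \<alpha> i = \<beta> i \<odot> f i"
    "SM (f 0) \<odot> \<alpha> (Suc n) = \<beta> (Suc n) \<odot> f (Suc n)"
proof -
  note * = assms(1)[unfolded map_iff[OF assms(2,3)]]
  then show "i \<le> Suc n \<Longrightarrow> hm (f i) (X i) (Y i)" "i \<le> Suc n \<Longrightarrow> xm f (Suc i) \<odot> \<alpha> i = \<beta> i \<odot> f i" by auto
  show "i \<le> Suc (Suc n) \<Longrightarrow> hm (xm f i) (xo X i) (xo Y i)" by (rule xm_hm) (use * in auto)
  show "i \<le> n \<Longrightarrow> f (Suc i) \<odot> \<alpha> i = \<beta> i \<odot> f i" using *[THEN conjunct2, rule_format, of i] by simp
  show "SM (f 0) \<odot> \<alpha> (Suc n) = \<beta> (Suc n) \<odot> f (Suc n)"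
    using *[THEN conjunct2, rule_format, of "Suc n"] by (simp add: xm_last)
qed

text \<open>The identities form an isomorphism between two pairs of functions that agree on the
  constrained positions, so (F1) makes membership in \<open>P\<close> independent of the values
  beyond.\<close>

lemma P_cong:
  assumes "(X, \<alpha>) \<in> P" "\<And>i. i \<le> Suc n \<Longrightarrow> Y i = X i" "\<And>i. i \<le> Suc n \<Longrightarrow> \<beta> i = \<alpha> i"
  shows "(Y, \<beta>) \<in> P"
proof -
  note X = P_seq[OF assms(1)]
  have Y: "sigma_seq n D SO Y \<beta>"
    using X assms(2,3) unfolding sigma_seq_def by simp
  have "sigma_map n D SM X \<alpha> Y \<beta> (\<lambda>i. Idm D (X i))"
    unfolding map_iff[OF X Y]
  proof (intro conjI allI impI)
    fix i assume i: "i \<le> Suc n"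
    show "hm (Idm D (X i)) (X i) (Y i)" using seqD[OF X] assms i by (simp add: cat_simps)
    have "xm (\<lambda>i. Idm D (X i)) (Suc i) = Idm D (xo X (Suc i))"
      by (rule xm_id) (use seqD[OF X] in auto)
    then show "xm (\<lambda>i. Idm D (X i)) (Suc i) \<odot> \<alpha> i = \<beta> i \<odot> Idm D (X i)"
      using seqD[OF X] assms(3) i by (simp add: cat_simps)
  qed
  then have "sigma_iso n D SM X \<alpha> Y \<beta> (\<lambda>i. Idm D (X i))"
    unfolding sigma_iso_def using assms(2) seqD[OF X] by (auto intro: isomor_id)
  then show ?thesis using F1_iso assms(1) Y by blast
qed

section \<open>Rotation and elementary angles\<close>

lemma rot_seq:
  assumes "sigma_seq n D SO X \<alpha>"
  shows "sigma_seq n D SO (rot_obj n SO X) (rot_map n D SO SM X \<alpha>)"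
  unfolding seq_iff
proof (intro conjI allI impI)
  note s = seqD[OF assms]
  fix i assume i: "i \<le> Suc n"
  show "rot_obj n SO X i \<in> Obj D" using s(1)[of "Suc i"] s(1)[of 0] i
      by (auto simp: rot_obj_def SO_in)
  have m: "hm (\<alpha> 0) (X 0) (X (Suc 0))" using s(2)[of 0] by simp
  consider "i < n" | "i = n" | "i = Suc n" using i by linarith
  then show "hm (rot_map n D SO SM X \<alpha> i) (rot_obj n SO X i) (xo (rot_obj n SO X) (Suc i))"
  proof cases
    case 1 then show ?thesis using s(2)[of "Suc i"] by (simp add: rot_obj_def rot_map_def)
  next
    case 2 then show ?thesis using s(2)[of "Suc i"] by (simp add: rot_obj_def rot_map_def xo_last)
  next
    case 3
    have "mneg D (SO (X 0)) (SO (X (Suc 0))) (SM (\<alpha> 0)) = neg (SM (\<alpha> 0))"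
      using m by (intro mneg_eq) (simp add: hm_def ty_SM)
    then show ?thesis using 3 m by (simp add: rot_obj_def rot_map_def xo_last ang_simps)
  qed
qed

text \<open>For \<open>k = 0\<close> the sequence is isomorphic to the trivial angle of (F1). A left
  rotation lowers the position of the isomorphism by one, which is the induction step.\<close>

lemma elementary_angle:
  assumes "sigma_seq n D SO X \<alpha>" "k \<le> n" "isomor D (X k) (X (Suc k)) (\<alpha> k)"
    and "\<And>i. i \<le> Suc n \<Longrightarrow> i \<noteq> k \<Longrightarrow> i \<noteq> Suc k \<Longrightarrow> zero_object (X i)"
  shows "(X, \<alpha>) \<in> P"
  using assms
proof (induction k arbitrary: X \<alpha>)
  case 0
  note X = 0(1) and s = seqD[OF 0(1)]
  let ?T = "triv_obj D (X 0)" and ?t = "triv_map n D SO (X 0)"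
  let ?f = "\<lambda>i. if i = 0 then Idm D (X 0) else if i = 1 then \<alpha> 0 else Mzero D (Zobj D) (X i)"
  have T: "(?T, ?t) \<in> P" using F1_triv s(1)[of 0] by simp
  note t = seqD[OF P_seq[OF T]]
  have z: "zero_object (X i)" if "i \<le> Suc n" "1 < i" for i using 0 that by simp
  have a0: "hm (\<alpha> 0) (X 0) (X (Suc 0))" using s(2)[of 0] by simp
  have iso: "isomor D (?T i) (X i) (?f i)" if i: "i \<le> Suc n" for i
  proof -
    consider "i = 0" | "i = 1" | "1 < i" by linarith
    then show ?thesis
    proof cases
      case 3
      have "isomor D (Zobj D) (X i) (Mzero D (Zobj D) (X i))"
        using z[OF i 3] s(1)[OF i]
        by (intro isomorI[of _ _ _ "Mzero D (X i) (Zobj D)"])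
          (auto simp: cat_simps zero_object_def Zobj_zero)
      then show ?thesis using 3 by (simp add: triv_obj_def)
    qed (use 0 s(1)[of 0] in \<open>auto simp: triv_obj_def isomor_id\<close>)
  qed
  have f: "hm (?f i) (?T i) (X i)" if "i \<le> Suc n" for i
    using iso[OF that] isomor_iff[of "?T i" "X i" "?f i"] t(1) s(1) that by blast
  have "sigma_map n D SM ?T ?t X \<alpha> ?f"
    unfolding map_iff[OF P_seq[OF T] X]
  proof (intro conjI allI impI)
    fix i assume i: "i \<le> Suc n"
    show "hm (?f i) (?T i) (X i)" using f i .
    have h: "hm (xm ?f (Suc i)) (xo ?T (Suc i)) (xo X (Suc i))"
      by (rule xm_hm) (use f i in auto)
    have l: "hm (xm ?f (Suc i) \<odot> ?t i) (?T i) (xo X (Suc i))"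
      and r: "hm (\<alpha> i \<odot> ?f i) (?T i) (xo X (Suc i))"
      using h t(2)[OF i] f[OF i] s(2)[OF i] by (auto simp: cat_simps)
    consider "i = 0" | "i = 1" | "1 < i" by linarith
    then show "xm ?f (Suc i) \<odot> ?t i = \<alpha> i \<odot> ?f i"
    proof cases
      case 1 then show ?thesis using a0 by (simp add: triv_map_def cat_simps)
    next
      case 2
      then have "zero_object (xo X (Suc i))" using z[of "Suc i"] n_pos by simp
      then show ?thesis using zero_object_into[OF _ l] zero_object_into[OF _ r] by (simp only:)
    next
      case 3
      then have "zero_object (?T i)" by (simp add: triv_obj_def zero_object_Zobj)
      then show ?thesis using zero_object_from[OF _ l] zero_object_from[OF _ r] by (simp only:)
    qed
  qed
  with iso have "sigma_iso n D SM ?T ?t X \<alpha> ?f" by (simp add: sigma_iso_def)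
  then show ?case using F1_iso T X by blast
next
  case (Suc k)
  have "(rot_obj n SO X, rot_map n D SO SM X \<alpha>) \<in> P"
  proof (rule Suc.IH)
    show "isomor D (rot_obj n SO X k) (rot_obj n SO X (Suc k)) (rot_map n D SO SM X \<alpha> k)"
      using Suc.prems by (simp add: rot_obj_def rot_map_def)
    show "zero_object (rot_obj n SO X i)" if "i \<le> Suc n" "i \<noteq> k" "i \<noteq> Suc k" for i
      using Suc.prems(4)[of "Suc i"] Suc.prems(4)[of 0] that
          by (auto simp: rot_obj_def zero_object_SO)
  qed (use Suc.prems rot_seq in auto)
  then show ?case using F2 Suc.prems(1) by blast
qed

lemma elementary_angle_last:
  assumes X: "sigma_seq n D SO X \<alpha>" and "isomor D (X (Suc n)) (SO (X 0)) (\<alpha> (Suc n))"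
    and z: "\<And>i. 1 \<le> i \<Longrightarrow> i \<le> n \<Longrightarrow> zero_object (X i)"
  shows "(X, \<alpha>) \<in> P"
proof -
  have "(rot_obj n SO X, rot_map n D SO SM X \<alpha>) \<in> P"
    by (rule elementary_angle[of _ _ n])
      (use assms rot_seq in \<open>auto simp: rot_obj_def rot_map_def\<close>)
  then show ?thesis using F2 X by blast
qed

text \<open>The complements \<open>W i\<close> form a sequence themselves, and \<open>X\<close> is
  isomorphic to the direct sum of \<open>Y\<close> and \<open>W\<close> by the columns of
  \<open>f\<close> and \<open>r\<close>. Then (F1) splits off \<open>Y\<close>.\<close>

lemma retract_with_complements_in_P:
  assumes X: "(X, \<alpha>) \<in> P" and Y: "sigma_seq n D SO Y \<beta>"
    and f: "sigma_map n D SM X \<alpha> Y \<beta> f" and g: "sigma_map n D SM Y \<beta> X \<alpha> g"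
    and fg: "\<And>i. i \<le> Suc n \<Longrightarrow> f i \<odot> g i = Idm D (Y i)"
    and c: "\<And>i. i \<le> Suc n \<Longrightarrow> has_complement (g i) (Y i) (X i)"
  shows "(Y, \<beta>) \<in> P"
proof -
  note X' = P_seq[OF X]
  note x = seqD[OF X'] and y = seqD[OF Y] and fD = mapD[OF f X' Y] and gD = mapD[OF g Y X']
  have "\<forall>i. \<exists>W w r. i \<le> Suc n \<longrightarrow> hm w W (X i) \<and> hm r (X i) W \<and> r \<odot> w = Idm D W \<and>
      f i \<odot> w = Mzero D W (Y i) \<and> r \<odot> g i = Mzero D (Y i) W \<and> g i \<odot> f i \<boxplus> w \<odot> r = Idm D (X i)"
    using has_complement_adjust[OF c fD(1) fg] by blast
  then obtain W w r where "\<And>i. i \<le> Suc n \<Longrightarrow> hm (w i) (W i) (X i) \<and> hm (r i) (X i) (W i) \<and>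
      r i \<odot> w i = Idm D (W i) \<and> f i \<odot> w i = Mzero D (W i) (Y i) \<and>
      r i \<odot> g i = Mzero D (Y i) (W i) \<and> g i \<odot> f i \<boxplus> w i \<odot> r i = Idm D (X i)"
    by metis
  then have t: "\<And>i. i \<le> Suc n \<Longrightarrow> hm (w i) (W i) (X i)" "\<And>i. i \<le> Suc n \<Longrightarrow> hm (r i) (X i) (W i)"
    and e: "\<And>i. i \<le> Suc n \<Longrightarrow> r i \<odot> w i = Idm D (W i)"
        "\<And>i. i \<le> Suc n \<Longrightarrow> f i \<odot> w i = Mzero D (W i) (Y i)"
      "\<And>i. i \<le> Suc n \<Longrightarrow> r i \<odot> g i = Mzero D (Y i) (W i)"
      "\<And>i. i \<le> Suc n \<Longrightarrow> g i \<odot> f i \<boxplus> w i \<odot> r i = Idm D (X i)"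
    by blast+
  have o: "W i \<in> Obj D" if "i \<le> Suc n" for i using t[OF that] by (simp add: hm_def)
  define \<gamma> where "\<gamma> i = xm r (Suc i) \<odot> (\<alpha> i \<odot> w i)" for i
  have xr: "hm (xm r (Suc i)) (xo X (Suc i)) (xo W (Suc i))" if "i \<le> Suc n" for i
    by (rule xm_hm) (use t that in auto)
  have W: "sigma_seq n D SO W \<gamma>"
    unfolding seq_iff using o xr t x by (auto simp: \<gamma>_def cat_simps)
  let ?h = "\<lambda>i. col D (Y i) (W i) (f i) (r i)"
  let ?S = "sum_obj D Y W" and ?s = "sum_map n D SO SM Y \<beta> W \<gamma>"
  have r: "sigma_map n D SM X \<alpha> W \<gamma> r"
    unfolding map_iff[OF X' W]
  proof (intro conjI allI impI)
    fix i assume i: "i \<le> Suc n"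
    show "hm (r i) (X i) (W i)" using t i by blast
    have rg: "xm r (Suc i) \<odot> xm g (Suc i) = Mzero D (xo Y (Suc i)) (xo W (Suc i))"
      apply (subst xm_comp[symmetric, of _ Y X _ W])
      using t gD e o y by (auto intro: xm_cong[THEN trans, OF _ _ xm_zero] simp: i)
    have z: "xm r (Suc i) \<odot> (xm g (Suc i) \<odot> u) = Mzero D T (xo W (Suc i))"
        if "ty u = Arw T (xo Y (Suc i))" for u T
      using comp_reduce[OF rg gD(2) xr, of u T] that i ty_Obj[OF that] seqD(3)[OF W, of "Suc i"]
      by (simp add: cat_simps)
    have "\<alpha> i \<odot> (g i \<odot> f i) = xm g (Suc i) \<odot> (\<beta> i \<odot> f i)"
      using gD(1-3)[of i] gD(2)[of "Suc i"] fD(1)[of i] x y i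
          by (simp add: cat_simps flip: comp_assoc)
    then have z': "xm r (Suc i) \<odot> (\<alpha> i \<odot> (g i \<odot> f i)) = Mzero D (X i) (xo W (Suc i))"
      using z[of "\<beta> i \<odot> f i" "X i"] fD(1)[OF i] y(2)[OF i] by (simp add: cat_simps)
    \<comment> \<open>Insertion of the decomposition of the identity of \<open>X i\<close>: the part
      through \<open>g i\<close> is killed, since \<open>g\<close> is a morphism and
      \<open>r \<odot> g\<close> is zero.\<close>
    have "xm r (Suc i) \<odot> \<alpha> i = xm r (Suc i) \<odot> (\<alpha> i \<odot> (g i \<odot> f i \<boxplus> w i \<odot> r i))"
      using e(4)[OF i] xr[OF i] x(2)[OF i] by (simp add: cat_simps)
    also have "\<dots> = \<gamma> i \<odot> r i"
      using z' xr[OF i] x(2)[OF i] fD(1)[OF i] gD(1)[OF i] t[OF i]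
      by (simp add: cat_simps \<gamma>_def)
    finally show "xm r (Suc i) \<odot> \<alpha> i = \<gamma> i \<odot> r i" .
  qed
  have "isomor D (X i) (?S i) (?h i)" if i: "i \<le> Suc n" for i
  proof (rule isomorI)
    show "hm (?h i) (X i) (?S i)" "hm (row D (Y i) (W i) (g i) (w i)) (?S i) (X i)"
      using t[OF i] fD(1)[OF i] gD(1)[OF i] by (auto simp: sum_obj_def col_def row_def cat_simps)
    show "row D (Y i) (W i) (g i) (w i) \<odot> ?h i = Idm D (X i)"
      using t[OF i] e[OF i] fD(1)[OF i] gD(1)[OF i] by (simp add: col_def row_def cat_simps)
    have "?h i \<odot> row D (Y i) (W i) (g i) (w i) = Idm D (Dsum D (Y i) (W i))"
      by (rule Dsum_Dsum_eqI[where A = "Y i" and A' = "Y i" and B = "W i" and B' = "W i"])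
        (use t[OF i] e(1-3)[OF i] fD(1)[OF i] gD(1)[OF i] fg[OF i]
            in \<open>simp_all add: col_def row_def cat_simps\<close>)
    then show "?h i \<odot> row D (Y i) (W i) (g i) (w i) = Idm D (?S i)" by (simp add: sum_obj_def)
  qed
  with col_map[OF Y X' W f r] have "sigma_iso n D SM X \<alpha> ?S ?s ?h"
    by (simp add: sigma_iso_def)
  then have "(?S, ?s) \<in> P" using F1_iso X sum_seq[OF Y W] by blast
  then show ?thesis using F1_summand Y W by blast
qed

text \<open>The composite across the end is included because it gives the last square of the map in
  \<open>to_elem_map\<close> for \<open>k = 0\<close>.\<close>

definition sigma_complex :: "(nat \<Rightarrow> 'o) \<Rightarrow> (nat \<Rightarrow> 'm) \<Rightarrow> bool" where
  "sigma_complex Y \<beta> \<longleftrightarrow> sigma_seq n D SO Y \<beta> \<and>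
    (\<forall>i\<le>n. \<beta> (Suc i) \<odot> \<beta> i = Mzero D (Y i) (xo Y (Suc (Suc i)))) \<and>
    SM (\<beta> 0) \<odot> \<beta> (Suc n) = Mzero D (Y (Suc n)) (SO (Y 1))"

definition elem_obj :: "'o \<Rightarrow> nat \<Rightarrow> nat \<Rightarrow> 'o" where
  "elem_obj A k i = (if i = k \<or> i = Suc k then A else Zobj D)"

definition elem_map :: "'o \<Rightarrow> nat \<Rightarrow> nat \<Rightarrow> 'm" where
  "elem_map A k i = (if i = k then Idm D A else Mzero D (elem_obj A k i) (xo (elem_obj A k) (Suc
      i)))"

lemma elem_seq:
  assumes "A \<in> Obj D" "k \<le> n"
  shows "sigma_seq n D SO (elem_obj A k) (elem_map A k)"
  unfolding seq_iff
proof (intro conjI allI impI)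
  have o: "elem_obj A k i \<in> Obj D" for i using assms by (simp add: elem_obj_def Zobj_in)
  fix i assume i: "i \<le> Suc n"
  show "elem_obj A k i \<in> Obj D" by (rule o)
  have "xo (elem_obj A k) (Suc i) \<in> Obj D" by (rule xo_in) (use o i in auto)
  moreover have "xo (elem_obj A k) (Suc k) = A" using assms by (simp add: elem_obj_def)
  ultimately show "hm (elem_map A k i) (elem_obj A k i) (xo (elem_obj A k) (Suc i))"
    using o assms by (auto simp: elem_map_def hm_def ty_zero ty_id) (auto simp: elem_obj_def ty_id)
qed

lemma elem_in_P:
  assumes "A \<in> Obj D" "k \<le> n"
  shows "(elem_obj A k, elem_map A k) \<in> P"
proof (rule elementary_angle[OF elem_seq[OF assms] assms(2)])
  show "isomor D (elem_obj A k k) (elem_obj A k (Suc k)) (elem_map A k k)"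
    using assms by (simp add: elem_obj_def elem_map_def isomor_id)
qed (auto simp: elem_obj_def zero_object_Zobj)

text \<open>Followed by the map of \<open>from_elem_map\<close> with \<open>v = h (k + 1)\<close>,
  this gives \<open>h (k + 1) \<odot> \<beta> k\<close> in position \<open>k\<close> and
  \<open>\<beta> k \<odot> h (k + 1)\<close> in position \<open>k + 1\<close>: exactly the
  contribution of one component \<open>h (k + 1)\<close> to a null-homotopic map.\<close>

lemma to_elem_map:
  assumes Y: "sigma_complex Y \<beta>" and k: "k \<le> n" and A: "A = Y (Suc k)"
  shows "sigma_map n D SM Y \<beta> (elem_obj A k) (elem_map A k)
    (\<lambda>i. if i = k then \<beta> k else if i = Suc k then Idm D A else Mzero D (Y i) (Zobj D))"
    (is "sigma_map _ _ _ _ _ _ _ ?u")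
proof -
  have Ys: "sigma_seq n D SO Y \<beta>" using Y by (simp add: sigma_complex_def)
  note y = seqD[OF Ys]
  have Ao: "A \<in> Obj D" using y(1)[of "Suc k"] k A by simp
  have u: "hm (?u i) (Y i) (elem_obj A k i)" if "i \<le> Suc n" for i
    using y(1)[OF that] y(4)[OF k] Ao A by (auto simp: elem_obj_def cat_simps)
  note e = seqD[OF elem_seq[OF Ao k]]
  have xk: "xo (elem_obj A k) (Suc k) = A" using k by (simp add: elem_obj_def)
  show ?thesis unfolding map_iff[OF Ys elem_seq[OF Ao k]]
  proof (intro conjI allI impI)
    fix i assume i: "i \<le> Suc n"
    show "hm (?u i) (Y i) (elem_obj A k i)" by (rule u[OF i])
    have h: "hm (xm ?u (Suc i)) (xo Y (Suc i)) (xo (elem_obj A k) (Suc i))"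
      by (rule xm_hm) (use u i in auto)
    have r0: "elem_map A k i \<odot> ?u i = Mzero D (Y i) (xo (elem_obj A k) (Suc i))" if "i \<noteq> k"
      using that u[OF i] e(1,2)[OF i] e(3)[of "Suc i"] i by (simp add: elem_map_def cat_simps)
    consider "i = k" | "Suc i = k" | "i = Suc n" "k = 0"
      | "i \<noteq> k" "Suc i \<noteq> k" "\<not> (i = Suc n \<and> k = 0)" by blast
    then show "xm ?u (Suc i) \<odot> \<beta> i = elem_map A k i \<odot> ?u i"
    proof cases
      case 1
      then show ?thesis using k y(4)[OF k] A by (simp add: elem_map_def cat_simps)
    next
      case 2
      then have "\<beta> k \<odot> \<beta> i = Mzero D (Y i) (xo Y (Suc (Suc i)))"
        using Y k unfolding sigma_complex_def by auto
      then show ?thesis using 2 r0 k A xk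
        by (auto simp: elem_obj_def)
    next
      case 3
      then show ?thesis using r0 Y A by (simp add: xm_last xo_last elem_obj_def sigma_complex_def)
    next
      case 4
      then have "zero_object (xo (elem_obj A k) (Suc i))"
        using i zero_object_Zobj zero_object_SO by (auto simp: xo_def elem_obj_def)
      moreover have "hm (xm ?u (Suc i) \<odot> \<beta> i) (Y i) (xo (elem_obj A k) (Suc i))"
        using h y(2)[OF i] by (simp add: cat_simps)
      ultimately have "xm ?u (Suc i) \<odot> \<beta> i = Mzero D (Y i) (xo (elem_obj A k) (Suc i))"
        by (rule zero_object_into)
      then show ?thesis using r0 4 by simp
    qed
  qed
qed

lemma from_elem_map:
  assumes Y: "sigma_complex Y \<beta>" and k: "k \<le> n" and v: "hm v A (Y k)"
  shows "sigma_map n D SM (elem_obj A k) (elem_map A k) Y \<beta>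
    (\<lambda>i. if i = k then v else if i = Suc k then \<beta> k \<odot> v else Mzero D (Zobj D) (Y i))"
    (is "sigma_map _ _ _ _ _ _ _ ?v")
proof -
  have Ys: "sigma_seq n D SO Y \<beta>" using Y by (simp add: sigma_complex_def)
  note y = seqD[OF Ys]
  have Ao: "A \<in> Obj D" using v by (simp add: hm_def)
  have u: "hm (?v i) (elem_obj A k i) (Y i)" if "i \<le> Suc n" for i
    using y(1)[OF that] y(4)[OF k] Ao v by (auto simp: elem_obj_def cat_simps)
  note e = seqD[OF elem_seq[OF Ao k]]
  have xk: "xo (elem_obj A k) (Suc k) = A" using k by (simp add: elem_obj_def)
  show ?thesis unfolding map_iff[OF elem_seq[OF Ao k] Ys]
  proof (intro conjI allI impI)
    fix i assume i: "i \<le> Suc n"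
    show "hm (?v i) (elem_obj A k i) (Y i)" by (rule u[OF i])
    have h: "hm (xm ?v (Suc i)) (xo (elem_obj A k) (Suc i)) (xo Y (Suc i))"
      by (rule xm_hm) (use u i in auto)
    have l0: "xm ?v (Suc i) \<odot> elem_map A k i = Mzero D (elem_obj A k i) (xo Y (Suc i))" if "i \<noteq> k"
      using that h e(1)[OF i] e(3)[of "Suc i"] i by (simp add: elem_map_def cat_simps)
    consider "i = k" | "i = Suc k" | "i \<noteq> k" "i \<noteq> Suc k" by blast
    then show "xm ?v (Suc i) \<odot> elem_map A k i = \<beta> i \<odot> ?v i"
    proof cases
      case 1
      then show ?thesis using k y(4)[OF k] v by (simp add: elem_map_def cat_simps)
    next
      case 2
      have b: "\<beta> (Suc k) \<odot> \<beta> k = Mzero D (Y k) (xo Y (Suc (Suc k)))"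
        using Y k unfolding sigma_complex_def by blast
      have "\<beta> i \<odot> (\<beta> k \<odot> v) = Mzero D A (xo Y (Suc i))"
        using comp_reduce[OF b y(4)[OF k] y(2)[of "Suc k"], of v A] v y(3)[of "Suc i"] i k 2
        by (simp add: cat_simps)
      then show ?thesis using 2 l0 by (simp add: elem_obj_def)
    next
      case 3
      then show ?thesis using l0 y(2)[OF i] u[OF i] by (simp add: elem_obj_def cat_simps)
    qed
  qed
qed

text \<open>The elementary angle across the end. The angles \<open>elem_obj\<close> used for the
  homotopy create complements in positions \<open>1\<close> to \<open>n + 1\<close>; this one
  creates the complement in position \<open>0\<close>.\<close>

definition last_obj :: "'o \<Rightarrow> nat \<Rightarrow> 'o" where
  "last_obj A i = (if i = 0 then A else if i = Suc n then SO A else Zobj D)"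

definition last_map :: "'o \<Rightarrow> nat \<Rightarrow> 'm" where
  "last_map A i = (if i = Suc n then Idm D (SO A) else Mzero D (last_obj A i) (last_obj A (Suc i)))"

lemma last_seq: "A \<in> Obj D \<Longrightarrow> sigma_seq n D SO (last_obj A) (last_map A)"
  unfolding seq_iff by (auto simp: cat_simps SO_in xo_def last_obj_def last_map_def)

lemma last_in_P: "A \<in> Obj D \<Longrightarrow> (last_obj A, last_map A) \<in> P"
  by (rule elementary_angle_last[OF last_seq])
    (auto simp: isomor_id SO_in zero_object_Zobj last_obj_def last_map_def)

text \<open>The contribution of the components \<open>h 1\<close> to \<open>h m\<close> alone, so
  that they can be removed one after the other, from \<open>m = n + 1\<close> downwards.\<close>

definition homotopy_part :: "(nat \<Rightarrow> 'o) \<Rightarrow> (nat \<Rightarrow> 'm) \<Rightarrow> (nat \<Rightarrow> 'm) \<Rightarrow> nat \<Rightarrow> nat \<Rightarrow> 'm" where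
  "homotopy_part Y \<beta> h m i =
    (if 1 \<le> i \<and> i \<le> m then \<beta> (i - 1) \<odot> h i else Mzero D (Y i) (Y i)) \<boxplus>
    (if i < m then h (Suc i) \<odot> \<beta> i else Mzero D (Y i) (Y i))"

text \<open>
  Adding to \<open>X\<close> the elementary angle on \<open>Y (k + 1)\<close> in positions \<open>k\<close>,
  \<open>k + 1\<close> removes the component \<open>h (k + 1)\<close> of the homotopy, and it makes the
  morphism from \<open>Y\<close> a split monomorphism with complement in position \<open>k + 1\<close>.
\<close>

lemma homotopy_retract_induct:
  assumes Y: "sigma_complex Y \<beta>" and X: "(X, \<alpha>) \<in> P"
    and f: "sigma_map n D SM X \<alpha> Y \<beta> f" and g: "sigma_map n D SM Y \<beta> X \<alpha> g"
    and m: "m \<le> Suc n" and h: "\<And>i. 1 \<le> i \<Longrightarrow> i \<le> m \<Longrightarrow> hm (h i) (Y i) (Y (i - 1))"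
    and fg: "\<And>i. i \<le> Suc n \<Longrightarrow> f i \<odot> g i \<boxplus> homotopy_part Y \<beta> h m i = Idm D (Y i)"
    and c: "\<And>i. i \<le> Suc n \<Longrightarrow> i = 0 \<or> m < i \<Longrightarrow> has_complement (g i) (Y i) (X i)"
  shows "(Y, \<beta>) \<in> P"
  using X f g m h fg c
proof (induction m arbitrary: X \<alpha> f g)
  case 0
  have Ys: "sigma_seq n D SO Y \<beta>" using Y by (simp add: sigma_complex_def)
  have "f i \<odot> g i = Idm D (Y i)" if i: "i \<le> Suc n" for i
    using 0(6)[OF i] mapD(1)[OF 0(2) P_seq[OF 0(1)] Ys i] mapD(1)[OF 0(3) Ys P_seq[OF 0(1)] i]
        seqD(1)[OF Ys i]
    by (auto simp: homotopy_part_def cat_simps split: if_splits)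
  then show ?case using retract_with_complements_in_P[OF 0(1) Ys 0(2,3)] 0(7) by auto
next
  case (Suc k)
  have Ys: "sigma_seq n D SO Y \<beta>" using Y by (simp add: sigma_complex_def)
  note y = seqD[OF Ys] and X = P_seq[OF Suc.prems(1)]
  note fD = mapD[OF Suc.prems(2) X Ys] and gD = mapD[OF Suc.prems(3) Ys X]
  have k: "k \<le> n" using Suc.prems by simp
  have hk: "hm (h (Suc k)) (Y (Suc k)) (Y k)" using Suc.prems(5)[of "Suc k"] by simp
  let ?A = "Y (Suc k)"
  let ?u = "\<lambda>i. if i = k then \<beta> k else if i = Suc k then Idm D ?A else Mzero D (Y i) (Zobj D)"
  let ?v = "\<lambda>i. if i = k then h (Suc k) else
      if i = Suc k then \<beta> k \<odot> h (Suc k) else Mzero D (Zobj D) (Y i)"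
  let ?S = "elem_obj ?A k" and ?s = "elem_map ?A k"
  have A: "?A \<in> Obj D" using y(1)[of "Suc k"] k by simp
  have S: "(?S, ?s) \<in> P" by (rule elem_in_P[OF A k])
  note u = to_elem_map[OF Y k refl] and v = from_elem_map[OF Y k hk]
  note uD = mapD(1)[OF u Ys P_seq[OF S]] and vD = mapD(1)[OF v P_seq[OF S] Ys]
  let ?X = "sum_obj D X ?S" and ?x = "sum_map n D SO SM X \<alpha> ?S ?s"
  let ?f = "\<lambda>i. row D (X i) (?S i) (f i) (?v i)" and ?g = "\<lambda>i. col D (X i) (?S i) (g i) (?u i)"
  show ?case
  proof (rule Suc.IH)
    show "(?X, ?x) \<in> P" by (rule F1_sum[OF Suc.prems(1) S])
    show "sigma_map n D SM ?X ?x Y \<beta> ?f" by (rule row_map[OF X Ys P_seq[OF S] Suc.prems(2) v])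
    show "sigma_map n D SM Y \<beta> ?X ?x ?g" by (rule col_map[OF X Ys P_seq[OF S] Suc.prems(3) u])
    show "k \<le> Suc n" using k by simp
    show "hm (h i) (Y i) (Y (i - 1))" if "1 \<le> i" "i \<le> k" for i using Suc.prems(5) that by simp
    show "?f i \<odot> ?g i \<boxplus> homotopy_part Y \<beta> h k i = Idm D (Y i)" if i: "i \<le> Suc n" for i
    proof -
      have "?f i \<odot> ?g i = f i \<odot> g i \<boxplus> ?v i \<odot> ?u i"
        using uD[OF i] vD[OF i] fD(1)[OF i] gD(1)[OF i] by (simp only: row_def col_def cat_simps)
      moreover have "?v i \<odot> ?u i \<boxplus> homotopy_part Y \<beta> h k i = homotopy_part Y \<beta> h (Suc k) i"
      proof -
        consider "i = k" | "i = Suc k" | "i < k" | "i > Suc k" by linarith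
        then show ?thesis
        proof cases
          case 1
          have "hm (if 1 \<le> i then \<beta> (i - 1) \<odot> h i else Mzero D (Y i) (Y i)) (Y i) (Y i)"
            using Suc.prems(5)[of i] y(4)[of "i - 1"] y(1)[OF i] 1 k by (auto simp: cat_simps)
          then show ?thesis unfolding homotopy_part_def
            using 1 hk y(4)[OF k] k add_comm[of "h (Suc k) \<odot> \<beta> k" "Y k" "Y k"]
                by (auto simp: cat_simps)
        next
          case 2
          then show ?thesis unfolding homotopy_part_def
            using hk y(4)[OF k] A by (simp add: cat_simps)
        next
          case 3
          have "hm (homotopy_part Y \<beta> h k i) (Y i) (Y i)"
            using Suc.prems(5)[of i] Suc.prems(5)[of "Suc i"] y(4)[of
                "i - 1"] y(4)[of i] y(1)[OF i] 3 k
            unfolding homotopy_part_def by (auto simp: cat_simps)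
          moreover have "homotopy_part Y \<beta> h (Suc k) i = homotopy_part Y \<beta> h k i"
            using 3 by (auto simp: homotopy_part_def)
          ultimately show ?thesis using 3 y(1)[OF i] by (simp add: cat_simps)
        next
          case 4
          then show ?thesis using y(1)[OF i] by (simp add: homotopy_part_def cat_simps)
        qed
      qed
      moreover have "hm (homotopy_part Y \<beta> h k i) (Y i) (Y i)"
        using Suc.prems(5)[of i] Suc.prems(5)[of "Suc i"] y(4)[of "i - 1"] y(4)[of i] y(1)[OF i] k
        unfolding homotopy_part_def by (auto simp: cat_simps)
      ultimately show ?thesis
        using Suc.prems(6)[OF i] uD[OF i] vD[OF i] fD(1)[OF i] gD(1)[OF i]
          add_assoc[of "f i \<odot> g i" "Y i" "Y i" "?v i \<odot> ?u i" "homotopy_part Y \<beta> h k i"]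
        by (simp only: cat_simps)
    qed
    show "has_complement (?g i) (Y i) (?X i)" if i: "i \<le> Suc n" "i = 0 \<or> k < i" for i
    proof (cases "i = Suc k")
      case True
      then show ?thesis using has_complement_col_id[OF gD(1)[OF i(1)]]
        by (simp add: sum_obj_def elem_obj_def)
    next
      case False
      \<comment> \<open>Positions treated before keep their complement when a further summand is
        added.\<close>
      then have "has_complement (g i) (Y i) (X i)" using Suc.prems(7)[OF i(1)] i(2) by auto
      from has_complement_col[OF this uD[OF i(1)]] show ?thesis by (simp only: sum_obj_def)
    qed
  qed
qed

text \<open>The elementary angle on \<open>Y 0\<close> across the end is added first. The map into
  it is the identity in position \<open>0\<close>, which yields the complement there, and the map
  out of it is zero, so \<open>f \<odot> g\<close> does not change. The induction then starts with
  the whole homotopy.\<close>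

lemma homotopy_retract_in_P:
  assumes Y: "sigma_complex Y \<beta>" and X: "(X, \<alpha>) \<in> P"
    and f: "sigma_map n D SM X \<alpha> Y \<beta> f" and g: "sigma_map n D SM Y \<beta> X \<alpha> g"
    and h: "\<And>i. 1 \<le> i \<Longrightarrow> i \<le> Suc n \<Longrightarrow> hm (h i) (Y i) (Y (i - 1))"
    and fg: "\<And>i. i \<le> Suc n \<Longrightarrow> f i \<odot> g i \<boxplus> homotopy_part Y \<beta> h (Suc n) i = Idm D (Y i)"
  shows "(Y, \<beta>) \<in> P"
proof -
  have Ys: "sigma_seq n D SO Y \<beta>" using Y by (simp add: sigma_complex_def)
  note y = seqD[OF Ys] and X' = P_seq[OF X]
  note fD = mapD[OF f X' Ys] and gD = mapD[OF g Ys X']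
  let ?S = "last_obj (Y 0)" and ?s = "last_map (Y 0)"
  let ?u = "\<lambda>i. if i = 0 then Idm D (Y 0) else
      if i = Suc n then \<beta> (Suc n) else Mzero D (Y i) (Zobj D)"
  let ?v = "\<lambda>i. Mzero D (?S i) (Y i)"
  have o: "Y 0 \<in> Obj D" "?S i \<in> Obj D" for i
    using y(1)[of 0] by (auto simp: last_obj_def Zobj_in SO_in)
  note Ss = last_seq[OF o(1)] and S = last_in_P[OF o(1)]
  note s = seqD[OF Ss]
  have uh: "hm (?u i) (Y i) (?S i)" if "i \<le> Suc n" for i
    using o(1) y(1)[OF that] y(5) by (auto simp: cat_simps last_obj_def)
  have u: "sigma_map n D SM Y \<beta> ?S ?s ?u"
    unfolding map_iff[OF Ys Ss]
  proof (intro conjI allI impI)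
    fix i assume i: "i \<le> Suc n"
    show "hm (?u i) (Y i) (?S i)" by (rule uh[OF i])
    have x: "hm (xm ?u (Suc i)) (xo Y (Suc i)) (xo ?S (Suc i))" by (rule xm_hm) (use uh i in auto)
    have l: "hm (xm ?u (Suc i) \<odot> \<beta> i) (Y i) (xo ?S (Suc i))"
      and r: "hm (?s i \<odot> ?u i) (Y i) (xo ?S (Suc i))"
      using x y(2)[OF i] s(2)[OF i] uh[OF i] by (simp_all only: cat_simps)
    consider "i < n" | "i = n" | "i = Suc n" using i by linarith
    then show "xm ?u (Suc i) \<odot> \<beta> i = ?s i \<odot> ?u i"
    proof cases
      case 1
      then have "zero_object (xo ?S (Suc i))" by (simp add: zero_object_Zobj last_obj_def)
      from zero_object_into[OF this l] zero_object_into[OF this r] show ?thesis by (simp only:)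
    next
      case 2
      have "\<beta> (Suc n) \<odot> \<beta> n = Mzero D (Y n) (SO (Y 0))"
        using Y by (auto simp: sigma_complex_def xo_last)
      then show ?thesis using 2 n_pos y(1)[of n] o(1)
        by (simp add: cat_simps SO_in last_obj_def last_map_def)
    next
      case 3
      then show ?thesis using y(5) o(1) by (simp add: xm_last SM_id cat_simps last_map_def)
    qed
  qed
  have v: "sigma_map n D SM ?S ?s Y \<beta> ?v"
    unfolding map_iff[OF Ss Ys]
  proof (intro conjI allI impI)
    fix i assume i: "i \<le> Suc n"
    show "hm (?v i) (?S i) (Y i)" using o(2)[of i] y(1)[OF i] by (simp only: cat_simps)
    have "xm ?v (Suc i) = Mzero D (xo ?S (Suc i)) (xo Y (Suc i))"
      by (rule xm_zero) (use o y(1) in auto)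
    then show "xm ?v (Suc i) \<odot> ?s i = \<beta> i \<odot> ?v i"
      using zero_comp[of "?s i" "?S i" "xo ?S (Suc i)" "xo Y (Suc i)"] s(2)[OF i] y(3)[of "Suc i"]
        comp_zero[of "\<beta> i" "Y i" "xo Y (Suc i)" "?S i"] y(2)[OF i] o(2)[of i] i
      by (simp only: hm_def)
  qed
  let ?X = "sum_obj D X ?S" and ?x = "sum_map n D SO SM X \<alpha> ?S ?s"
  let ?f = "\<lambda>i. row D (X i) (?S i) (f i) (?v i)" and ?g = "\<lambda>i. col D (X i) (?S i) (g i) (?u i)"
  show ?thesis
  proof (rule homotopy_retract_induct[OF Y, of ?X ?x ?f ?g "Suc n" h])
    show "(?X, ?x) \<in> P" by (rule F1_sum[OF X S])
    show "sigma_map n D SM ?X ?x Y \<beta> ?f" by (rule row_map[OF X' Ys Ss f v])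
    show "sigma_map n D SM Y \<beta> ?X ?x ?g" by (rule col_map[OF X' Ys Ss g u])
    show "?f i \<odot> ?g i \<boxplus> homotopy_part Y \<beta> h (Suc n) i = Idm D (Y i)" if i: "i \<le> Suc n" for i
    proof -
      have "?f i \<odot> ?g i = f i \<odot> g i"
        using uh[OF i] o(2)[of i] y(1)[OF i] fD(1)[OF i] gD(1)[OF i]
        by (simp only: row_def col_def cat_simps)
      then show ?thesis using fg[OF i] by simp
    qed
    show "has_complement (?g i) (Y i) (?X i)" if i: "i \<le> Suc n" "i = 0 \<or> Suc n < i" for i
      using has_complement_col_id[OF gD(1)[of 0]] i by (simp add: sum_obj_def last_obj_def)
  qed (use h in auto)
qed

section \<open>Exactness and rotation\<close>

text \<open>The sign \<open>(-1)^n\<close> of the rotation, kept as an operation so that parity is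
  not split into cases in each computation.\<close>

definition sg :: "'m \<Rightarrow> 'm" where
  "sg f = (if even n then f else neg f)"

lemma ty_sg: "ty f = Arw A B \<Longrightarrow> ty (sg f) = Arw A B"
  and sg_sg: "ty f = Arw A B \<Longrightarrow> sg (sg f) = f"
  and sg_comp: "ty f = Arw A B \<Longrightarrow> ty g = Arw B C \<Longrightarrow> sg g \<odot> f = sg (g \<odot> f)"
  and comp_sg: "ty f = Arw A B \<Longrightarrow> ty g = Arw B C \<Longrightarrow> g \<odot> sg f = sg (g \<odot> f)"
  and sg_zero: "A \<in> Obj D \<Longrightarrow> B \<in> Obj D \<Longrightarrow> sg (Mzero D A B) = Mzero D A B"
  and SM_sg: "ty f = Arw A B \<Longrightarrow> SM (sg f) = sg (SM f)"
  by (simp_all add: sg_def ang_simps)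

lemmas sg_simps = ty_sg sg_sg sg_comp comp_sg sg_zero SM_sg

section \<open>Composites, factorisations and exactness\<close>

lemma F3_hm:
  assumes "(X, \<alpha>) \<in> P" "(Y, \<beta>) \<in> P" "hm \<phi>0 (X 0) (Y 0)" "hm \<phi>1 (X 1) (Y 1)"
    "\<phi>1 \<odot> \<alpha> 0 = \<beta> 0 \<odot> \<phi>0"
  shows "\<exists>\<phi>. \<phi> 0 = \<phi>0 \<and> \<phi> 1 = \<phi>1 \<and> sigma_map n D SM X \<alpha> Y \<beta> \<phi>"
  using F3[of X \<alpha> Y \<beta> \<phi>0 \<phi>1] assms by (simp add: hm_iff)

lemma F4_hm:
  assumes "(X, \<alpha>) \<in> P" "(Y, \<beta>) \<in> P" "hm \<phi>0 (X 0) (Y 0)" "hm \<phi>1 (X 1) (Y 1)"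
    "\<phi>1 \<odot> \<alpha> 0 = \<beta> 0 \<odot> \<phi>0"
  shows "\<exists>\<phi>. \<phi> 0 = \<phi>0 \<and> \<phi> 1 = \<phi>1 \<and> sigma_map n D SM X \<alpha> Y \<beta> \<phi> \<and>
    (angle_cone_obj n D SO X Y, angle_cone_map n D SO SM X \<alpha> Y \<beta> \<phi>) \<in> P"
  using F4[of X \<alpha> Y \<beta> \<phi>0 \<phi>1] assms by (simp add: hm_iff)

lemma SO_inj: "SO A = SO B \<Longrightarrow> A \<in> Obj D \<Longrightarrow> B \<in> Obj D \<Longrightarrow> A = B"
  using automorphism unfolding additive_automorphism_def bij_betw_def inj_on_def by blast

lemma xo_rot_obj_last: "xo (rot_obj n SO X) (Suc (Suc n)) = SO (X (Suc 0))"
  by (simp add: xo_last rot_obj_def)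

lemma rot_map_le: "i \<le> n \<Longrightarrow> rot_map n D SO SM X \<alpha> i = \<alpha> (Suc i)"
  by (simp add: rot_map_def)

lemma rot_map_last:
  assumes "sigma_seq n D SO X \<alpha>"
  shows "rot_map n D SO SM X \<alpha> (Suc n) = sg (SM (\<alpha> 0))"
  using hm_SM[OF seqD(4)[OF assms, of 0]] by (simp add: rot_map_def sg_def mneg_eq hm_def)

lemma rot_in_P: "(X, \<alpha>) \<in> P \<Longrightarrow> (rot_obj n SO X, rot_map n D SO SM X \<alpha>) \<in> P"
  using F2 P_seq by blast

text \<open>For \<open>i = 0\<close>, (F3) extends the identity and \<open>\<alpha> 0\<close> to a
  morphism from the trivial angle on \<open>X 0\<close>, whose second map is zero. Rotation gives
  the other positions.\<close>

lemma comp_zero_in_P: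
  assumes "(X, \<alpha>) \<in> P" "i \<le> n"
  shows "\<alpha> (Suc i) \<odot> \<alpha> i = Mzero D (X i) (xo X (Suc (Suc i)))"
  using assms
proof (induction i arbitrary: X \<alpha>)
  case 0
  note Xs = P_seq[OF 0(1)] note x = seqD[OF Xs]
  have T: "(triv_obj D (X 0), triv_map n D SO (X 0)) \<in> P" using F1_triv x(1)[of 0] by simp
  obtain \<phi> where \<phi>: "\<phi> 1 = \<alpha> 0"
      "sigma_map n D SM (triv_obj D (X 0)) (triv_map n D SO (X 0)) X \<alpha> \<phi>"
    using F3_hm[OF T 0(1), of "Idm D (X 0)" "\<alpha> 0"] x(1)[of 0] x(4)[of 0]
    by (auto simp: triv_obj_def triv_map_def hm_def cat_simps)
  note m = mapD[OF \<phi>(2) P_seq[OF T] Xs]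
  have "\<alpha> 1 \<odot> \<alpha> 0 = \<phi> 2 \<odot> triv_map n D SO (X 0) 1"
    using m(4)[of 1] \<phi>(1) n_pos by (simp add: numeral_2_eq_2)
  also have "\<dots> = Mzero D (X 0) (X 2)"
    using m(1)[of 2] n_pos x(1)[of 0] by (simp add: triv_map_def triv_obj_def cat_simps)
  finally show ?case using n_pos by (simp add: numeral_2_eq_2)
next
  case (Suc i)
  then show ?case using Suc.IH[OF rot_in_P[OF Suc.prems(1)]]
    by (simp add: rot_map_le rot_obj_def xo_def split: if_splits)
qed

lemma sigma_complex_in_P:
  assumes "(X, \<alpha>) \<in> P"
  shows "sigma_complex X \<alpha>"
proof -
  note Xs = P_seq[OF assms] note x = seqD[OF Xs]
  have a: "hm (\<alpha> 0) (X 0) (X (Suc 0))" "hm (\<alpha> (Suc n)) (X (Suc n)) (SO (X 0))" using x(4)[of 0] x(5)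
      by auto
  have "sg (SM (\<alpha> 0)) \<odot> \<alpha> (Suc n) = Mzero D (X (Suc n)) (SO (X (Suc 0)))"
    using comp_zero_in_P[OF rot_in_P[OF assms], of n]
    by (simp add: rot_map_le rot_map_last[OF Xs] xo_rot_obj_last) (simp add: rot_obj_def)
  from arg_cong[OF this, of sg] have "SM (\<alpha> 0) \<odot> \<alpha> (Suc n) = Mzero D (X (Suc n)) (SO (X (Suc 0)))"
    using a by (simp add: sg_simps ang_simps)
  then show ?thesis unfolding sigma_complex_def using comp_zero_in_P[OF assms] Xs by auto
qed

text \<open>The homotopy is taken to be zero. That \<open>Y\<close> is a complex is inherited from
  the angle \<open>X\<close> through the retraction.\<close>

lemma retract_in_P:
  assumes X: "(X, \<alpha>) \<in> P" and Y: "sigma_seq n D SO Y \<beta>"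
    and f: "sigma_map n D SM X \<alpha> Y \<beta> f" and g: "sigma_map n D SM Y \<beta> X \<alpha> g"
    and fg: "\<And>i. i \<le> Suc n \<Longrightarrow> f i \<odot> g i = Idm D (Y i)"
  shows "(Y, \<beta>) \<in> P"
proof (rule homotopy_retract_in_P[OF _ X f g, where h = "\<lambda>i. Mzero D (Y i) (Y (i - 1))"])
  note Xs = P_seq[OF X]
  note x = seqD[OF Xs] and y = seqD[OF Y] and fD = mapD[OF f Xs Y] and gD = mapD[OF g Y Xs]
  \<comment> \<open>One computation with two squares, used for the inner composites and for the one
    across the end.\<close>
  have c: "b' \<odot> b = Mzero D A E"
    if "hm b A B" "hm b' B E" "hm a A' B'" "hm a' B' E'" "hm f0 A' A" "hm g0 A A'" "hm f1 B' B"
        "hm g1 B B'" "hm f2 E' E"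
      "f0 \<odot> g0 = Idm D A" "f1 \<odot> a = b \<odot> f0" "f2 \<odot> a' = b' \<odot> f1" "a' \<odot> a = Mzero D A' E'"
    for b b' a a' f0 g0 f1 g1 f2 A B E A' B' E'
  proof -
    have "b' \<odot> b = b' \<odot> (b \<odot> (f0 \<odot> g0))" using that by (simp add: cat_simps)
    also have "\<dots> = b' \<odot> ((b \<odot> f0) \<odot> g0)" using that(1-9) by (simp add: cat_simps)
    also have "\<dots> = b' \<odot> ((f1 \<odot> a) \<odot> g0)" using that by simp
    also have "\<dots> = (b' \<odot> f1) \<odot> (a \<odot> g0)" using that(1-9) by (simp add: cat_simps)
    also have "\<dots> = (f2 \<odot> a') \<odot> (a \<odot> g0)" using that by simp
    also have "\<dots> = f2 \<odot> ((a' \<odot> a) \<odot> g0)" using that(1-9) by (simp add: cat_simps)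
    also have "\<dots> = Mzero D A E" using that by (simp add: cat_simps)
    finally show ?thesis .
  qed
  show "sigma_complex Y \<beta>" unfolding sigma_complex_def
  proof (intro conjI allI impI)
    fix i assume i: "i \<le> n"
    show "\<beta> (Suc i) \<odot> \<beta> i = Mzero D (Y i) (xo Y (Suc (Suc i)))"
      by (rule c[OF y(4)[OF i] y(2)[of "Suc i"] x(4)[OF i] x(2)[of "Suc i"] fD(1)[of i] gD(1)[of i]
            fD(1)[of "Suc i"] gD(1)[of "Suc i"] fD(2)[of "Suc (Suc i)"]])
        (use i fg fD(4)[of i] fD(3)[of "Suc i"] comp_zero_in_P[OF X] in auto)
  next
    have t: "hm (SM (\<beta> 0)) (SO (Y 0)) (SO (Y 1))" "hm (SM (\<alpha> 0)) (SO (X 0)) (SO (X 1))"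
      "hm (SM (f 0)) (SO (X 0)) (SO (Y 0))" "hm (SM (g 0)) (SO (Y 0)) (SO (X 0))"
      "hm (SM (f 1)) (SO (X 1)) (SO (Y 1))"
      using hm_SM y(4)[of 0] x(4)[of 0] fD(1)[of 0] gD(1)[of 0] fD(1)[of 1] by simp_all
    have "SM (f 1) \<odot> SM (\<alpha> 0) = SM (\<beta> 0) \<odot> SM (f 0)"
      using arg_cong[OF fD(4)[of 0], of SM] y(4)[of 0] x(4)[of 0] fD(1)[of 0] fD(1)[of 1]
      by (simp add: ang_simps)
    from c[OF y(5) t(1) x(5) t(2) fD(1)[of "Suc n"] gD(1)[of "Suc n"] t(3-5) fg[of
        "Suc n"] fD(5) this]
    show "SM (\<beta> 0) \<odot> \<beta> (Suc n) = Mzero D (Y (Suc n)) (SO (Y 1))"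
      using sigma_complex_in_P[OF X] by (simp add: sigma_complex_def)
  qed (rule Y)
  show "hm (Mzero D (Y i) (Y (i - 1))) (Y i) (Y (i - 1))" if "1 \<le> i" "i \<le> Suc n" for i
    using that y(1)[of i] y(1)[of "i - 1"] by (simp add: cat_simps)
  show "f i \<odot> g i \<boxplus> homotopy_part Y \<beta> (\<lambda>i. Mzero D (Y i) (Y (i - 1))) (Suc n) i = Idm D (Y i)"
      if i: "i \<le> Suc n" for i
    using fg[OF i] y(1)[OF i] y(1)[of "i - 1"] y(4)[of "i - 1"] y(4)[of i] y(1)[of "Suc i"] i
    by (auto simp: homotopy_part_def cat_simps)
qed

lemma retract_squares_in_P:
  assumes X: "(X, \<alpha>) \<in> P" and Y: "sigma_seq n D SO Y \<beta>"
    and h: "\<And>i. i \<le> Suc n \<Longrightarrow> hm (g i) (Y i) (X i) \<and> hm (f i) (X i) (Y i) \<and> f i \<odot> g i = Idm D (Y i)"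
    and sq: "\<And>i. i \<le> Suc n \<Longrightarrow> xm g (Suc i) \<odot> \<beta> i = \<alpha> i \<odot> g i \<and> xm f (Suc i) \<odot> \<alpha> i = \<beta> i \<odot> f i"
  shows "(Y, \<beta>) \<in> P"
  by (rule retract_in_P[OF X Y, of f g]) (use h sq
      in \<open>simp_all add: map_iff[OF P_seq[OF X] Y] map_iff[OF Y P_seq[OF X]]\<close>)

text \<open>If \<open>h\<close> kills \<open>\<alpha> 0\<close>, then (F3) extends it to a morphism
  into the elementary angle with \<open>T = T\<close> in positions \<open>1\<close> and
  \<open>2\<close>, and the component in position \<open>2\<close> is the factor. The remaining
  positions follow by rotation.\<close>

lemma contra_exact_in_P:
  assumes "(X, \<alpha>) \<in> P" "i \<le> n" "hm h (X (Suc i)) T" "h \<odot> \<alpha> i = Mzero D (X i) T"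
  shows "\<exists>h'. hm h' (xo X (Suc (Suc i))) T \<and> h = h' \<odot> \<alpha> (Suc i)"
  using assms
proof (induction i arbitrary: X \<alpha>)
  case 0
  note Xs = P_seq[OF 0(1)] note x = seqD[OF Xs]
  have T: "T \<in> Obj D" using 0(3) by (simp add: hm_def)
  have E: "(elem_obj T 1, elem_map T 1) \<in> P" using elem_in_P T n_pos by simp
  have e: "hm (elem_map T 1 0) (Zobj D) T"
    using seqD(2)[OF P_seq[OF E], of 0] by (simp add: elem_obj_def)
  obtain \<phi> where \<phi>: "\<phi> 1 = h" "sigma_map n D SM X \<alpha> (elem_obj T 1) (elem_map T 1) \<phi>"
    using F3_hm[OF 0(1) E, of "Mzero D (X 0) (Zobj D)" h] 0(3,4) x(1)[of 0] T e
    by (auto simp: elem_obj_def hm_def comp_zero ty_zero Zobj_in)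
  note m = mapD[OF \<phi>(2) Xs P_seq[OF E]]
  have "h = \<phi> 2 \<odot> \<alpha> 1"
    using m(4)[of 1] \<phi>(1) n_pos 0(3) by (simp add: numeral_2_eq_2 elem_map_def cat_simps)
  moreover have "hm (\<phi> 2) (X 2) T" using m(1)[of 2] n_pos by (simp add: elem_obj_def numeral_2_eq_2)
  ultimately show ?case using n_pos by (auto simp: numeral_2_eq_2)
next
  case (Suc i)
  then show ?case using Suc.IH[OF rot_in_P[OF Suc.prems(1)]]
    by (simp add: rot_map_le rot_obj_def xo_def split: if_splits)
qed

lemma contra_exact_last_in_P:
  assumes X: "(X, \<alpha>) \<in> P" and h: "hm h (X 0) T"
      and z: "SM h \<odot> \<alpha> (Suc n) = Mzero D (X (Suc n)) (SO T)"
  shows "\<exists>h'. hm h' (X 1) T \<and> h = h' \<odot> \<alpha> 0"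
proof -
  note Xs = P_seq[OF X] note x = seqD[OF Xs]
  have a: "hm (\<alpha> 0) (X 0) (X (Suc 0))" using x(4)[of 0] by simp
  obtain k where k: "hm k (SO (X (Suc 0))) (SO T)" "SM h = k \<odot> sg (SM (\<alpha> 0))"
    using contra_exact_in_P[OF rot_in_P[OF X], of n "SM h" "SO T"] hm_SM[OF h] z
    by (auto simp: rot_map_le rot_map_last[OF Xs] xo_rot_obj_last) (auto simp: rot_obj_def)
  obtain h' where h': "hm h' (X 1) T" "SM h' = k" using SM_surj[OF k(1)] a h by (auto simp: hm_def)
  have "SM (sg h' \<odot> \<alpha> 0) = SM h" using k a h' by (simp add: ang_simps sg_simps)
  then have "h = sg h' \<odot> \<alpha> 0"
    using SM_inj[of "sg h' \<odot> \<alpha> 0" h "X 0" T] h h' a by (simp add: cat_simps sg_simps)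
  then show ?thesis using h' by (intro exI[of _ "sg h'"]) (simp add: hm_def sg_simps)
qed

text \<open>Here (F3) is applied to a morphism out of the elementary angle across the end, with
  \<open>T\<close> in position \<open>0\<close> and \<open>SO T\<close> in position
  \<open>n + 1\<close>. The factor is the component in position \<open>n + 1\<close>.\<close>

lemma cov_exact_first_in_P:
  assumes X: "(X, \<alpha>) \<in> P" and h: "hm h T (X 0)" and z: "\<alpha> 0 \<odot> h = Mzero D T (X 1)"
  shows "\<exists>h'. hm h' (SO T) (X (Suc n)) \<and> \<alpha> (Suc n) \<odot> h' = SM h"
proof -
  note Xs = P_seq[OF X] note x = seqD[OF Xs]
  have T: "T \<in> Obj D" using h by (simp add: hm_def)
  note L = last_in_P[OF T]
  have l: "hm (last_map T 0) T (Zobj D)"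
    using T n_pos by (simp add: last_map_def last_obj_def cat_simps)
  obtain \<phi> where \<phi>: "\<phi> 0 = h" "sigma_map n D SM (last_obj T) (last_map T) X \<alpha> \<phi>"
    using F3_hm[OF L X, of h "Mzero D (Zobj D) (X 1)"] h z x(1)[of 1] T n_pos l
    by (auto simp: last_obj_def hm_def zero_comp ty_zero Zobj_in)
  note m = mapD[OF \<phi>(2) P_seq[OF L] Xs]
  show ?thesis using m(5) m(1)[of "Suc n"] \<phi>(1) h T
    by (auto simp: last_obj_def last_map_def ang_simps)
qed

text \<open>For \<open>i = 0\<close> this is the previous lemma for the rotated angle: the factor
  lives between objects in the image of \<open>SO\<close> and is brought back by fullness of
  \<open>SM\<close>, with the rotation sign absorbed.\<close>

lemma cov_exact_in_P:
  assumes "(X, \<alpha>) \<in> P" "i \<le> n" "hm h T (X (Suc i))" "\<alpha> (Suc i) \<odot> h = Mzero D T (xo X (Suc (Suc i)))"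
  shows "\<exists>h'. hm h' T (X i) \<and> h = \<alpha> i \<odot> h'"
  using assms
proof (induction i arbitrary: X \<alpha>)
  case 0
  note Xs = P_seq[OF 0(1)] note x = seqD[OF Xs]
  have a: "hm (\<alpha> 0) (X 0) (X (Suc 0))" using x(4)[of 0] by simp
  obtain k where k: "hm k (SO T) (SO (X 0))" "sg (SM (\<alpha> 0)) \<odot> k = SM h"
    using cov_exact_first_in_P[OF rot_in_P[OF 0(1)], of h T] 0(3,4) n_pos
    by (auto simp: rot_map_le rot_map_last[OF Xs]) (auto simp: rot_obj_def)
  obtain h' where h': "hm h' T (X 0)" "SM h' = k" using SM_surj[OF k(1)] a 0(3)
      by (auto simp: hm_def)
  have "SM (\<alpha> 0 \<odot> sg h') = SM h" using k a h' by (simp add: ang_simps sg_simps)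
  then have "h = \<alpha> 0 \<odot> sg h'"
    using SM_inj[of "\<alpha> 0 \<odot> sg h'" h T "X (Suc 0)"] 0(3) h' a by (simp add: cat_simps sg_simps)
  then show ?case using h' by (intro exI[of _ "sg h'"]) (simp add: hm_def sg_simps)
next
  case (Suc i)
  then show ?case using Suc.IH[OF rot_in_P[OF Suc.prems(1)]]
    by (simp add: rot_map_le rot_obj_def xo_def split: if_splits)
qed

section \<open>Right rotation\<close>

lemma case_nat_seq:
  assumes X: "sigma_seq n D SO X \<alpha>" and A: "SO A = X (Suc n)" and a: "hm a A (X 0)"
  shows "sigma_seq n D SO (case_nat A X) (case_nat a \<alpha>)"
  unfolding seq_iff
proof (intro conjI allI impI)
  note x = seqD[OF X]
  fix i assume i: "i \<le> Suc n"
  show "case_nat A X i \<in> Obj D" using a x(1) i by (auto simp: hm_def split: nat.split)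
  consider "i = 0" | j where "i = Suc j" "j < n" | "i = Suc n" using i
      by (cases i) (auto simp: le_less)
  then show "hm (case_nat a \<alpha> i) (case_nat A X i) (xo (case_nat A X) (Suc i))"
    using a x(4) A by cases (auto simp: xo_def)
qed

text \<open>The left rotation of the prepended sequence is \<open>X\<close> again: its last map is
  \<open>sg (SM a)\<close>, and the sign \<open>(-1)^n\<close> occurs twice. So (F2)
  applies.\<close>

lemma right_rotate_iff:
  assumes X: "sigma_seq n D SO X \<alpha>" and A: "SO A = X (Suc n)"
      and a: "hm a A (X 0)" "SM a = sg (\<alpha> (Suc n))"
  shows "(case_nat A X, case_nat a \<alpha>) \<in> P \<longleftrightarrow> (X, \<alpha>) \<in> P"
proof -
  note x = seqD[OF X] and s = case_nat_seq[OF X A a(1)]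
  have l: "sg (SM a) = \<alpha> (Suc n)" using a x(5) by (simp add: hm_def sg_simps)
  have r: "rot_obj n SO (case_nat A X) i = X i"
      "rot_map n D SO SM (case_nat A X) (case_nat a \<alpha>) i = \<alpha> i" if "i \<le> Suc n" for i
    using that A l rot_map_last[OF s] by (auto simp: rot_obj_def rot_map_le le_Suc_eq)
  show ?thesis unfolding F2[OF s]
    by (auto intro: P_cong simp: r)
qed

lemma right_rotateE:
  assumes X: "(X, \<alpha>) \<in> P"
  obtains A a where "SO A = X (Suc n)" "A \<in> Obj D" "hm a A (X 0)" "SM a = sg (\<alpha> (Suc n))"
    "(case_nat A X, case_nat a \<alpha>) \<in> P"
proof -
  note x = seqD[OF P_seq[OF X]]
  obtain A where A: "A \<in> Obj D" "SO A = X (Suc n)" using SO_surj x(1)[of "Suc n"] by auto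
  then have "hm (sg (\<alpha> (Suc n))) (SO A) (SO (X 0))" using x(5) x(1)[of 0]
      by (simp add: hm_def sg_simps SO_in)
  then obtain a where "hm a A (X 0)" "SM a = sg (\<alpha> (Suc n))" using SM_surj A(1) x(1)[of 0] by blast
  then show ?thesis using that A right_rotate_iff[OF P_seq[OF X]] X by blast
qed

text \<open>After a right rotation of both angles, positions \<open>n + 1\<close> and
  \<open>0\<close> become \<open>0\<close> and \<open>1\<close>, where (F3) allows the components to
  be prescribed.\<close>

lemma F3_last:
  assumes X: "(X, \<alpha>) \<in> P" and Y: "(Y, \<beta>) \<in> P" and f: "hm f (X 0) (Y 0)"
      and g: "hm g (X (Suc n)) (Y (Suc n))"
    and fg: "SM f \<odot> \<alpha> (Suc n) = \<beta> (Suc n) \<odot> g"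
  shows "\<exists>\<phi>. \<phi> 0 = f \<and> \<phi> (Suc n) = g \<and> sigma_map n D SM X \<alpha> Y \<beta> \<phi>"
proof -
  note Xs = P_seq[OF X] and Ys = P_seq[OF Y]
  note x = seqD[OF Xs] and y = seqD[OF Ys]
  obtain A a where A: "SO A = X (Suc n)" "A \<in> Obj D" "hm a A (X 0)" "SM a = sg (\<alpha> (Suc n))"
    and X': "(case_nat A X, case_nat a \<alpha>) \<in> P" using right_rotateE[OF X] .
  obtain B b where B: "SO B = Y (Suc n)" "B \<in> Obj D" "hm b B (Y 0)" "SM b = sg (\<beta> (Suc n))"
    and Y': "(case_nat B Y, case_nat b \<beta>) \<in> P" using right_rotateE[OF Y] .
  note X's = P_seq[OF X'] and Y's = P_seq[OF Y']
  obtain g0 where g0: "hm g0 A B" "SM g0 = g" using SM_surj[of g A B] g A B by auto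
  have "f \<odot> a = b \<odot> g0"
  proof (rule SM_inj)
    show "SM (f \<odot> a) = SM (b \<odot> g0)" using f g g0 A B x(5) y(5) fg by (simp add: ang_simps sg_simps)
  qed (use f g0 A B in \<open>auto simp: cat_simps\<close>)
  then obtain \<phi> where \<phi>: "\<phi> 0 = g0" "\<phi> 1 = f"
      "sigma_map n D SM (case_nat A X) (case_nat a \<alpha>) (case_nat B Y) (case_nat b \<beta>) \<phi>"
    using F3_hm[OF X' Y', of g0 f] g0 f by auto
  note m = mapD[OF \<phi>(3) X's Y's]
  have xX: "xo (case_nat A X) (Suc i) = X i" and xY: "xo (case_nat B Y) (Suc i) = Y i"
      if "i \<le> Suc n" for i
    using that A B by (cases "i = Suc n"; auto simp: xo_def)+
  \<comment> \<open>Position \<open>n + 2\<close> of the continued right rotation is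
    \<open>SO A = X (n + 1)\<close>, so the shift of the continued morphism is one between the
    original sequences.\<close>
  let ?\<psi> = "\<lambda>i. xm \<phi> (Suc i)"
  have \<psi>0: "?\<psi> 0 = f" "?\<psi> (Suc n) = g" using \<phi> g0 by (auto simp: xm_last)
  have "sigma_map n D SM X \<alpha> Y \<beta> ?\<psi>" unfolding map_iff[OF Xs Ys]
  proof (intro conjI allI impI)
    fix i assume i: "i \<le> Suc n"
    show "hm (?\<psi> i) (X i) (Y i)" using m(2)[of "Suc i"] xX[OF i] xY[OF i] i by simp
    show "xm ?\<psi> (Suc i) \<odot> \<alpha> i = \<beta> i \<odot> ?\<psi> i"
    proof (cases "i = Suc n")
      case True then show ?thesis using fg \<psi>0 by (simp only: xm_last)
    next
      case False then show ?thesis using m(3)[of "Suc i"] i by simp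
    qed
  qed
  then show ?thesis using \<psi>0 by (intro exI[of _ ?\<psi>]) simp
qed

section \<open>Reduced mapping cones\<close>

lemma angle_cone_obj_eq:
  "i \<le> Suc n \<Longrightarrow> angle_cone_obj n D SO X Y i = Dsum D (xo X (Suc i)) (Y i)"
  by (auto simp: angle_cone_obj_def xo_def le_Suc_eq)

lemma angle_cone_map_eq:
  assumes "sigma_seq n D SO X \<alpha>" "i \<le> n"
  shows "angle_cone_map n D SO SM X \<alpha> Y \<beta> \<phi> i =
    mat D (xo X (Suc i)) (Y i) (xo X (Suc (Suc i))) (Y (Suc i))
      (neg (\<alpha> (Suc i))) (Mzero D (Y i) (xo X (Suc (Suc i)))) (xm \<phi> (Suc i)) (\<beta> i)"
proof -
  have "mneg D (X (Suc i)) (xo X (Suc (Suc i))) (\<alpha> (Suc i)) = neg (\<alpha> (Suc i))"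
    using seqD(2)[OF assms(1), of "Suc i"] assms(2) by (simp add: mneg_eq hm_def)
  then show ?thesis using assms(2) by (auto simp: angle_cone_map_def xo_def le_less)
qed

lemma angle_cone_map_last:
  assumes X: "sigma_seq n D SO X \<alpha>" and Y: "sigma_seq n D SO Y \<beta>" and "hm (\<phi> 0) (X 0) (Y 0)"
  shows "angle_cone_map n D SO SM X \<alpha> Y \<beta> \<phi> (Suc n) =
    SM (Inl D (X 1) (Y 0)) \<odot> (neg (SM (\<alpha> 0)) \<odot> Prl D (SO (X 0)) (Y (Suc n))) \<boxplus>
    SM (Inr D (X 1) (Y 0)) \<odot>
      (SM (\<phi> 0) \<odot> Prl D (SO (X 0)) (Y (Suc n)) \<boxplus> \<beta> (Suc n) \<odot> Prr D (SO (X 0)) (Y (Suc n)))"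
proof -
  note x = seqD[OF X] and y = seqD[OF Y]
  have a: "hm (\<alpha> 0) (X 0) (X 1)" "hm (\<beta> (Suc n)) (Y (Suc n)) (SO (Y 0))"
    using x(4)[of 0] y(5) by simp_all
  have "mneg D (SO (X 0)) (SO (X 1)) (SM (\<alpha> 0)) = neg (SM (\<alpha> 0))"
    using a by (simp add: mneg_eq hm_def ty_SM)
  then show ?thesis using a assms(3)
    by (simp add: angle_cone_map_def sigma_dsum_def mat_def row_def col_def ang_simps)
qed

definition cone_angle :: "(nat \<Rightarrow> 'o) \<Rightarrow> (nat \<Rightarrow> 'm) \<Rightarrow> (nat \<Rightarrow> 'o) \<Rightarrow> (nat \<Rightarrow> 'm) \<Rightarrow> (nat \<Rightarrow> 'm) \<Rightarrow> 'm \<Rightarrow>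
    bool" where
  "cone_angle X \<alpha> Y \<beta> \<phi> \<epsilon> \<longleftrightarrow> (cone_obj n D X Y, (cone_map n D X \<alpha> Y \<beta> \<phi>)(Suc n := \<epsilon>)) \<in> P"

text \<open>
  If \<open>\<phi> 0 = 1\<close>, the summand \<open>SO (X 0)\<close> in position \<open>n + 1\<close> of the mapping cone is
  mapped isomorphically to the summand \<open>Y 0\<close> of position \<open>0\<close>; splitting it off leaves the
  cone of the truncated sequences.
\<close>

lemma cone_angle_first:
  assumes X: "(X, \<alpha>) \<in> P" and Y: "(Y, \<beta>) \<in> P" and X0: "Y 0 = X 0"
    and \<phi>1: "hm \<phi>1 (X 1) (Y 1)" "\<phi>1 \<odot> \<alpha> 0 = \<beta> 0"
  shows "\<exists>\<phi>. chain_map D n (\<lambda>i. X (Suc i)) (\<lambda>i. \<alpha> (Suc i)) (\<lambda>i. Y (Suc i)) (\<lambda>i. \<beta> (Suc i)) \<phi> \<and>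
    \<phi> 0 = \<phi>1 \<and>
    cone_angle (\<lambda>i. X (Suc i)) (\<lambda>i. \<alpha> (Suc i)) (\<lambda>i. Y (Suc i)) (\<lambda>i. \<beta> (Suc i)) \<phi> (SM (\<alpha> 0) \<odot> \<beta> (Suc
        n))"
proof -
  note Xs = P_seq[OF X] and Ys = P_seq[OF Y]
  note x = seqD[OF Xs] and y = seqD[OF Ys]
  have t0: "hm (\<alpha> 0) (X 0) (X 1)" "hm (\<beta> 0) (X 0) (Y 1)" "hm (\<beta> (Suc n)) (Y (Suc n)) (SO (X 0))"
    "hm (\<alpha> (Suc n)) (X (Suc n)) (SO (X 0))"
    using x(4)[of 0] y(4)[of 0] y(5) x(5) X0 by simp_all
  obtain \<phi> where \<phi>: "\<phi> 0 = Idm D (X 0)" "\<phi> 1 = \<phi>1" "sigma_map n D SM X \<alpha> Y \<beta> \<phi>"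
    and "(angle_cone_obj n D SO X Y, angle_cone_map n D SO SM X \<alpha> Y \<beta> \<phi>) \<in> P"
    using F4_hm[OF X Y, of "Idm D (X 0)" \<phi>1] \<phi>1 t0 X0 by (auto simp: cat_simps)
  moreover define T \<tau> where "T = angle_cone_obj n D SO X Y"
      and "\<tau> = angle_cone_map n D SO SM X \<alpha> Y \<beta> \<phi>"
  ultimately have T: "(T, \<tau>) \<in> P" by simp
  note m = mapD[OF \<phi>(3) Xs Ys] and Ts = P_seq[OF T]
  note t = seqD[OF Ts]
  let ?f = "\<lambda>i. \<phi> (Suc i)"
  let ?Q = "cone_obj n D (\<lambda>i. X (Suc i)) (\<lambda>i. Y (Suc i))"
  let ?q = "(cone_map n D (\<lambda>i. X (Suc i)) (\<lambda>i. \<alpha> (Suc i)) (\<lambda>i. Y (Suc i)) (\<lambda>i. \<beta> (Suc i)) ?f)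
    (Suc n := SM (\<alpha> 0) \<odot> \<beta> (Suc n))"
  have Q0: "?Q 0 = X 1" and QT: "?Q i = T i" if "1 \<le> i" "i \<le> n" for i
    using that by (auto simp: cone_obj_def T_def angle_cone_obj_def)
  have Q0: "?Q 0 = X 1" and Qn: "?Q (Suc n) = Y (Suc n)" by (auto simp: cone_obj_def)
  have T0: "T 0 = Dsum D (X 1) (Y 0)" and Tn: "T (Suc n) = Dsum D (SO (X 0)) (Y (Suc n))"
    and T1: "T 1 = Dsum D (xo X 2) (Y 1)" and Tn': "T n = Dsum D (X (Suc n)) (Y n)"
    using n_pos by (auto simp: T_def angle_cone_obj_eq xo_last numeral_2_eq_2)
  have x2: "xo X 2 = X 2" using n_pos by simp
  have t1: "hm (\<alpha> 1) (X 1) (X 2)" "hm (\<beta> n) (Y n) (Y (Suc n))"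
    using x(4)[of 1] n_pos y(4)[of n] by (auto simp: numeral_2_eq_2)
  have q0: "?q 0 = col D (X 2) (Y 1) (neg (\<alpha> 1)) \<phi>1"
    using mneg_eq[of "\<alpha> 1" "X 1" "X 2"] t1 \<phi>(2) by (simp add: cone_map_def hm_def numeral_2_eq_2)
  have qT: "?q i = \<tau> i" if "1 \<le> i" "i < n" for i
    using that n_pos by (simp add: cone_map_def \<tau>_def angle_cone_map_def)
  have qn: "?q n = row D (X (Suc n)) (Y n) (\<phi> (Suc n)) (\<beta> n)"
    using n_pos by (simp add: cone_map_def)
  have \<tau>0: "\<tau> 0 = mat D (X 1) (Y 0) (X 2) (Y 1) (neg (\<alpha> 1)) (Mzero D (Y 0) (X 2)) \<phi>1 (\<beta> 0)"
    using angle_cone_map_eq[OF Xs, of 0 Y \<beta> \<phi>] \<phi>(2) n_pos by (simp add: \<tau>_def numeral_2_eq_2)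
  have \<tau>n: "\<tau> n = mat D (X (Suc n)) (Y n) (SO (X 0)) (Y (Suc n))
      (neg (\<alpha> (Suc n))) (Mzero D (Y n) (SO (X 0))) (\<phi> (Suc n)) (\<beta> n)"
    using angle_cone_map_eq[OF Xs, of n Y \<beta> \<phi>] by (simp add: \<tau>_def xo_last)
  have \<tau>l: "\<tau> (Suc n) = SM (Inl D (X 1) (Y 0)) \<odot> (neg (SM (\<alpha> 0)) \<odot> Prl D (SO (X 0)) (Y (Suc n))) \<boxplus>
    SM (Inr D (X 1) (Y 0)) \<odot> (Prl D (SO (X 0)) (Y (Suc n)) \<boxplus> \<beta> (Suc n) \<odot> Prr D (SO (X 0)) (Y (Suc
        n)))"
    using angle_cone_map_last[OF Xs Ys, of \<phi>] m(1)[of 0] \<phi>(1) t0 by (simp add: \<tau>_def ang_simps)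
  have oX: "X 0 \<in> Obj D" "X 1 \<in> Obj D" "X 2 \<in> Obj D" "Y 1 \<in> Obj D" "Y (Suc n) \<in> Obj D"
      "X (Suc n) \<in> Obj D" "Y n \<in> Obj D"
    using t0 t1 by (auto simp: hm_def)
  have \<phi>n: "hm (\<phi> (Suc n)) (X (Suc n)) (Y (Suc n))" using m(1)[of "Suc n"] by simp
  have Qs: "sigma_seq n D SO ?Q ?q" unfolding seq_iff
  proof (intro conjI allI impI)
    fix i assume i: "i \<le> Suc n"
    consider "i = 0" | "1 \<le> i" "i < n" | "i = n" | "i = Suc n" using i by linarith
    note c = this
    show "?Q i \<in> Obj D" using c
      by cases (use Q0 Qn QT t(1)[of i] n_pos oX i in auto)
    have "?Q 1 = Dsum D (X 2) (Y 1)" using QT[of 1] T1 x2 n_pos by simp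
    then have e0: "hm (?q 0) (?Q 0) (?Q 1)" unfolding q0 Q0 using t1 \<phi>1
        by (simp add: cat_simps col_def)
    have en: "hm (?q n) (?Q n) (?Q (Suc n))" unfolding qn Qn using t1 \<phi>n QT[of n] Tn' n_pos
      by (simp add: cat_simps row_def)
    have el: "hm (?q (Suc n)) (?Q (Suc n)) (SO (?Q 0))"
      using t0 Q0 Qn by (simp add: ang_simps)
    from c show "hm (?q i) (?Q i) (xo ?Q (Suc i))"
    proof cases
      case 2
      then show ?thesis using qT[of i] QT[of i] QT[of "Suc i"] t(4)[of i] by simp
    qed (use e0 en el in \<open>auto simp: xo_last\<close>)
  qed
  \<comment> \<open>The last map of \<open>T\<close> has the row \<open>[1 \<beta>(n+1)]\<close>
    into \<open>SO (X 0)\<close>, and the column \<open>(-\<beta>(n+1), 1)\<close> is its kernel. In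
    position \<open>0\<close>, the row \<open>[1 \<alpha>0]\<close> kills the column
    \<open>(-\<alpha>0, 1)\<close> through which the cancelled summand enters. The entry
    \<open>-\<beta>(n+1)\<close> turns \<open>-SM (\<alpha> 0)\<close> into the connecting morphism
    of the reduced cone.\<close>
  define j p where
    "j i = (if i = 0 then Inl D (X 1) (Y 0)
      else if i = Suc n then col D (SO (X 0)) (Y (Suc n)) (neg (\<beta> (Suc n))) (Idm D (Y (Suc n)))
      else Idm D (T i))" and
    "p i = (if i = 0 then row D (X 1) (Y 0) (Idm D (X 1)) (\<alpha> 0)
      else if i = Suc n then Prr D (SO (X 0)) (Y (Suc n)) else Idm D (T i))" for i
  note s = t0 t1 \<phi>1(1) \<phi>n oX
  have jp: "hm (j i) (?Q i) (T i) \<and> hm (p i) (T i) (?Q i) \<and> p i \<odot> j i = Idm D (?Q i)"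
      if i: "i \<le> Suc n" for i
  proof -
    consider "i = 0" | "1 \<le> i" "i \<le> n" | "i = Suc n" using i by linarith
    then show ?thesis
    proof cases
      case 1 then show ?thesis
        using s Q0 T0 X0 by (simp add: j_def p_def row_def ang_simps)
    next
      case 2 then show ?thesis
        using QT t(1)[of i] by (simp add: j_def p_def cat_simps)
    next
      case 3 then show ?thesis
        using s Qn Tn by (simp add: j_def p_def col_def ang_simps)
    qed
  qed
  have z: "\<alpha> 1 \<odot> \<alpha> 0 = Mzero D (X 0) (X 2)" "\<beta> (Suc n) \<odot> \<beta> n = Mzero D (Y n) (SO (X 0))"
    "\<beta> (Suc n) \<odot> \<phi> (Suc n) = \<alpha> (Suc n)"
    using comp_zero_in_P[OF X, of 0] comp_zero_in_P[OF Y, of n] x2 X0 m(5) \<phi>(1) t0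
    by (auto simp: xo_last numeral_2_eq_2 ang_simps)
  have z1: "hm (\<alpha> 0) (X 0) (X 1)" "hm (\<alpha> 1) (X 1) (X 2)" using s by auto
  note z' = comp_reduce[OF z(1) z1] comp_reduce[OF \<phi>1(2) z1(1) \<phi>1(1)]
    comp_reduce[OF z(2) t1(2) t0(3)] comp_reduce[OF z(3) \<phi>n t0(3)]
  have j0: "j 1 \<odot> ?q 0 = \<tau> 0 \<odot> j 0"
    unfolding q0 \<tau>0 using s n_pos X0 T1 x2 by (simp add: j_def mat_def row_def col_def ang_simps)
  have p0: "p 1 \<odot> \<tau> 0 = ?q 0 \<odot> p 0"
    unfolding q0 \<tau>0 using s n_pos X0 T1 x2 z z' \<phi>1(2)
    by (simp add: p_def mat_def row_def col_def ang_simps)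
  have jn: "j (Suc n) \<odot> ?q n = \<tau> n \<odot> j n"
    unfolding qn \<tau>n using s n_pos Tn' z z'
    by (simp add: j_def mat_def row_def col_def ang_simps)
  have pn: "p (Suc n) \<odot> \<tau> n = ?q n \<odot> p n"
    unfolding qn \<tau>n using s n_pos Tn' z z'
    by (simp add: p_def mat_def row_def col_def ang_simps)
  have jl: "SM (j 0) \<odot> ?q (Suc n) = \<tau> (Suc n) \<odot> j (Suc n)"
    unfolding \<tau>l using s X0 by (simp add: j_def mat_def row_def col_def ang_simps)
  have pl: "SM (p 0) \<odot> \<tau> (Suc n) = ?q (Suc n) \<odot> p (Suc n)"
    unfolding \<tau>l using s X0 by (simp add: p_def mat_def row_def col_def ang_simps)
  have "(?Q, ?q) \<in> P"
  proof (rule retract_squares_in_P[OF T Qs jp])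
    fix i assume i: "i \<le> Suc n"
    consider "i = 0" | "1 \<le> i" "i < n" | "i = n" | "i = Suc n" using i by linarith
    then show "xm j (Suc i) \<odot> ?q i = \<tau> i \<odot> j i \<and> xm p (Suc i) \<odot> \<tau> i = ?q i \<odot> p i"
    proof cases
      case 2
      then show ?thesis using qT[of i] t(1)[of i] t(1)[of "Suc i"] t(4)[of i]
        by (simp add: j_def p_def cat_simps)
    qed (use j0 jn jl p0 pn pl in \<open>auto simp: xm_last\<close>)
  qed
  moreover have "chain_map D n (\<lambda>i. X (Suc i)) (\<lambda>i. \<alpha> (Suc i)) (\<lambda>i. Y (Suc i)) (\<lambda>i. \<beta> (Suc i)) ?f"
    using m x(1) y(1) by (subst chain_map_hm) auto
  ultimately show ?thesis unfolding cone_angle_def using \<phi>(2) by (intro exI[of _ ?f]) simp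
qed

lemma cone_seq:
  assumes "\<And>i. i \<le> n \<Longrightarrow> X i \<in> Obj D" "\<And>i. i \<le> n \<Longrightarrow> Y i \<in> Obj D"
    and "\<And>i. i < n \<Longrightarrow> hm (\<alpha> i) (X i) (X (Suc i))" "\<And>i. i < n \<Longrightarrow> hm (\<beta> i) (Y i) (Y (Suc i))"
    and "\<And>i. i \<le> n \<Longrightarrow> hm (\<phi> i) (X i) (Y i)" "hm \<epsilon> (Y n) (SO (X 0))"
  shows "sigma_seq n D SO (cone_obj n D X Y) ((cone_map n D X \<alpha> Y \<beta> \<phi>)(Suc n := \<epsilon>))"
  unfolding seq_iff
proof (intro conjI allI impI)
  fix i assume i: "i \<le> Suc n"
  show "cone_obj n D X Y i \<in> Obj D" using assms(1,2) i by (auto simp: cone_obj_def Dsum_in)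
  note neg = assms(3)[unfolded hm_def, THEN conjunct1, THEN mneg_eq]
  consider "i = 0" | k where "i = Suc k" "Suc k < n" | "i = n" | "i = Suc n"
    using i n_pos by (cases i; cases n; force simp: le_less less_Suc_eq)
  then show "hm (((cone_map n D X \<alpha> Y \<beta> \<phi>)(Suc n := \<epsilon>)) i) (cone_obj n D X Y i) (xo (cone_obj n D X
      Y) (Suc i))"
  proof cases
    case 1
    then show ?thesis using n_pos assms(1)[of 0] assms(2)[of 0] assms(3)[of 0] assms(5)[of 0] neg[of
        0]
      by (simp add: cone_map_def cone_obj_def ang_simps col_def)
  next
    case 2
    then show ?thesis
      using assms(3)[of "Suc k"] assms(4)[of k] assms(5)[of "Suc k"] neg[of "Suc k"]
        assms(1)[of "Suc (Suc k)"] assms(2)[of "Suc k"]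
      by (simp add: cone_map_def cone_obj_def mat_def row_def col_def ang_simps)
  next
    case 3
    then show ?thesis
      using assms(4)[of "n - 1"] assms(5)[of n] assms(1)[of n] assms(2)[of "n - 1"] n_pos
      by (simp add: cone_map_def cone_obj_def row_def ang_simps)
  next
    case 4
    then show ?thesis using assms(6) by (simp add: cone_obj_def xo_last)
  qed
qed

text \<open>
  The same cone with the last instead of the first component of the morphism prescribed.  The mapping
  cone is now taken between the right rotations, and the summand \<open>X 0\<close>, common to its
  positions \<open>0\<close> and \<open>1\<close>, is split off.
\<close>

lemma cone_angle_first_last:
  assumes X: "(X, \<alpha>) \<in> P" and Y: "(Y, \<beta>) \<in> P" and X0: "Y 0 = X 0"
    and g: "hm g (X (Suc n)) (Y (Suc n))" "\<beta> (Suc n) \<odot> g = \<alpha> (Suc n)"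
  shows "\<exists>\<phi>. chain_map D n (\<lambda>i. X (Suc i)) (\<lambda>i. \<alpha> (Suc i)) (\<lambda>i. Y (Suc i)) (\<lambda>i. \<beta> (Suc i)) \<phi> \<and>
    \<phi> n = g \<and>
    cone_angle (\<lambda>i. X (Suc i)) (\<lambda>i. \<alpha> (Suc i)) (\<lambda>i. Y (Suc i)) (\<lambda>i. \<beta> (Suc i)) \<phi> (SM (\<alpha> 0) \<odot> \<beta> (Suc
        n))"
proof -
  note Xs = P_seq[OF X] and Ys = P_seq[OF Y]
  note x = seqD[OF Xs] and y = seqD[OF Ys]
  obtain A a where A: "SO A = X (Suc n)" "A \<in> Obj D" "hm a A (X 0)" "SM a = sg (\<alpha> (Suc n))"
    and X': "(case_nat A X, case_nat a \<alpha>) \<in> P" using right_rotateE[OF X] .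
  obtain B b where B: "SO B = Y (Suc n)" "B \<in> Obj D" "hm b B (Y 0)" "SM b = sg (\<beta> (Suc n))"
    and Y': "(case_nat B Y, case_nat b \<beta>) \<in> P" using right_rotateE[OF Y] .
  note X's = P_seq[OF X'] and Y's = P_seq[OF Y']
  have t0: "hm (\<alpha> 0) (X 0) (X 1)" "hm (\<beta> 0) (X 0) (Y 1)" "hm (\<beta> (Suc n)) (Y (Suc n)) (SO (X 0))"
    "hm (\<alpha> (Suc n)) (X (Suc n)) (SO (X 0))" "hm (\<beta> n) (Y n) (Y (Suc n))" "hm b B (X 0)"
        "hm a A (X 0)"
    using x(4)[of 0] y(4)[of 0] y(5) x(5) X0 y(4)[of n] B(3) A(3) by simp_all
  obtain \<phi>0 where \<phi>0: "hm \<phi>0 A B" "SM \<phi>0 = g" using SM_surj[of g A B] g(1) A B by auto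
  have ba: "b \<odot> \<phi>0 = a"
  proof (rule SM_inj)
    show "SM (b \<odot> \<phi>0) = SM a" using g \<phi>0 A B t0 by (simp add: ang_simps sg_simps)
  qed (use t0 \<phi>0 in \<open>auto simp: cat_simps\<close>)
  obtain \<phi> where \<phi>: "\<phi> 0 = \<phi>0" "\<phi> 1 = Idm D (X 0)"
      "sigma_map n D SM (case_nat A X) (case_nat a \<alpha>) (case_nat B Y) (case_nat b \<beta>) \<phi>"
    and "(angle_cone_obj n D SO (case_nat A X) (case_nat B Y),
      angle_cone_map n D SO SM (case_nat A X) (case_nat a \<alpha>) (case_nat B Y) (case_nat b \<beta>) \<phi>) \<in> P"
    using F4_hm[OF X' Y', of \<phi>0 "Idm D (X 0)"] ba \<phi>0 t0 X0 by (auto simp: cat_simps)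
  moreover define T \<tau> where "T = angle_cone_obj n D SO (case_nat A X) (case_nat B Y)"
    and "\<tau> = angle_cone_map n D SO SM (case_nat A X) (case_nat a \<alpha>) (case_nat B Y) (case_nat b \<beta>) \<phi>"
  ultimately have T: "(T, \<tau>) \<in> P" by simp
  note m = mapD[OF \<phi>(3) X's Y's] and Ts = P_seq[OF T]
  note t = seqD[OF Ts]
  have xX: "xo (case_nat A X) (Suc i) = X i" and xY: "xo (case_nat B Y) (Suc i) = Y i"
      if "i \<le> Suc n" for i
    using that A B by (cases "i = Suc n"; auto simp: xo_def)+
  \<comment> \<open>Shifting undoes the right rotation; the component in position
    \<open>n + 1\<close> is then \<open>SM \<phi>0 = g\<close>.\<close>
  define \<psi> where "\<psi> i = xm \<phi> (Suc i)" for i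
  have \<psi>h: "hm (\<psi> i) (X i) (Y i)" if "i \<le> Suc n" for i
    using m(2)[of "Suc i"] xX[OF that] xY[OF that] that by (simp add: \<psi>_def)
  have \<psi>c: "\<psi> (Suc i) \<odot> \<alpha> i = \<beta> i \<odot> \<psi> i" if "i \<le> n" for i
    using m(3)[of "Suc i"] that by (simp add: \<psi>_def)
  have \<psi>0: "\<psi> 0 = Idm D (X 0)" and \<psi>n: "\<psi> (Suc n) = g"
    using \<phi> \<phi>0 by (auto simp: \<psi>_def xm_last)
  let ?f = "\<lambda>i. \<psi> (Suc i)"
  let ?Q = "cone_obj n D (\<lambda>i. X (Suc i)) (\<lambda>i. Y (Suc i))"
  let ?q = "(cone_map n D (\<lambda>i. X (Suc i)) (\<lambda>i. \<alpha> (Suc i)) (\<lambda>i. Y (Suc i)) (\<lambda>i. \<beta> (Suc i)) ?f)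
    (Suc n := SM (\<alpha> 0) \<odot> \<beta> (Suc n))"
  \<comment> \<open>The mapping cone of the right rotations reduces to the right rotation of the
    desired cone: \<open>B\<close> is the desuspension of \<open>Y (n + 1)\<close>, and
    \<open>\<alpha> 0 \<odot> b\<close> suspends to the connecting morphism up to the rotation
    sign.\<close>
  let ?N = "case_nat B ?Q" and ?\<nu> = "case_nat (\<alpha> 0 \<odot> b) ?q"
  have oX: "X 0 \<in> Obj D" "X 1 \<in> Obj D" "Y 1 \<in> Obj D" "Y (Suc n) \<in> Obj D" "X (Suc n) \<in> Obj D"
      "Y n \<in> Obj D"
      "A \<in> Obj D" "B \<in> Obj D"
    using t0 x(1) by (auto simp: hm_def)
  have Qs: "sigma_seq n D SO ?Q ?q"
    by (rule cone_seq) (use x y \<psi>h t0 in \<open>auto simp: ang_simps\<close>)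
  have Q0: "?Q 0 = X 1" and Qn: "?Q (Suc n) = Y (Suc n)" by (auto simp: cone_obj_def)
  have Ns: "sigma_seq n D SO ?N ?\<nu>"
    by (rule case_nat_seq[OF Qs]) (use B Qn Q0 t0 in \<open>auto simp: cat_simps\<close>)
  have N: "?N 0 = B" "?N 1 = X 1" using Q0 by simp_all
  have NT: "?N i = T i" if "2 \<le> i" "i \<le> Suc n" for i
    using that xX[of i] by (cases i) (auto simp: cone_obj_def T_def angle_cone_obj_eq split:
        nat.split)
  have T0: "T 0 = Dsum D (X 0) B" and T1: "T 1 = Dsum D (X 1) (X 0)"
    and Tn: "T (Suc n) = Dsum D (X (Suc n)) (Y n)"
    using xX[of 0] xX[of 1] xX[of "Suc n"] X0 by (auto simp: T_def angle_cone_obj_eq)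
  have t1: "hm (\<alpha> 1) (X 1) (xo X 2)" and x2: "xo X 2 = X 2" "hm (\<alpha> 1) (X 1) (X 2)" "X 2 \<in> Obj D"
    using x(2)[of 1] n_pos x(3)[of 2] by (auto simp: numeral_2_eq_2)
  have q0: "?q 0 = col D (X 2) (Y 1) (neg (\<alpha> 1)) (\<psi> 1)"
    using mneg_eq[of "\<alpha> 1" "X 1" "X 2"] x2 by (simp add: cone_map_def hm_def numeral_2_eq_2)
  have qn: "?q n = row D (X (Suc n)) (Y n) g (\<beta> n)"
    using n_pos \<psi>n by (simp add: cone_map_def)
  have \<tau>: "\<tau> i = mat D (X i) (case_nat B Y i) (X (Suc i)) (Y i)
      (neg (\<alpha> i)) (Mzero D (case_nat B Y i) (X (Suc i))) (\<psi> i) (case_nat b \<beta> i)" if "i \<le> n" for i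
    using angle_cone_map_eq[OF X's that, of "case_nat B Y" "case_nat b \<beta>" \<phi>] xX[of i] xX[of
        "Suc i"] that
    by (simp add: \<tau>_def \<psi>_def)
  have \<nu>: "?\<nu> (Suc i) = ?q i" for i by simp
  have qT: "?\<nu> i = \<tau> i" if "2 \<le> i" "i \<le> n" for i
  proof -
    obtain k where k: "i = Suc (Suc k)" using \<open>2 \<le> i\<close> by (metis Suc_le_D numeral_2_eq_2 Suc_le_mono)
    have "mneg D (X i) (X (Suc i)) (\<alpha> i) = neg (\<alpha> i)"
      using x(4)[of i] that by (simp add: mneg_eq hm_def)
    then show ?thesis using k that by (simp add: \<tau> cone_map_def)
  qed
  have \<tau>l: "\<tau> (Suc n) = SM (Inl D (X 0) B) \<odot> (neg (SM a) \<odot> Prl D (X (Suc n)) (Y n)) \<boxplus>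
    SM (Inr D (X 0) B) \<odot> (g \<odot> Prl D (X (Suc n)) (Y n) \<boxplus> \<beta> n \<odot> Prr D (X (Suc n)) (Y n))"
    using angle_cone_map_last[OF X's Y's, of \<phi>] \<phi> \<phi>0 A(1) by (simp add: \<tau>_def)
  \<comment> \<open>The first map of \<open>T\<close> has the row \<open>[1 b]\<close> into
    \<open>X 0\<close> with kernel \<open>(-b, 1)\<close>, and \<open>[1 \<alpha>0]\<close> kills
    its column \<open>(-\<alpha>0, 1)\<close>. This is the cancellation of
    \<open>cone_angle_first\<close>, one position later.\<close>
  define j p where
    "j i = (if i = 0 then col D (X 0) B (neg b) (Idm D B)
      else if i = 1 then Inl D (X 1) (X 0) else Idm D (T i))" and
    "p i = (if i = 0 then Prr D (X 0) B
      else if i = 1 then row D (X 1) (X 0) (Idm D (X 1)) (\<alpha> 0) else Idm D (T i))" for i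
  have \<psi>1: "hm (\<psi> 1) (X 1) (Y 1)" "\<psi> 1 \<odot> \<alpha> 0 = \<beta> 0" using \<psi>h[of 1] \<psi>c[of 0] \<psi>0 t0
      by (auto simp: cat_simps)
  note s = t0 x2 \<psi>1(1) oX g(1)
  have jp: "hm (j i) (?N i) (T i) \<and> hm (p i) (T i) (?N i) \<and> p i \<odot> j i = Idm D (?N i)"
      if i: "i \<le> Suc n" for i
  proof -
    consider "i = 0" | "i = 1" | "2 \<le> i" by linarith
    then show ?thesis
    proof cases
      case 1 then show ?thesis
        using s N T0 by (simp add: j_def p_def col_def ang_simps)
    next
      case 2 then show ?thesis
        using s N T1 by (simp add: j_def p_def row_def ang_simps)
    next
      case 3 then show ?thesis
        using NT[of i] t(1)[of i] i by (simp add: j_def p_def cat_simps)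
    qed
  qed
  have z: "\<alpha> 1 \<odot> \<alpha> 0 = Mzero D (X 0) (X 2)" "SM b \<odot> \<beta> n = Mzero D (Y n) (SO (X 0))"
      "SM b \<odot> g = SM a"
    using comp_zero_in_P[OF X, of 0] comp_zero_in_P[OF Y, of n] x2 X0 g(2) t0 A(4) B(4) g(1) oX
    by (simp_all add: xo_last numeral_2_eq_2 sg_simps hm_def SO_in)
  have sb: "hm (SM b) (Y (Suc n)) (SO (X 0))" "hm (SM a) (X (Suc n)) (SO (X 0))"
    using hm_SM[OF t0(6)] hm_SM[OF t0(7)] A B by simp_all
  note z' = comp_reduce[OF z(1) t0(1) x2(2)] comp_reduce[OF \<psi>1(2) t0(1) \<psi>1(1)]
    comp_reduce[OF z(2) t0(5) sb(1)] comp_reduce[OF z(3) g(1) sb(1)]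
  have \<tau>0: "\<tau> 0 = mat D (X 0) B (X 1) (X 0) (neg (\<alpha> 0)) (Mzero D B (X 1)) (Idm D (X 0)) b"
    using \<tau>[of 0] \<psi>0 X0 by simp
  have \<tau>1: "\<tau> 1 = mat D (X 1) (X 0) (X 2) (Y 1) (neg (\<alpha> 1)) (Mzero D (X 0) (X 2)) (\<psi> 1) (\<beta> 0)"
    using \<tau>[of 1] X0 n_pos by (simp add: numeral_2_eq_2)
  have T2: "T 2 = Dsum D (X 2) (Y 1)"
    using n_pos xX[of 2] by (simp add: T_def angle_cone_obj_eq numeral_2_eq_2)
  have j0: "j 1 \<odot> (\<alpha> 0 \<odot> b) = \<tau> 0 \<odot> j 0"
    unfolding \<tau>0 using s by (simp add: j_def mat_def row_def col_def ang_simps)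
  have p0: "p 1 \<odot> \<tau> 0 = (\<alpha> 0 \<odot> b) \<odot> p 0"
    unfolding \<tau>0 using s by (simp add: p_def mat_def row_def col_def ang_simps)
  have j1: "j 2 \<odot> ?q 0 = \<tau> 1 \<odot> j 1"
    unfolding \<tau>1 q0 using s T2 by (simp add: j_def mat_def row_def col_def ang_simps)
  have p1: "p 2 \<odot> \<tau> 1 = ?q 0 \<odot> p 1"
    unfolding \<tau>1 q0 using s T2 z z' \<psi>1(2) by (simp add: p_def mat_def row_def col_def ang_simps)
  have jl: "SM (j 0) \<odot> ?q n = \<tau> (Suc n) \<odot> j (Suc n)"
    unfolding \<tau>l qn using s z z' sb Tn n_pos B(1)
        by (simp add: j_def mat_def row_def col_def ang_simps)
  have pl: "SM (p 0) \<odot> \<tau> (Suc n) = ?q n \<odot> p (Suc n)"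
    unfolding \<tau>l qn using s sb Tn n_pos B(1) by (simp add: p_def mat_def row_def col_def ang_simps)
  have "(?N, ?\<nu>) \<in> P"
  proof (rule retract_squares_in_P[OF T Ns jp])
    fix i assume i: "i \<le> Suc n"
    consider "i = 0" | "i = 1" | "2 \<le> i" "i \<le> n" | "i = Suc n" using i by linarith
    then show "xm j (Suc i) \<odot> ?\<nu> i = \<tau> i \<odot> j i \<and> xm p (Suc i) \<odot> \<tau> i = ?\<nu> i \<odot> p i"
    proof cases
      case 2 then show ?thesis using j1 p1 n_pos by (simp add: numeral_2_eq_2)
    next
      case 3
      then show ?thesis using qT[of i] t(1)[of i] t(1)[of "Suc i"] t(4)[of i]
        by (simp add: j_def p_def cat_simps)
    qed (use j0 jl p0 pl n_pos in \<open>simp_all add: xm_last \<nu>\<close>)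
  qed
  then have "(?Q, ?q) \<in> P"
    by (subst (asm) right_rotate_iff[OF Qs])
      (use B Qn Q0 t0 in \<open>auto simp: ang_simps sg_simps\<close>)
  moreover have "chain_map D n (\<lambda>i. X (Suc i)) (\<lambda>i. \<alpha> (Suc i)) (\<lambda>i. Y (Suc i)) (\<lambda>i. \<beta> (Suc i)) ?f"
    using \<psi>h \<psi>c x(1) y(1) by (subst chain_map_hm) auto
  ultimately show ?thesis unfolding cone_angle_def using \<psi>n by (intro exI[of _ ?f]) simp
qed

lemma right_rotate2E:
  assumes X: "(X, \<alpha>) \<in> P" and Y: "(Y, \<beta>) \<in> P" and Xn: "Y (Suc n) = X (Suc n)"
  obtains A a b where "hm a A (X 0)" "SM a = sg (\<alpha> (Suc n))" "(case_nat A X, case_nat a \<alpha>) \<in> P"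
    "hm b A (Y 0)" "SM b = sg (\<beta> (Suc n))" "(case_nat A Y, case_nat b \<beta>) \<in> P"
proof -
  obtain A a where A: "SO A = X (Suc n)" "A \<in> Obj D" "hm a A (X 0)" "SM a = sg (\<alpha> (Suc n))"
    "(case_nat A X, case_nat a \<alpha>) \<in> P" using right_rotateE[OF X] .
  obtain B b where B: "SO B = Y (Suc n)" "B \<in> Obj D" "hm b B (Y 0)" "SM b = sg (\<beta> (Suc n))"
    "(case_nat B Y, case_nat b \<beta>) \<in> P" using right_rotateE[OF Y] .
  have "B = A" using SO_inj A B Xn by simp
  then show ?thesis using that A B by blast
qed

text \<open>A right rotation makes the common last term a common first one and puts \<open>f\<close>
  in position \<open>1\<close>. The new first map suspends to \<open>sg (\<alpha> (n + 1))\<close>,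
  whence the sign in the connecting morphism.\<close>

lemma cone_angle_last_first:
  assumes X: "(X, \<alpha>) \<in> P" and Y: "(Y, \<beta>) \<in> P" and Xn: "Y (Suc n) = X (Suc n)"
    and f: "hm f (X 0) (Y 0)" "SM f \<odot> \<alpha> (Suc n) = \<beta> (Suc n)"
  shows "\<exists>\<phi>. chain_map D n X \<alpha> Y \<beta> \<phi> \<and> \<phi> 0 = f \<and>
    cone_angle X \<alpha> Y \<beta> \<phi> (sg (\<alpha> (Suc n)) \<odot> \<beta> n)"
proof -
  obtain A a b where r: "hm a A (X 0)" "SM a = sg (\<alpha> (Suc n))" "(case_nat A X, case_nat a \<alpha>) \<in> P"
    "hm b A (Y 0)" "SM b = sg (\<beta> (Suc n))" "(case_nat A Y, case_nat b \<beta>) \<in> P"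
    using right_rotate2E[OF X Y Xn] .
  have "f \<odot> a = b"
  proof (rule SM_inj)
    show "SM (f \<odot> a) = SM b"
      using f r seqD(5)[OF P_seq[OF X]] by (simp add: ang_simps sg_simps)
  qed (use f r in \<open>auto simp: cat_simps\<close>)
  then show ?thesis
    using cone_angle_first[OF r(3,6), of f] f r(2) by simp
qed

lemma cone_angle_last:
  assumes X: "(X, \<alpha>) \<in> P" and Y: "(Y, \<beta>) \<in> P" and Xn: "Y (Suc n) = X (Suc n)"
    and g: "hm g (X n) (Y n)" "\<beta> n \<odot> g = \<alpha> n"
  shows "\<exists>\<phi>. chain_map D n X \<alpha> Y \<beta> \<phi> \<and> \<phi> n = g \<and>
    cone_angle X \<alpha> Y \<beta> \<phi> (sg (\<alpha> (Suc n)) \<odot> \<beta> n)"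
proof -
  obtain A a b where r: "hm a A (X 0)" "SM a = sg (\<alpha> (Suc n))" "(case_nat A X, case_nat a \<alpha>) \<in> P"
    "hm b A (Y 0)" "SM b = sg (\<beta> (Suc n))" "(case_nat A Y, case_nat b \<beta>) \<in> P"
    using right_rotate2E[OF X Y Xn] .
  show ?thesis using cone_angle_first_last[OF r(3,6), of g] g r(2) by simp
qed

section \<open>The extension-closed subcategory\<close>

text \<open>Conjugation by the automorphisms \<open>1\<close> and \<open>-1\<close> of the terms,
  where \<open>s\<close> marks the positions with \<open>-1\<close>: a map changes sign when exactly
  one of its ends is marked. Marking an outer position changes one recorded map and the connecting
  morphism, which removes the sign left over by a cone.\<close>

lemma sign_change_in_P:
  fixes s :: "nat \<Rightarrow> bool"
  assumes X: "(X, \<alpha>) \<in> P"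
  shows "(X, \<lambda>i. if s i \<noteq> (if i = Suc n then s 0 else s (Suc i)) then neg (\<alpha> i) else \<alpha> i) \<in> P"
proof -
  let ?\<beta> = "\<lambda>i. if s i \<noteq> (if i = Suc n then s 0 else s (Suc i)) then neg (\<alpha> i) else \<alpha> i"
  let ?f = "\<lambda>i. if s i then neg (Idm D (X i)) else Idm D (X i)"
  note Xs = P_seq[OF X] note x = seqD[OF Xs]
  have Ys: "sigma_seq n D SO X ?\<beta>" unfolding seq_iff using x(1,2) by (simp add: cat_simps)
  have "isomor D (X i) (X i) (?f i)" if "i \<le> Suc n" for i
    using x(1)[OF that] by (intro isomorI[of _ _ _ "?f i"]) (auto simp: cat_simps)
  moreover have "sigma_map n D SM X \<alpha> X ?\<beta> ?f" unfolding map_iff[OF Xs Ys]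
  proof (intro conjI allI impI)
    fix i assume i: "i \<le> Suc n"
    show "hm (?f i) (X i) (X i)" using x(1)[OF i] by (simp add: cat_simps)
    have "xm ?f (Suc i) = (if (if i = Suc n then s 0 else s (Suc i)) then neg (Idm D (xo X (Suc i)))
        else Idm D (xo X (Suc i)))"
      using i x(1)[of 0] by (auto simp: xm_def xo_def ang_simps)
    moreover have "(if v then neg (Idm D A') else Idm D A') \<odot> a = (if u \<noteq> v then neg a else a) \<odot> (if
        u then neg (Idm D A) else Idm D A)"
      if "hm a A A'" for u v a A A'
      using that by (auto simp: cat_simps)
    ultimately show "xm ?f (Suc i) \<odot> \<alpha> i = ?\<beta> i \<odot> ?f i"
      using x(2)[OF i] by (simp only:)
  qed
  ultimately have "sigma_iso n D SM X \<alpha> X ?\<beta> ?f" unfolding sigma_iso_def Suc_eq_plus1 by blast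
  then show ?thesis by (rule F1_iso[OF X Ys])
qed

end

locale extension_closed = angulated n D SO SM P
  for n :: nat and D :: "('o, 'm) addcat" (structure)
    and SO :: "'o \<Rightarrow> 'o" and SM :: "'m \<Rightarrow> 'm" and P :: "('o, 'm) sq set" +
  fixes B :: "'o set"
  assumes sub: "additive_subcategory D B"
    and ext_closed: "n_extension_closed n D SO P B"
    and vanish: "\<forall>A \<in> B. \<forall>A' \<in> B. Hom D (SO A) A' = {Mzero D (SO A) A'}"
begin

lemma B_Obj: "A \<in> B \<Longrightarrow> A \<in> Obj D"
  and B_Zobj: "Zobj D \<in> B"
  and B_Dsum: "A \<in> B \<Longrightarrow> A' \<in> B \<Longrightarrow> Dsum D A A' \<in> B"
  using sub by (auto simp: additive_subcategory_def)

lemma vanish_hm: "hm h (SO A) A' \<Longrightarrow> A \<in> B \<Longrightarrow> A' \<in> B \<Longrightarrow> h = Mzero D (SO A) A'"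
  using vanish by (auto simp: hm_iff)

lemma full_sub_simps [simp]:
  "Obj (full_sub D B) = B" "Hom (full_sub D B) = Hom D" "Idm (full_sub D B) = Idm D"
  "Comp (full_sub D B) = Comp D" "Madd (full_sub D B) = Madd D" "Mzero (full_sub D B) = Mzero D"
  "Zobj (full_sub D B) = Zobj D" "Dsum (full_sub D B) = Dsum D"
  "Inl (full_sub D B) = Inl D" "Inr (full_sub D B) = Inr D"
  "Prl (full_sub D B) = Prl D" "Prr (full_sub D B) = Prr D"
  "hom_group (full_sub D B) = hom_group D" "mneg (full_sub D B) = mneg D"
  "isomor (full_sub D B) = isomor D"
  "row (full_sub D B) = row D" "col (full_sub D B) = col D" "mat (full_sub D B) = mat D"
  by (auto simp: full_sub_def hom_group_def mneg_def isomor_def row_def col_def mat_def fun_eq_iff)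

lemma full_sub_cone [simp]:
  "chain_map (full_sub D B) = chain_map D"
  "cone_obj n (full_sub D B) = cone_obj n D" "cone_map n (full_sub D B) = cone_map n D"
  by (auto simp: chain_map_def cone_obj_def cone_map_def fun_eq_iff)

lemma full_sub_additive: "additive_category (full_sub D B)"
proof (intro additive_category.intro additive_category_axioms.intro category.intro)
  show "A = A' \<and> Ba = B'" if "A \<in> Obj (full_sub D B)" "Ba \<in> Obj (full_sub D B)"
      "A' \<in> Obj (full_sub D B)"
    "B' \<in> Obj (full_sub D B)" "f \<in> Hom (full_sub D B) A Ba" "f \<in> Hom (full_sub D B) A' B'"
        for A A' Ba B' f
    using Hom_disjoint[of A Ba A' B' f] that B_Obj by simp
qed (auto simp: B_Obj B_Zobj B_Dsum Idm_in hom_comm_group Zobj_zero Inl_in Inr_in Prl_in Prr_in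
    Prl_Inl Prr_Inr Prl_Inr Prr_Inl Dsum_decomp,
    (metis B_Obj Comp_in Comp_assoc Comp_Idm Idm_Comp Comp_Madd_right Comp_Madd_left)+)

abbreviation \<X> where "\<X> \<equiv> ext_sequences n D SO P B"

lemma ext_sequencesI:
  assumes "(X, \<alpha>) \<in> P" "\<And>i. i \<le> Suc n \<Longrightarrow> X i \<in> B" "\<And>i. i \<le> n \<Longrightarrow> d i = \<alpha> i"
  shows "(X, d) \<in> \<X>"
proof -
  have "(X, d(n + 1 := \<alpha> (n + 1))) \<in> P"
    by (rule P_cong[OF assms(1)]) (use assms(3) in auto)
  moreover have "\<alpha> (n + 1) \<in> Hom D (X (n + 1)) (SO (X 0))"
    using seqD(5)[OF P_seq[OF assms(1)]] by (simp add: hm_iff)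
  ultimately show ?thesis using assms(2) by (auto simp: ext_sequences_def)
qed

lemma ext_sequencesE:
  assumes "(X, d) \<in> \<X>"
  obtains \<alpha> where "(X, \<alpha>) \<in> P" "\<And>i. i \<le> n \<Longrightarrow> \<alpha> i = d i" "\<And>i. i \<le> Suc n \<Longrightarrow> X i \<in> B"
proof -
  obtain \<delta> where "(X, d(n + 1 := \<delta>)) \<in> P" "\<forall>i\<le>n + 1. X i \<in> B"
    using assms unfolding ext_sequences_def by auto
  then show ?thesis using that[of "d(n + 1 := \<delta>)"] by auto
qed

lemma extensionE:
  assumes "A \<in> B" "C \<in> B" "hm \<delta> C (SO A)"
  obtains X \<alpha> where "(X, \<alpha>) \<in> P" "X 0 = A" "X (Suc n) = C" "\<alpha> (Suc n) = \<delta>"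
    "\<And>i. i \<le> Suc n \<Longrightarrow> X i \<in> B" "(X, \<alpha>) \<in> \<X>"
proof -
  obtain X \<alpha> where X: "(X, \<alpha>) \<in> P" "X 0 = A" "X (Suc n) = C" "\<alpha> (Suc n) = \<delta>" "\<forall>i\<in>{1..n}. X i \<in> B"
    using ext_closed assms unfolding n_extension_closed_def hm_iff Suc_eq_plus1 by blast
  have "X i \<in> B" if "i \<le> Suc n" for i
  proof (cases "i = 0 \<or> i = Suc n")
    case False
    then have "i \<in> {1..n}" using that by auto
    then show ?thesis using X by blast
  qed (use X assms in auto)
  then show ?thesis using that X ext_sequencesI[of X \<alpha> \<alpha>] by blast
qed

section \<open>The sequences of the class are \<open>n\<close>-exact in \<open>B\<close>\<close>

lemma cov_exact_iff:
  assumes X: "\<And>i. i \<le> m \<Longrightarrow> X i \<in> Obj D" and d: "\<And>i. i < m \<Longrightarrow> hm (d i) (X i) (X (Suc i))"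
    and c: "\<And>i. Suc i < m \<Longrightarrow> d (Suc i) \<odot> d i = Mzero D (X i) (X (Suc (Suc i)))" and m: "1 \<le> m"
  shows "cov_exact (full_sub D B) m X d \<longleftrightarrow> (\<forall>T\<in>B.
    (\<forall>h. hm h T (X 0) \<and> d 0 \<odot> h = Mzero D T (X 1) \<longrightarrow> h = Mzero D T (X 0)) \<and>
    (\<forall>i h. Suc i < m \<and> hm h T (X (Suc i)) \<and> d (Suc i) \<odot> h = Mzero D T (X (Suc (Suc i)))
      \<longrightarrow> (\<exists>h'. hm h' T (X i) \<and> h = d i \<odot> h')))"
proof -
  have 1: "kernel (hom_group D T (X 0)) (hom_group D T (X 1)) (\<lambda>h. d 0 \<odot> h) = {Mzero D T (X 0)} \<longleftrightarrow>
     (\<forall>h. hm h T (X 0) \<and> d 0 \<odot> h = Mzero D T (X 1) \<longrightarrow> h = Mzero D T (X 0))" if "T \<in> B" for T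
  proof -
    have "hm (Mzero D T (X 0)) T (X 0)" "d 0 \<odot> Mzero D T (X 0) = Mzero D T (X 1)"
      using X[of 0] d[of 0] m B_Obj[OF that] by (simp_all add: cat_simps)
    then show ?thesis using X[of 0] B_Obj[OF that] by (auto simp: kernel_def hm_iff)
  qed
  have 2: "kernel (hom_group D T (X (i + 1))) (hom_group D T (X (i + 2))) (\<lambda>h. d (i + 1) \<odot> h)
        = (\<lambda>h. d i \<odot> h) ` Hom D T (X i) \<longleftrightarrow>
    (\<forall>h. hm h T (X (Suc i)) \<and> d (Suc i) \<odot> h = Mzero D T (X (Suc (Suc i)))
      \<longrightarrow> (\<exists>h'. hm h' T (X i) \<and> h = d i \<odot> h'))" if T: "T \<in> B" and i: "i + 1 < m" for T i
  proof -
    have dd: "hm (d i \<odot> h) T (X (Suc i)) \<and> d (Suc i) \<odot> (d i \<odot> h) = Mzero D T (X (Suc (Suc i)))"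
      if "hm h T (X i)" for h
      using that d[of i] d[of "Suc i"] i comp_reduce[OF c[of i] d[of i] d[of "Suc i"], of h T]
          by (simp add: cat_simps)
    have h: "h \<in> Hom D T (X k) \<longleftrightarrow> hm h T (X k)" if "k \<le> m" for h k
      using X[OF that] B_Obj[OF T] by (simp add: hm_iff)
    have "kernel (hom_group D T (X (i + 1))) (hom_group D T (X (i + 2))) (\<lambda>h. d (i + 1) \<odot> h)
      = {h. hm h T (X (Suc i)) \<and> d (Suc i) \<odot> h = Mzero D T (X (Suc (Suc i)))}"
      unfolding kernel_def using h[of "Suc i"] i by (auto simp: numeral_2_eq_2)
    moreover have "(\<lambda>h. d i \<odot> h) ` Hom D T (X i) = {h. \<exists>h'. hm h' T (X i) \<and> h = d i \<odot> h'}"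
      using h[of i] i by auto
    ultimately show ?thesis using dd by (simp add: set_eq_iff) blast
  qed
  show ?thesis unfolding cov_exact_def using 1 2 by simp blast
qed

lemma contra_exact_iff:
  assumes X: "\<And>i. i \<le> m \<Longrightarrow> X i \<in> Obj D" and d: "\<And>i. i < m \<Longrightarrow> hm (d i) (X i) (X (Suc i))"
    and c: "\<And>i. Suc i < m \<Longrightarrow> d (Suc i) \<odot> d i = Mzero D (X i) (X (Suc (Suc i)))" and m: "1 \<le> m"
  shows "contra_exact (full_sub D B) m X d \<longleftrightarrow> (\<forall>T\<in>B.
    (\<forall>h. hm h (X m) T \<and> h \<odot> d (m - 1) = Mzero D (X (m - 1)) T \<longrightarrow> h = Mzero D (X m) T) \<and>
    (\<forall>i h. Suc i < m \<and> hm h (X (Suc i)) T \<and> h \<odot> d i = Mzero D (X i) T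
      \<longrightarrow> (\<exists>h'. hm h' (X (Suc (Suc i))) T \<and> h = h' \<odot> d (Suc i))))"
proof -
  have 1: "kernel (hom_group D (X m) T) (hom_group D (X (m - 1)) T) (\<lambda>h. h \<odot> d (m - 1)) = {Mzero D
      (X m) T} \<longleftrightarrow>
     (\<forall>h. hm h (X m) T \<and> h \<odot> d (m - 1) = Mzero D (X (m - 1)) T \<longrightarrow> h = Mzero D (X m) T)" if "T \<in> B"
         for T
  proof -
    have "hm (Mzero D (X m) T) (X m) T" "Mzero D (X m) T \<odot> d (m - 1) = Mzero D (X (m - 1)) T"
      using X[of m] d[of "m - 1"] m B_Obj[OF that] by (simp_all add: cat_simps)
    then show ?thesis using X[of m] B_Obj[OF that] by (auto simp: kernel_def hm_iff)
  qed
  have 2: "kernel (hom_group D (X (i + 1)) T) (hom_group D (X i) T) (\<lambda>h. h \<odot> d i)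
        = (\<lambda>h. h \<odot> d (i + 1)) ` Hom D (X (i + 2)) T \<longleftrightarrow>
    (\<forall>h. hm h (X (Suc i)) T \<and> h \<odot> d i = Mzero D (X i) T
      \<longrightarrow> (\<exists>h'. hm h' (X (Suc (Suc i))) T \<and> h = h' \<odot> d (Suc i)))" if T: "T \<in> B" and i: "i + 1 < m"
          for T i
  proof -
    have dd: "hm (h \<odot> d (Suc i)) (X (Suc i)) T \<and> (h \<odot> d (Suc i)) \<odot> d i = Mzero D (X i) T"
      if "hm h (X (Suc (Suc i))) T" for h
      using that d[of i] d[of "Suc i"] i c[of i] by (simp add: cat_simps)
    have h: "h \<in> Hom D (X k) T \<longleftrightarrow> hm h (X k) T" if "k \<le> m" for h k
      using X[OF that] B_Obj[OF T] by (simp add: hm_iff)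
    have "kernel (hom_group D (X (i + 1)) T) (hom_group D (X i) T) (\<lambda>h. h \<odot> d i)
      = {h. hm h (X (Suc i)) T \<and> h \<odot> d i = Mzero D (X i) T}"
      unfolding kernel_def using h[of "Suc i"] i by auto
    moreover have "(\<lambda>h. h \<odot> d (i + 1)) ` Hom D (X (i + 2)) T =
      {h. \<exists>h'. hm h' (X (Suc (Suc i))) T \<and> h = h' \<odot> d (Suc i)}"
      using h[of "Suc (Suc i)"] i by (auto simp: numeral_2_eq_2)
    ultimately show ?thesis using dd by (simp add: set_eq_iff) blast
  qed
  show ?thesis unfolding contra_exact_def using 1 2 by simp blast
qed

lemma is_complex_iff:
  "is_complex (full_sub D B) m X d \<longleftrightarrow> (\<forall>i\<le>m. X i \<in> B) \<and> (\<forall>i<m. hm (d i) (X i) (X (Suc i))) \<and>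
    (\<forall>i. Suc i < m \<longrightarrow> d (Suc i) \<odot> d i = Mzero D (X i) (X (Suc (Suc i))))"
proof -
  have "d i \<in> Hom D (X i) (X (Suc i)) \<longleftrightarrow> hm (d i) (X i) (X (Suc i))"
    if "\<forall>i\<le>m. X i \<in> B" "i < m" for i using that B_Obj by (simp add: hm_iff)
  then show ?thesis unfolding is_complex_def by (auto simp: numeral_2_eq_2)
qed

text \<open>In inner positions this is the exactness of the angle. At the left end a morphism killed
  by \<open>d 0\<close> comes from one \<open>SO T \<rightarrow> X (n + 1)\<close>, at the right end
  a morphism that kills \<open>d n\<close> factors through one
  \<open>SO (X 0) \<rightarrow> T\<close>; for \<open>T\<close> in \<open>B\<close> both are
  zero.\<close>

lemma ext_sequences_exact:
  assumes "(X, d) \<in> \<X>"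
  shows "n_exact_seq n (full_sub D B) X d"
proof -
  obtain \<alpha> where X: "(X, \<alpha>) \<in> P" and d: "\<And>i. i \<le> n \<Longrightarrow> \<alpha> i = d i" and XB: "\<And>i. i \<le> Suc n \<Longrightarrow> X i \<in> B"
    using ext_sequencesE[OF assms] by blast
  note x = seqD[OF P_seq[OF X]]
  have dh: "hm (d i) (X i) (X (Suc i))" if "i < Suc n" for i using x(4)[of i] d[of i] that by simp
  have c: "d (Suc i) \<odot> d i = Mzero D (X i) (X (Suc (Suc i)))" if "Suc i < Suc n" for i
    using comp_zero_in_P[OF X, of i] d[of i] d[of "Suc i"] that by simp
  have "is_complex (full_sub D B) (Suc n) X d" unfolding is_complex_iff using XB dh c by auto
  moreover have "cov_exact (full_sub D B) (Suc n) X d"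
  proof (subst cov_exact_iff, goal_cases)
    case 5
    show ?case
    proof (intro ballI conjI allI impI; elim conjE)
      fix T h assume T: "T \<in> B" and h: "hm h T (X 0)" "d 0 \<odot> h = Mzero D T (X 1)"
      then obtain h' where h': "hm h' (SO T) (X (Suc n))" "\<alpha> (Suc n) \<odot> h' = SM h"
        using cov_exact_first_in_P[OF X] d[of 0] by auto
      have "h' = Mzero D (SO T) (X (Suc n))" by (rule vanish_hm) (use h' T XB in auto)
      then have "SM h = SM (Mzero D T (X 0))"
        using h' h x(5) by (simp add: ang_simps)
      then show "h = Mzero D T (X 0)" using h SM_inj[of h "Mzero D T (X 0)" T "X 0"]
          by (simp add: cat_simps)
    next
      fix T i h assume "T \<in> B" "Suc i < Suc n" "hm h T (X (Suc i))"
          "d (Suc i) \<odot> h = Mzero D T (X (Suc (Suc i)))"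
      then show "\<exists>h'. hm h' T (X i) \<and> h = d i \<odot> h'"
        using cov_exact_in_P[OF X, of i h T] d[of i] d[of "Suc i"] by auto
    qed
  qed (use x(1) dh c in auto)
  moreover have "contra_exact (full_sub D B) (Suc n) X d"
  proof (subst contra_exact_iff, goal_cases)
    case 5
    show ?case
    proof (intro ballI conjI allI impI; elim conjE)
      fix T h assume T: "T \<in> B"
          and h: "hm h (X (Suc n)) T" "h \<odot> d (Suc n - 1) = Mzero D (X (Suc n - 1)) T"
      then obtain h' where h': "hm h' (SO (X 0)) T" "h = h' \<odot> \<alpha> (Suc n)"
        using contra_exact_in_P[OF X, of n h T] d[of n] by (auto simp: xo_last)
      have "h' = Mzero D (SO (X 0)) T" by (rule vanish_hm) (use h' T XB in auto)
      then show "h = Mzero D (X (Suc n)) T" using h' h x(5) by (simp add: ang_simps)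
    next
      fix T i h assume "T \<in> B" "Suc i < Suc n" "hm h (X (Suc i)) T" "h \<odot> d i = Mzero D (X i) T"
      then show "\<exists>h'. hm h' (X (Suc (Suc i))) T \<and> h = h' \<odot> d (Suc i)"
        using contra_exact_in_P[OF X, of i h T] d[of i] d[of "Suc i"] by auto
    qed
  qed (use x(1) dh c in auto)
  ultimately show ?thesis by (simp add: n_exact_seq_def)
qed

lemma ext_sequences_zero: "((\<lambda>i. Zobj D), (\<lambda>i. Mzero D (Zobj D) (Zobj D))) \<in> \<X>"
proof (rule ext_sequencesI)
  let ?\<alpha> = "(\<lambda>i. Mzero D (Zobj D) (Zobj D))(Suc n := Mzero D (Zobj D) (SO (Zobj D)))"
  have s: "sigma_seq n D SO (\<lambda>i. Zobj D) ?\<alpha>"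
    unfolding seq_iff by (auto simp: xo_def ang_simps)
  show "(\<lambda>i. Zobj D, ?\<alpha>) \<in> P"
    by (rule elementary_angle[OF s, of 0])
      (use isomor_id[OF Zobj_in] in \<open>auto simp: zero_object_Zobj Zobj_zero\<close>)
qed (auto simp: B_Zobj)

section \<open>Pushouts and pullbacks\<close>

lemma cone_obj_B:
  assumes "\<And>i. i \<le> n \<Longrightarrow> X i \<in> B" "\<And>i. i \<le> n \<Longrightarrow> Y i \<in> B" "i \<le> Suc n"
  shows "cone_obj n D X Y i \<in> B"
  using assms by (auto simp: cone_obj_def B_Dsum)

lemma cone_map_cong:
  assumes "\<And>i. i < n \<Longrightarrow> d i = d' i" "\<And>i. i < n \<Longrightarrow> e i = e' i"
  shows "cone_map n D X d Y e \<phi> = cone_map n D X d' Y e' \<phi>"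
  using assms n_pos by (auto simp: cone_map_def fun_eq_iff)

text \<open>A reduced cone over \<open>B\<close> is itself a sequence of the class. Its exactness in
  the second variable gives pushout diagrams, that in the first variable pullback diagrams.\<close>

lemma cone_exact:
  assumes "cone_angle X \<alpha> Y \<beta> \<phi> \<epsilon>" "\<And>i. i \<le> n \<Longrightarrow> X i \<in> B" "\<And>i. i \<le> n \<Longrightarrow> Y i \<in> B"
  shows "n_exact_seq n (full_sub D B) (cone_obj n D X Y) (cone_map n D X \<alpha> Y \<beta> \<phi>)"
  by (rule ext_sequences_exact, rule ext_sequencesI[OF assms(1)[unfolded cone_angle_def]])
    (use cone_obj_B[OF assms(2,3)] in auto)

lemma is_complex_mono: "is_complex D' m X d \<Longrightarrow> m' \<le> m \<Longrightarrow> is_complex D' m' X d"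
  by (auto simp: is_complex_def)

text \<open>The bottom row realises in \<open>B\<close> the class of \<open>X\<close> pushed forward
  along \<open>f\<close>, that is, \<open>SM f \<odot> \<alpha> (n + 1)\<close>. The two angles then
  share their last term, so a reduced cone of a morphism starting with \<open>f\<close>
  exists.\<close>

lemma ext_sequences_pushout:
  assumes "(X, d) \<in> \<X>" "Y0 \<in> B" "f \<in> Hom D (X 0) Y0"
  shows "\<exists>Y e \<phi>. n_pushout n (full_sub D B) X d Y e \<phi> \<and> Y 0 = Y0 \<and> \<phi> 0 = f \<and> e 0 \<in> adm_mono \<X>"
proof -
  obtain \<alpha> where X: "(X, \<alpha>) \<in> P" and d: "\<And>i. i \<le> n \<Longrightarrow> \<alpha> i = d i" and XB: "\<And>i. i \<le> Suc n \<Longrightarrow> X i \<in> B"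
    using ext_sequencesE[OF assms(1)] by blast
  note x = seqD[OF P_seq[OF X]]
  have f: "hm f (X 0) Y0" using assms B_Obj x(1)[of 0] by (simp add: hm_iff)
  have "hm (SM f \<odot> \<alpha> (Suc n)) (X (Suc n)) (SO Y0)" using f x(5) by (simp add: ang_simps)
  then obtain Y \<beta> where Y: "(Y, \<beta>) \<in> P" "Y 0 = Y0" "Y (Suc n) = X (Suc n)"
      "\<beta> (Suc n) = SM f \<odot> \<alpha> (Suc n)"
    "\<And>i. i \<le> Suc n \<Longrightarrow> Y i \<in> B" "(Y, \<beta>) \<in> \<X>"
    using extensionE assms(2) XB[of "Suc n"] by blast
  obtain \<phi> where \<phi>: "chain_map D n X \<alpha> Y \<beta> \<phi>" "\<phi> 0 = f"
    and c: "cone_angle X \<alpha> Y \<beta> \<phi> (sg (\<alpha> (Suc n)) \<odot> \<beta> n)"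
    using cone_angle_last_first[OF X Y(1,3), of f] f Y by auto
  have cm: "cone_map n D X \<alpha> Y \<beta> \<phi> = cone_map n D X d Y \<beta> \<phi>"
    by (rule cone_map_cong) (use d in auto)
  have "chain_map D n X d Y \<beta> \<phi>" using \<phi>(1) d by (simp add: chain_map_def)
  then have "n_pushout n (full_sub D B) X d Y \<beta> \<phi>"
    using cone_exact[OF c] XB Y(5) ext_sequences_exact[OF assms(1)] ext_sequences_exact[OF Y(6)]
    by (auto simp: n_pushout_def n_exact_seq_def cm intro: is_complex_mono)
  moreover have "\<beta> 0 \<in> adm_mono \<X>" using Y(6) by (auto simp: adm_mono_def)
  ultimately show ?thesis using Y(2) \<phi>(2) by blast
qed

lemma is_complex_shift: "is_complex D' (Suc m) X d \<Longrightarrow>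
    is_complex D' m (\<lambda>i. X (Suc i)) (\<lambda>i. d (Suc i))"
  by (auto simp: is_complex_def)

text \<open>Here the class of \<open>X\<close> is pulled back to
  \<open>\<alpha> (n + 1) \<odot> g\<close>. The two angles share their first term, which the
  truncation drops.\<close>

lemma ext_sequences_pullback:
  assumes "(X, d) \<in> \<X>" "Y' \<in> B" "g \<in> Hom D Y' (X (n + 1))"
  shows "\<exists>Y e \<phi>. n_pullback n (full_sub D B) Y e (\<lambda>i. X (i + 1)) (\<lambda>i. d (i + 1)) \<phi> \<and>
          Y n = Y' \<and> \<phi> n = g \<and> e (n - 1) \<in> adm_epi n \<X>"
proof -
  obtain \<alpha> where X: "(X, \<alpha>) \<in> P" and d: "\<And>i. i \<le> n \<Longrightarrow> \<alpha> i = d i" and XB: "\<And>i. i \<le> Suc n \<Longrightarrow> X i \<in> B"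
    using ext_sequencesE[OF assms(1)] by blast
  note x = seqD[OF P_seq[OF X]]
  have g: "hm g Y' (X (Suc n))" using assms B_Obj x(1)[of "Suc n"] by (simp add: hm_iff)
  have "hm (\<alpha> (Suc n) \<odot> g) Y' (SO (X 0))" using g x(5) by (simp add: ang_simps)
  then obtain Y \<beta> where Y: "(Y, \<beta>) \<in> P" "Y 0 = X 0" "Y (Suc n) = Y'" "\<beta> (Suc n) = \<alpha> (Suc n) \<odot> g"
    "\<And>i. i \<le> Suc n \<Longrightarrow> Y i \<in> B" "(Y, \<beta>) \<in> \<X>"
    using extensionE assms(2) XB[of 0] by blast
  let ?Y = "\<lambda>i. Y (Suc i)" and ?\<beta> = "\<lambda>i. \<beta> (Suc i)" and ?X = "\<lambda>i. X (Suc i)"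
  obtain \<phi> where \<phi>: "chain_map D n ?Y ?\<beta> ?X (\<lambda>i. \<alpha> (Suc i)) \<phi>" "\<phi> n = g"
    and c: "cone_angle ?Y ?\<beta> ?X (\<lambda>i. \<alpha> (Suc i)) \<phi> (SM (\<beta> 0) \<odot> \<alpha> (Suc n))"
    using cone_angle_first_last[OF Y(1) X, of g] g Y by auto
  have cm: "cone_map n D ?Y ?\<beta> ?X (\<lambda>i. \<alpha> (Suc i)) \<phi> = cone_map n D ?Y ?\<beta> ?X (\<lambda>i. d (Suc i)) \<phi>"
    by (rule cone_map_cong) (use d in auto)
  have "chain_map D n ?Y ?\<beta> ?X (\<lambda>i. d (Suc i)) \<phi>" using \<phi>(1) d by (simp add: chain_map_def)
  then have "n_pullback n (full_sub D B) ?Y ?\<beta> ?X (\<lambda>i. d (Suc i)) \<phi>"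
    using cone_exact[OF c] XB Y(5) ext_sequences_exact[OF assms(1)] ext_sequences_exact[OF Y(6)]
    by (auto simp: n_pullback_def n_exact_seq_def cm intro: is_complex_shift)
  moreover have "?\<beta> (n - 1) \<in> adm_epi n \<X>" using Y(6) n_pos by (auto simp: adm_epi_def)
  ultimately show ?thesis using Y(3) \<phi>(2) by (intro exI[of _ ?Y] exI[of _ ?\<beta>] exI[of _ \<phi>]) simp
qed

section \<open>Composites of admissible monomorphisms and epimorphisms\<close>

lemma adm_monoI: "(X, d) \<in> \<Y> \<Longrightarrow> d 0 \<in> adm_mono \<Y>"
  and adm_epiI: "(X, d) \<in> \<Y> \<Longrightarrow> d k \<in> adm_epi k \<Y>"
  by (auto simp: adm_mono_def adm_epi_def)

text \<open>
  Let \<open>Q\<close> be the cone of a good morphism from the angle of \<open>g\<close> along the second map of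
  the angle of \<open>f\<close>.  It starts with the column of \<open>g\<close> and this second map, so it maps to
  the rotated angle of \<open>f\<close>; the cone of that morphism, with the common summand \<open>X 2\<close>
  split off, is a rotated angle on \<open>g \<odot> f\<close>.
\<close>

lemma adm_mono_comp:
  assumes f: "hm f A M" "f \<in> adm_mono \<X>" and g: "hm g M C" "g \<in> adm_mono \<X>"
  shows "g \<odot> f \<in> adm_mono \<X>"
proof -
  obtain X d where Xd: "(X, d) \<in> \<X>" "d 0 = f" using f(2) by (auto simp: adm_mono_def)
  obtain \<alpha> where X: "(X, \<alpha>) \<in> P" and d: "\<And>i. i \<le> n \<Longrightarrow> \<alpha> i = d i" and XB: "\<And>i. i \<le> Suc n \<Longrightarrow> X i \<in> B"
    using ext_sequencesE[OF Xd(1)] by blast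
  obtain Y e where Ye: "(Y, e) \<in> \<X>" "e 0 = g" using g(2) by (auto simp: adm_mono_def)
  obtain \<gamma> where Y: "(Y, \<gamma>) \<in> P" and e: "\<And>i. i \<le> n \<Longrightarrow> \<gamma> i = e i" and YB: "\<And>i. i \<le> Suc n \<Longrightarrow> Y i \<in> B"
    using ext_sequencesE[OF Ye(1)] by blast
  note x = seqD[OF P_seq[OF X]] and y = seqD[OF P_seq[OF Y]]
  \<comment> \<open>Membership in \<open>adm_mono\<close> records only the morphism; hom-sets being
    disjoint, its source and target determine the terms of the angle.\<close>
  have f0: "\<alpha> 0 = f" "X 0 = A" "X 1 = M" using d[of 0] Xd(2) x(4)[of 0] f(1)
      by (auto simp: hm_def arw.inject)
  have g0: "\<gamma> 0 = g" "Y 0 = M" "Y 1 = C" using e[of 0] Ye(2) y(4)[of 0] g(1)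
      by (auto simp: hm_def arw.inject)
  have a1: "hm (\<alpha> 1) M (X 2)" using x(4)[of 1] n_pos f0 by (simp add: numeral_2_eq_2)
  have X2: "X 2 \<in> B" "C \<in> B" "A \<in> B" using XB[of 2] YB[of 1] XB[of 0] n_pos g0 f0 by auto
  have "hm (SM (\<alpha> 1) \<odot> \<gamma> (Suc n)) (Y (Suc n)) (SO (X 2))" using a1 y(5) g0 by (simp add: ang_simps)
  then obtain E \<eta> where E: "(E, \<eta>) \<in> P" "E 0 = X 2" "E (Suc n) = Y (Suc n)"
      "\<eta> (Suc n) = SM (\<alpha> 1) \<odot> \<gamma> (Suc n)"
    "\<And>i. i \<le> Suc n \<Longrightarrow> E i \<in> B"
    using extensionE X2(1) YB[of "Suc n"] by blast
  obtain \<phi> where \<phi>: "\<phi> 0 = \<alpha> 1" and c: "cone_angle Y \<gamma> E \<eta> \<phi> (sg (\<gamma> (Suc n)) \<odot> \<eta> n)"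
    using cone_angle_last_first[OF Y E(1,3), of "\<alpha> 1"] a1 E g0 by auto
  define Q q where "Q = cone_obj n D Y E"
    and "q = (cone_map n D Y \<gamma> E \<eta> \<phi>)(Suc n := sg (\<gamma> (Suc n)) \<odot> \<eta> n)"
  have Q: "(Q, q) \<in> P" using c by (simp add: cone_angle_def Q_def q_def)
  have QB: "Q i \<in> B" if "i \<le> Suc n" for i
    unfolding Q_def by (rule cone_obj_B) (use YB E(5) that in auto)
  have Q01: "Q 0 = M" "Q 1 = Dsum D C (X 2)" using n_pos g0 E(2) by (auto simp: Q_def cone_obj_def)
  have q0: "q 0 = col D C (X 2) (neg g) (\<alpha> 1)"
    using mneg_eq[of g M C] g(1) g0 E(2) \<phi> by (simp add: q_def cone_map_def hm_def)
  note Qs = seqD[OF P_seq[OF Q]]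
  let ?R = "rot_obj n SO X" and ?r = "rot_map n D SO SM X \<alpha>"
  have R: "(?R, ?r) \<in> P" by (rule rot_in_P[OF X])
  have r0: "?R 0 = M" "?R 1 = X 2" "?r 0 = \<alpha> 1" using n_pos f0
      by (auto simp: rot_obj_def rot_map_def numeral_2_eq_2)
  have oX: "X 2 \<in> Obj D" "C \<in> Obj D" "A \<in> Obj D" "M \<in> Obj D" using X2 B_Obj f(1)
      by (auto simp: hm_def)
  have "Prr D C (X 2) \<odot> q 0 = ?r 0" "hm (Prr D C (X 2)) (Q 1) (?R 1)"
    unfolding q0 r0 Q01 using a1 g(1) oX by (simp_all add: col_def ang_simps)
  then obtain \<psi> where \<psi>: "\<psi> 0 = Prr D C (X 2)"
    and c2: "cone_angle (\<lambda>i. Q (Suc i)) (\<lambda>i. q (Suc i)) (\<lambda>i. ?R (Suc i)) (\<lambda>i. ?r (Suc i)) \<psi> (SM (q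
        0) \<odot> ?r (Suc n))"
    using cone_angle_first[OF Q R, of "Prr D C (X 2)"] Q01 r0 by auto
  define S \<sigma> where "S = cone_obj n D (\<lambda>i. Q (Suc i)) (\<lambda>i. ?R (Suc i))"
    and "\<sigma> = (cone_map n D (\<lambda>i. Q (Suc i)) (\<lambda>i. q (Suc i)) (\<lambda>i. ?R (Suc i)) (\<lambda>i. ?r (Suc i)) \<psi>)(Suc
        n := SM (q 0) \<odot> ?r (Suc n))"
  have S: "(S, \<sigma>) \<in> P" using c2 by (simp add: cone_angle_def S_def \<sigma>_def)
  note Ss = P_seq[OF S]
  note s = seqD[OF Ss]
  have S01: "S 0 = Dsum D C (X 2)" "S 1 = Dsum D (Q 2) (X 2)" "S (Suc n) = SO A"
    using n_pos Q01 r0 f0 by (auto simp: S_def cone_obj_def rot_obj_def numeral_2_eq_2)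
  have q1: "hm (q 1) (Dsum D C (X 2)) (Q 2)" using Qs(4)[of 1] Q01 n_pos
      by (simp add: numeral_2_eq_2)
  have \<sigma>0: "\<sigma> 0 = col D (Q 2) (X 2) (neg (q 1)) (Prr D C (X 2))"
    using mneg_eq[of "q 1" "Dsum D C (X 2)" "Q 2"] q1 Q01 r0 \<psi>
    by (simp add: \<sigma>_def cone_map_def hm_def numeral_2_eq_2)
  have \<sigma>l: "\<sigma> (Suc n) = SM (q 0) \<odot> sg (SM f)" using rot_map_last[OF P_seq[OF X]] f0
      by (simp add: \<sigma>_def)
  have oQ: "Q 2 \<in> Obj D" "SO A \<in> Obj D" "SO C \<in> Obj D" using q1 oX by (auto simp: hm_def SO_in)
  have \<sigma>1: "hm (\<sigma> 1) (Dsum D (Q 2) (X 2)) (xo S 2)" "hm (\<sigma> (Suc n)) (SO A) (SO (Dsum D C (X 2)))"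
    using s(2)[of 1] S01 s(5) by (auto simp: numeral_2_eq_2)
  \<comment> \<open>The second row of \<open>\<sigma> 0\<close> is the projection to
    \<open>X 2\<close>, so \<open>X 2\<close> is linked to itself in positions \<open>0\<close> and
    \<open>1\<close>. \<open>N\<close> drops both copies; \<open>p 1\<close> subtracts the image of
    the first one, and \<open>\<sigma> 1 \<odot> \<sigma> 0 = 0\<close> makes the next square
    commute.\<close>
  define N where "N i = (if i = 0 then C else if i = 1 then Q 2 else S i)" for i
  define \<nu> where "\<nu> i = (if i = 0 then neg (q 1) \<odot> Inl D C (X 2) else
      if i = 1 then \<sigma> 1 \<odot> Inl D (Q 2) (X 2)
    else if i = Suc n then SM (Prl D C (X 2)) \<odot> \<sigma> (Suc n) else \<sigma> i)" for i
  define j p where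
    "j i = (if i = 0 then Inl D C (X 2) else if i = 1 then Inl D (Q 2) (X 2) else Idm D (S i))" and
    "p i = (if i = 0 then Prl D C (X 2)
      else if i = 1 then Prl D (Q 2) (X 2) \<boxplus> (q 1 \<odot> (Inr D C (X 2) \<odot> Prr D (Q 2) (X 2))) else Idm D
          (S i))" for i
  have z: "SM (\<alpha> 1) \<odot> SM f = Mzero D (SO A) (SO (X 2))"
  proof -
    have "\<alpha> 1 \<odot> f = Mzero D A (X 2)" using comp_zero_in_P[OF X, of 0] f0 n_pos
        by (simp add: numeral_2_eq_2)
    from arg_cong[OF this, of SM] show ?thesis using a1 f(1) oX by (simp add: ang_simps)
  qed
  have \<sigma>Inr: "\<sigma> 1 \<odot> Inr D (Q 2) (X 2) = \<sigma> 1 \<odot> (Inl D (Q 2) (X 2) \<odot> (q 1 \<odot> Inr D C (X 2)))"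
  proof -
    have "\<sigma> 1 \<odot> \<sigma> 0 = Mzero D (S 0) (xo S 2)"
      using comp_zero_in_P[OF S, of 0] by (simp add: numeral_2_eq_2)
    from arg_cong[OF this, of "\<lambda>x. x \<odot> Inr D C (X 2)"]
    have "neg (\<sigma> 1 \<odot> (Inl D (Q 2) (X 2) \<odot> (q 1 \<odot> Inr D C (X 2)))) \<boxplus> \<sigma> 1 \<odot> Inr D (Q 2) (X 2) = Mzero
        D (X 2) (xo S 2)"
      unfolding \<sigma>0 S01 using \<sigma>1 q1 oX oQ by (simp add: col_def ang_simps)
    from eq_if_neg_add[OF this] show ?thesis using \<sigma>1 q1 oX oQ by (simp add: ang_simps)
  qed
  have jp: "hm (j i) (N i) (S i) \<and> hm (p i) (S i) (N i) \<and> p i \<odot> j i = Idm D (N i)" if i: "i \<le> Suc n"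
      for i
  proof -
    consider "i = 0" | "i = 1" | "2 \<le> i" by linarith
    then show ?thesis
    proof cases
      case 1 then show ?thesis using oX S01 by (simp add: j_def p_def N_def ang_simps)
    next
      case 2 then show ?thesis using oX oQ q1 S01 by (simp add: j_def p_def N_def ang_simps)
    next
      case 3 then show ?thesis using s(1)[OF i] by (simp add: j_def p_def N_def cat_simps)
    qed
  qed
  have Nn: "N (Suc n) = SO A" using S01 n_pos by (simp add: N_def)
  have N2: "xo N 2 = xo S 2" using n_pos by (simp add: N_def)
  have Ns: "sigma_seq n D SO N \<nu>" unfolding seq_iff
  proof (intro conjI allI impI)
    fix i assume i: "i \<le> Suc n"
    show "N i \<in> Obj D" using jp[OF i] by (simp add: hm_def)
    consider "i = 0" | "i = 1" | "2 \<le> i" "i \<le> n" | "i = Suc n" using i by linarith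
    then show "hm (\<nu> i) (N i) (xo N (Suc i))"
    proof cases
      case 1 then show ?thesis using q1 oX by (simp add: \<nu>_def N_def ang_simps)
    next
      case 2 then show ?thesis using \<sigma>1 oQ oX n_pos N2
          by (simp add: \<nu>_def N_def ang_simps numeral_2_eq_2)
    next
      case 3 then show ?thesis using s(2)[OF i] by (simp add: \<nu>_def N_def)
    next
      case 4 then show ?thesis using \<sigma>1 oX Nn n_pos S01 by (simp add: \<nu>_def N_def ang_simps xo_last)
    qed
  qed
  have j0: "j 1 \<odot> \<nu> 0 = \<sigma> 0 \<odot> j 0"
    unfolding \<sigma>0 using q1 oX oQ by (simp add: j_def \<nu>_def col_def ang_simps)
  have p0: "p 1 \<odot> \<sigma> 0 = \<nu> 0 \<odot> p 0"
    unfolding \<sigma>0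
    by (rule out_Dsum_eqI[where A = C and B = "X 2" and C = "Q 2"])
      (use q1 oX oQ in \<open>simp_all add: p_def \<nu>_def col_def ang_simps\<close>)
  have j1: "j 2 \<odot> \<nu> 1 = \<sigma> 1 \<odot> j 1"
    using \<sigma>1 oX oQ n_pos by (simp add: j_def \<nu>_def ang_simps numeral_2_eq_2)
  have p1: "p 2 \<odot> \<sigma> 1 = \<nu> 1 \<odot> p 1"
    by (rule out_Dsum_eqI[where A = "Q 2" and B = "X 2" and C = "xo S 2"])
      (use \<sigma>1 q1 oX oQ n_pos \<sigma>Inr in \<open>simp_all add: p_def \<nu>_def ang_simps numeral_2_eq_2\<close>)
  have jl: "SM (j 0) \<odot> \<nu> (Suc n) = \<sigma> (Suc n) \<odot> j (Suc n)"
    unfolding \<nu>_def \<sigma>l q0 using n_pos z f(1) g(1) a1 oX oQ S01 comp_sg[of "SM f" "SO A" "SO M"]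
    by (simp add: j_def \<nu>_def col_def ang_simps sg_simps)
  have pl: "SM (p 0) \<odot> \<sigma> (Suc n) = \<nu> (Suc n) \<odot> p (Suc n)"
    using n_pos \<sigma>1 oX oQ S01 by (simp add: p_def \<nu>_def ang_simps)
  have "(N, \<nu>) \<in> P"
  proof (rule retract_squares_in_P[OF S Ns jp])
    fix i assume i: "i \<le> Suc n"
    consider "i = 0" | "i = 1" | "2 \<le> i" "i \<le> n" | "i = Suc n" using i by linarith
    then show "xm j (Suc i) \<odot> \<nu> i = \<sigma> i \<odot> j i \<and> xm p (Suc i) \<odot> \<sigma> i = \<nu> i \<odot> p i"
    proof cases
      case 2 then show ?thesis using j1 p1 n_pos by (simp add: numeral_2_eq_2)
    next
      case 3 then show ?thesis using s(4)[of i] by (simp add: j_def p_def \<nu>_def cat_simps)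
    qed (use j0 jl p0 pl n_pos in \<open>simp_all add: xm_last\<close>)
  qed
  \<comment> \<open>The term \<open>SO A\<close> in position \<open>n + 1\<close> lies outside the
    control of \<open>B\<close>; the right rotation replaces it by \<open>A\<close> in front. The
    first entry of \<open>q 0\<close> is \<open>-g\<close>, which explains the sign of the new first
    map.\<close>
  then have "(case_nat A N, case_nat (neg (g \<odot> f)) \<nu>) \<in> P"
    by (subst right_rotate_iff[OF Ns])
      (use Nn f(1) g(1) n_pos a1 oX oQ in \<open>auto simp: N_def \<nu>_def \<sigma>l q0 col_def ang_simps sg_simps\<close>)
  \<comment> \<open>Marking position \<open>0\<close> alters only the first map and the connecting
    morphism, and the latter is forgotten in \<open>\<X>\<close>.\<close>
  note K = sign_change_in_P[OF this, of "\<lambda>i. i = 0"]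
  let ?\<kappa> = "\<lambda>i. if (i = 0) \<noteq> (if i = Suc n then (0 :: nat) = 0 else Suc i = 0)
    then neg (case_nat (neg (g \<odot> f)) \<nu> i) else case_nat (neg (g \<odot> f)) \<nu> i"
  have "case_nat A N i \<in> B" if "i \<le> Suc n" for i
  proof (cases i)
    case (Suc k)
    then have k: "k \<le> n" using that by simp
    have "S k \<in> B" if "2 \<le> k"
    proof -
      have "xo X (Suc k) = X (Suc k)" "Q (Suc k) \<in> B" using k QB by auto
      then show ?thesis using that k XB[of "Suc k"]
        by (auto simp: S_def cone_obj_def rot_obj_def intro!: B_Dsum)
    qed
    then show ?thesis using Suc X2 QB[of 2] n_pos by (auto simp: N_def)
  qed (use X2 in simp)
  from ext_sequencesI[OF K this refl] have "(case_nat A N, ?\<kappa>) \<in> \<X>" .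
  from adm_monoI[OF this] show ?thesis using f(1) g(1) by (simp add: neg_neg ty_comp hm_def)
qed

text \<open>The angle of \<open>f\<close> is pulled back along the map
  \<open>\<gamma> (n - 1)\<close> from \<open>V\<close> to \<open>M\<close> that precedes
  \<open>g\<close>. The resulting cone \<open>R\<close> ends with the row of this map and
  \<open>f\<close> into \<open>M\<close>. The right rotation of the angle of \<open>g\<close> also
  ends in \<open>M\<close> and maps to \<open>R\<close> by the injection of \<open>V\<close>; the
  cone of that morphism, with the common summand \<open>V\<close> split off, is a right rotation of
  an angle with \<open>g \<odot> f\<close>.\<close>

lemma adm_epi_comp:
  assumes f: "hm f A M" "f \<in> adm_epi n \<X>" and g: "hm g M C" "g \<in> adm_epi n \<X>"
  shows "g \<odot> f \<in> adm_epi n \<X>"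
proof -
  obtain X d where Xd: "(X, d) \<in> \<X>" "d n = f" using f(2) by (auto simp: adm_epi_def)
  obtain \<alpha> where X: "(X, \<alpha>) \<in> P" and d: "\<And>i. i \<le> n \<Longrightarrow> \<alpha> i = d i" and XB: "\<And>i. i \<le> Suc n \<Longrightarrow> X i \<in> B"
    using ext_sequencesE[OF Xd(1)] by blast
  obtain Y e where Ye: "(Y, e) \<in> \<X>" "e n = g" using g(2) by (auto simp: adm_epi_def)
  obtain \<gamma> where Y: "(Y, \<gamma>) \<in> P" and e: "\<And>i. i \<le> n \<Longrightarrow> \<gamma> i = e i" and YB: "\<And>i. i \<le> Suc n \<Longrightarrow> Y i \<in> B"
    using ext_sequencesE[OF Ye(1)] by blast
  note x = seqD[OF P_seq[OF X]] and y = seqD[OF P_seq[OF Y]]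
  have f0: "\<alpha> n = f" "X n = A" "X (Suc n) = M" using d[of n] Xd(2) x(4)[of n] f(1)
      by (auto simp: hm_def arw.inject)
  have g0: "\<gamma> n = g" "Y n = M" "Y (Suc n) = C" using e[of n] Ye(2) y(4)[of n] g(1)
      by (auto simp: hm_def arw.inject)
  define m where "m = n - 1"
  have m: "Suc m = n" using n_pos by (simp add: m_def)
  define V where "V = Y m"
  have c1: "hm (\<gamma> m) V M" using y(4)[of m] m g0 by (auto simp: V_def)
  have VB: "V \<in> B" "C \<in> B" "A \<in> B" "M \<in> B" using XB[of n] YB[of "Suc n"] YB[of m] YB[of n] m g0 f0
      by (auto simp: V_def)
  have "hm (\<alpha> (Suc n) \<odot> \<gamma> m) V (SO (X 0))" using c1 x(5) f0 by (simp add: ang_simps)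
  then obtain E \<eta> where E: "(E, \<eta>) \<in> P" "E 0 = X 0" "E (Suc n) = V" "\<eta> (Suc n) = \<alpha> (Suc n) \<odot> \<gamma> m"
    "\<And>i. i \<le> Suc n \<Longrightarrow> E i \<in> B"
    using extensionE XB[of 0] VB(1) by blast
  obtain \<phi> where \<phi>: "\<phi> n = \<gamma> m"
    and c: "cone_angle (\<lambda>i. E (Suc i)) (\<lambda>i. \<eta> (Suc i)) (\<lambda>i. X (Suc i)) (\<lambda>i. \<alpha> (Suc i)) \<phi> (SM (\<eta> 0) \<odot>
        \<alpha> (Suc n))"
    using cone_angle_first_last[OF E(1) X, of "\<gamma> m"] c1 E f0 by auto
  define R \<rho> where "R = cone_obj n D (\<lambda>i. E (Suc i)) (\<lambda>i. X (Suc i))"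
    and "\<rho> = (cone_map n D (\<lambda>i. E (Suc i)) (\<lambda>i. \<eta> (Suc i)) (\<lambda>i. X (Suc i)) (\<lambda>i. \<alpha> (Suc i)) \<phi>)(Suc n
        := SM (\<eta> 0) \<odot> \<alpha> (Suc n))"
  have R: "(R, \<rho>) \<in> P" using c by (simp add: cone_angle_def R_def \<rho>_def)
  have RB: "R i \<in> B" if "i \<le> Suc n" for i
    unfolding R_def by (rule cone_obj_B) (use XB E(5) that in auto)
  have Rn: "R n = Dsum D V A" "R (Suc n) = M"
    using m f0 E(3) n_pos by (auto simp: R_def cone_obj_def)
  have \<rho>n: "\<rho> n = row D V A (\<gamma> m) f"
    using m f0 E(3) \<phi> n_pos by (auto simp: \<rho>_def cone_map_def)
  note Rs = seqD[OF P_seq[OF R]]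
  \<comment> \<open>In this rotation \<open>M\<close> is the last term and \<open>g\<close> the
    connecting morphism.\<close>
  obtain Z a where Z: "SO Z = C" "Z \<in> Obj D" "hm a Z (Y 0)" "SM a = sg (\<gamma> (Suc n))"
    and Y': "(case_nat Z Y, case_nat a \<gamma>) \<in> P" using right_rotateE[OF Y] g0 by metis
  have y': "case_nat Z Y (Suc n) = M" "case_nat Z Y n = V" "case_nat a \<gamma> n = \<gamma> m"
      "case_nat a \<gamma> (Suc n) = g"
    using m g0 by (auto simp: V_def split: nat.split)
  have oX: "V \<in> Obj D" "C \<in> Obj D" "A \<in> Obj D" "M \<in> Obj D" using VB B_Obj by auto
  have "\<rho> n \<odot> Inl D V A = \<gamma> m" "hm (Inl D V A) V (Dsum D V A)"
    unfolding \<rho>n using c1 f(1) oX by (simp_all add: row_def ang_simps)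
  then obtain \<psi> where \<psi>: "\<psi> n = Inl D V A"
    and c2: "cone_angle (case_nat Z Y) (case_nat a \<gamma>) R \<rho> \<psi> (sg g \<odot> \<rho> n)"
    using cone_angle_last[OF Y' R, of "Inl D V A"] Rn y' by auto
  define L \<omega> where "L = cone_obj n D (case_nat Z Y) R"
    and "\<omega> = (cone_map n D (case_nat Z Y) (case_nat a \<gamma>) R \<rho> \<psi>)(Suc n := sg g \<odot> \<rho> n)"
  have L: "(L, \<omega>) \<in> P" using c2 by (simp add: cone_angle_def L_def \<omega>_def)
  note Ls = P_seq[OF L]
  note l = seqD[OF Ls]
  define W where "W = R m"
  have WB: "W \<in> B" using RB[of m] m by (simp add: W_def)
  have Ln: "L 0 = Z" "L n = Dsum D V W" "L (Suc n) = Dsum D V A"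
    using n_pos y' Rn by (auto simp: L_def cone_obj_def W_def m_def)
  have \<rho>m: "hm (\<rho> m) W (Dsum D V A)" using Rs(4)[of m] Rn m by (auto simp: W_def)
  have \<omega>n: "\<omega> n = row D V W (Inl D V A) (\<rho> m)" using n_pos y' \<psi>
      by (simp add: \<omega>_def cone_map_def W_def m_def)
  have \<omega>l: "\<omega> (Suc n) = sg g \<odot> row D V A (\<gamma> m) f" by (simp add: \<omega>_def \<rho>n)
  have oW: "W \<in> Obj D" "Z \<in> Obj D" using WB B_Obj Z by auto
  have \<omega>m: "hm (\<omega> m) (L m) (Dsum D V W)" using l(4)[of m] Ln m by auto
  have gz: "g \<odot> \<gamma> m = Mzero D V C"
    using comp_zero_in_P[OF Y, of m] g0 m by (simp add: V_def)
  have \<omega>z: "row D V W (Inl D V A) (\<rho> m) \<odot> \<omega> m = Mzero D (L m) (Dsum D V A)"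
    using comp_zero_in_P[OF L, of m] \<omega>n Ln m by simp
  define N where "N i = (if i = n then W else if i = Suc n then A else L i)" for i
  define \<nu> where "\<nu> i = (if i = Suc n then \<omega> (Suc n) \<odot> Inr D V A else if i = n then Prr D V A \<odot> \<rho> m
    else if i = m then Prr D V W \<odot> \<omega> m else \<omega> i)" for i
  \<comment> \<open>\<open>V\<close> is linked to itself in positions \<open>n\<close> and
    \<open>n + 1\<close> by the entry \<open>Inl\<close> of \<open>\<omega> n\<close>. The
    correction in \<open>j n\<close> makes it the kernel of the component of
    \<open>\<omega> n\<close> in \<open>V\<close>.\<close>
  define j p where
    "j i = (if i = n then Inr D V W \<boxplus> neg (Inl D V W \<odot> (Prl D V A \<odot> \<rho> m))
      else if i = Suc n then Inr D V A else Idm D (L i))" and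
    "p i = (if i = n then Prr D V W else if i = Suc n then Prr D V A else Idm D (L i))" for i
  have jp: "hm (j i) (N i) (L i) \<and> hm (p i) (L i) (N i) \<and> p i \<odot> j i = Idm D (N i)" if i: "i \<le> Suc n"
      for i
  proof -
    consider "i = n" | "i = Suc n" | "i < n" using i by linarith
    then show ?thesis
    proof cases
      case 1 then show ?thesis using oX oW \<rho>m Ln by (simp add: j_def p_def N_def ang_simps)
    next
      case 2 then show ?thesis using oX oW Ln by (simp add: j_def p_def N_def ang_simps)
    next
      case 3 then show ?thesis using l(1)[OF i] by (simp add: j_def p_def N_def cat_simps)
    qed
  qed
  have N0: "N 0 = Z" "j 0 = Idm D Z" "p 0 = Idm D Z" using Ln n_pos
      by (auto simp: N_def j_def p_def)
  have \<nu>m: "\<nu> m = Prr D V W \<odot> \<omega> m" "N m = L m" "j m = Idm D (L m)" "p m = Idm D (L m)"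
    using m by (auto simp: \<nu>_def N_def j_def p_def)
  have \<nu>n: "\<nu> n = Prr D V A \<odot> \<rho> m" "N n = W" "j n = Inr D V W \<boxplus> neg (Inl D V W \<odot> (Prl D V A \<odot> \<rho> m))"
      "p n = Prr D V W"
    by (auto simp: \<nu>_def N_def j_def p_def)
  have \<nu>l: "\<nu> (Suc n) = (sg g \<odot> row D V A (\<gamma> m) f) \<odot> Inr D V A" "N (Suc n) = A"
      "j (Suc n) = Inr D V A" "p (Suc n) = Prr D V A"
    by (auto simp: \<nu>_def N_def j_def p_def \<omega>l)
  have \<nu>l': "\<nu> (Suc n) = sg (g \<odot> f)"
    unfolding \<nu>l using oX c1 f(1) g(1) gz by (simp add: row_def ang_simps sg_simps)
  have Ns: "sigma_seq n D SO N \<nu>" unfolding seq_iff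
  proof (intro conjI allI impI)
    fix i assume i: "i \<le> Suc n"
    show "N i \<in> Obj D" using jp[OF i] by (simp add: hm_def)
    consider "i = n" | "i = Suc n" | "i = m" | "i < m" using i m by linarith
    then show "hm (\<nu> i) (N i) (xo N (Suc i))"
    proof cases
      case 1 then show ?thesis using \<rho>m oX by (simp add: \<nu>n \<nu>l ang_simps)
    next
      case 2 then show ?thesis using f(1) g(1) oX Z N0
          by (simp add: \<nu>l' \<nu>l(2) xo_last ang_simps sg_simps)
    next
      case 3 then show ?thesis using \<omega>m oX oW m \<nu>m \<nu>n by (simp add: ang_simps)
    next
      case 4 then show ?thesis using l(4)[of i] m by (simp add: \<nu>_def N_def)
    qed
  qed
  have jm: "j n \<odot> \<nu> m = \<omega> m \<odot> j m"
  proof -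
    have "j n \<odot> \<nu> m = \<omega> m"
    proof (rule into_Dsum_eqI[where A = V and B = W and C = "L m"])
      have "Prl D V A \<odot> (row D V W (Inl D V A) (\<rho> m) \<odot> \<omega> m) = Mzero D (L m) V"
        unfolding \<omega>z using oX l(1)[of m] m by (simp add: ang_simps)
      then have "Prl D V W \<odot> \<omega> m \<boxplus> Prl D V A \<odot> (\<rho> m \<odot> (Prr D V W \<odot> \<omega> m)) = Mzero D (L m) V"
        using \<omega>m \<rho>m oX oW by (simp add: row_def ang_simps)
      from eq_neg_if[OF this] show "Prl D V W \<odot> (j n \<odot> \<nu> m) = Prl D V W \<odot> \<omega> m"
        unfolding \<nu>m \<nu>n using \<omega>m \<rho>m oX oW by (simp add: ang_simps)
    qed (use \<omega>m \<rho>m oX oW in \<open>simp_all add: \<nu>m \<nu>n ang_simps\<close>)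
    then show ?thesis using \<omega>m \<nu>m by (simp add: ang_simps)
  qed
  have pm: "p n \<odot> \<omega> m = \<nu> m \<odot> p m" using \<omega>m oX oW by (simp add: \<nu>m \<nu>n ang_simps)
  have jn: "j (Suc n) \<odot> \<nu> n = \<omega> n \<odot> j n"
    unfolding \<omega>n \<nu>l \<nu>n
    by (rule into_Dsum_eqI[where A = V and B = A and C = W])
      (use \<rho>m oX oW in \<open>simp_all add: row_def ang_simps\<close>)
  have pn: "p (Suc n) \<odot> \<omega> n = \<nu> n \<odot> p n"
    unfolding \<omega>n \<nu>l \<nu>n using \<rho>m oX oW by (simp add: row_def ang_simps)
  note gz' = comp_reduce[OF gz c1 g(1)]
  have jl: "SM (j 0) \<odot> \<nu> (Suc n) = \<omega> (Suc n) \<odot> j (Suc n)"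
    unfolding N0 \<nu>l \<omega>l using c1 f(1) g(1) oX Z by (simp add: row_def ang_simps sg_simps)
  have pl: "SM (p 0) \<odot> \<omega> (Suc n) = \<nu> (Suc n) \<odot> p (Suc n)"
    unfolding N0 \<nu>l \<omega>l using c1 f(1) g(1) oX Z gz gz' by (simp add: row_def ang_simps sg_simps)
  have "(N, \<nu>) \<in> P"
  proof (rule retract_squares_in_P[OF L Ns jp])
    fix i assume i: "i \<le> Suc n"
    consider "i = n" | "i = Suc n" | "i = m" | "i < m" using i m by linarith
    then show "xm j (Suc i) \<odot> \<nu> i = \<omega> i \<odot> j i \<and> xm p (Suc i) \<odot> \<omega> i = \<nu> i \<odot> p i"
    proof cases
      case 4 then show ?thesis using l(4)[of i] m by (simp add: j_def p_def \<nu>_def cat_simps)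
    qed (use jm jn jl pm pn pl m in \<open>simp_all add: xm_last\<close>)
  qed
  note K = rot_in_P[OF this]
  let ?K = "rot_obj n SO N" and ?\<kappa> = "rot_map n D SO SM N \<nu>"
  have \<kappa>n: "?\<kappa> n = sg (g \<odot> f)" by (simp add: rot_map_le \<nu>l')
  have KB: "?K i \<in> B" if "i \<le> Suc n" for i
  proof -
    have "L k \<in> B" if k: "1 \<le> k" "k < n" for k
    proof -
      have "case_nat Z Y k \<in> B" using k YB[of "k - 1"] by (cases k) auto
      then show ?thesis using k RB[of "k - 1"] by (simp add: L_def cone_obj_def B_Dsum)
    qed
    then show ?thesis using that WB VB N0 Z by (auto simp: rot_obj_def N_def)
  qed
  show ?thesis
  \<comment> \<open>The rotation leaves the sign \<open>(-1)^n\<close> on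
    \<open>g \<odot> f\<close>. For odd \<open>n\<close>, marking position \<open>n + 1\<close>
    removes it and otherwise changes only the forgotten connecting morphism.\<close>
  proof (cases "even n")
    case True
    then have "?\<kappa> n = g \<odot> f" using \<kappa>n by (simp add: sg_def)
    then show ?thesis using adm_epiI[OF ext_sequencesI[OF K KB refl], of n] by simp
  next
    case False
    then have k: "?\<kappa> n = neg (g \<odot> f)" using \<kappa>n by (simp add: sg_def)
    let ?k = "\<lambda>i. if (i = Suc n) \<noteq> (if i = Suc n then 0 = Suc n else Suc i = Suc n) then neg (?\<kappa> i)
        else ?\<kappa> i"
    have "(?K, ?k) \<in> \<X>" by (rule ext_sequencesI[OF sign_change_in_P[OF K, of
        "\<lambda>i. i = Suc n"] KB refl])
    moreover have "?k n = g \<odot> f" using k f(1) g(1) by (simp add: neg_neg ty_comp hm_def)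
    ultimately show ?thesis using adm_epiI[of ?K ?k \<X> n] by simp
  qed
qed

section \<open>Homotopies and weak isomorphisms\<close>

abbreviation exact_in_B :: "(nat \<Rightarrow> 'o) \<Rightarrow> (nat \<Rightarrow> 'm) \<Rightarrow> bool" where
  "exact_in_B X d \<equiv> n_exact_seq n (full_sub D B) X d"

abbreviation complex_in_B :: "(nat \<Rightarrow> 'o) \<Rightarrow> (nat \<Rightarrow> 'm) \<Rightarrow> bool" where
  "complex_in_B X d \<equiv> is_complex (full_sub D B) (Suc n) X d"

lemma complexD:
  assumes "complex_in_B X d"
  shows "i \<le> Suc n \<Longrightarrow> X i \<in> B" "i \<le> n \<Longrightarrow> hm (d i) (X i) (X (Suc i))"
    "Suc i \<le> n \<Longrightarrow> d (Suc i) \<odot> d i = Mzero D (X i) (X (Suc (Suc i)))" "i \<le> Suc n \<Longrightarrow> X i \<in> Obj D"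
  using assms B_Obj by (auto simp: is_complex_iff)

lemma exactD:
  assumes "exact_in_B X d"
  shows "complex_in_B X d"
    "\<lbrakk>T \<in> B; hm h T (X 0); d 0 \<odot> h = Mzero D T (X 1)\<rbrakk> \<Longrightarrow> h = Mzero D T (X 0)"
    "\<lbrakk>T \<in> B; i < n; hm h T (X (Suc i)); d (Suc i) \<odot> h = Mzero D T (X (Suc (Suc i)))\<rbrakk> \<Longrightarrow>
      \<exists>h'. hm h' T (X i) \<and> h = d i \<odot> h'"
    "\<lbrakk>T \<in> B; hm h (X (Suc n)) T; h \<odot> d n = Mzero D (X n) T\<rbrakk> \<Longrightarrow> h = Mzero D (X (Suc n)) T"
    "\<lbrakk>T \<in> B; i < n; hm h (X (Suc i)) T; h \<odot> d i = Mzero D (X i) T\<rbrakk> \<Longrightarrow>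
      \<exists>h'. hm h' (X (Suc (Suc i))) T \<and> h = h' \<odot> d (Suc i)"
proof -
  show c: "complex_in_B X d" using assms by (simp add: n_exact_seq_def)
  note cD = complexD[OF c]
  have "cov_exact (full_sub D B) (Suc n) X d" using assms by (simp add: n_exact_seq_def)
  note * = this[THEN cov_exact_iff[THEN iffD1, rotated -1], OF cD(4) cD(2) cD(3)]
  show "\<lbrakk>T \<in> B; hm h T (X 0); d 0 \<odot> h = Mzero D T (X 1)\<rbrakk> \<Longrightarrow> h = Mzero D T (X 0)"
    "\<lbrakk>T \<in> B; i < n; hm h T (X (Suc i)); d (Suc i) \<odot> h = Mzero D T (X (Suc (Suc i)))\<rbrakk> \<Longrightarrow>
      \<exists>h'. hm h' T (X i) \<and> h = d i \<odot> h'"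
    using * by auto
  have "contra_exact (full_sub D B) (Suc n) X d" using assms by (simp add: n_exact_seq_def)
  note * = this[THEN contra_exact_iff[THEN iffD1, rotated -1], OF cD(4) cD(2) cD(3)]
  show "\<lbrakk>T \<in> B; hm h (X (Suc n)) T; h \<odot> d n = Mzero D (X n) T\<rbrakk> \<Longrightarrow> h = Mzero D (X (Suc n)) T"
    "\<lbrakk>T \<in> B; i < n; hm h (X (Suc i)) T; h \<odot> d i = Mzero D (X i) T\<rbrakk> \<Longrightarrow>
      \<exists>h'. hm h' (X (Suc (Suc i))) T \<and> h = h' \<odot> d (Suc i)"
    using * by auto
qed

section \<open>Lifting chain maps and homotopies\<close>

lemma lift_down:
  assumes Y: "complex_in_B Y e" and X: "exact_in_B X d"
  shows "k \<le> n \<Longrightarrow> hm a (Y k) (X k) \<Longrightarrow> hm b (Y (Suc k)) (X (Suc k)) \<Longrightarrow> d k \<odot> a = b \<odot> e k \<Longrightarrow>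
    \<exists>g. g k = a \<and> g (Suc k) = b \<and> (\<forall>i\<le>Suc k. hm (g i) (Y i) (X i)) \<and>
        (\<forall>i\<le>k. g (Suc i) \<odot> e i = d i \<odot> g i)"
proof (induction k arbitrary: a b)
  case 0
  then show ?case by (intro exI[of _ "case_nat a (\<lambda>_. b)"]) (auto simp: le_Suc_eq)
next
  case (Suc k)
  note y = complexD[OF Y] and x = complexD[OF exactD(1)[OF X]]
  have k: "k < n" "k \<le> n" using Suc.prems by auto
  have t: "hm (d (Suc k)) (X (Suc k)) (X (Suc (Suc k)))" "hm (e k) (Y k) (Y (Suc k))"
      "hm (e (Suc k)) (Y (Suc k)) (Y (Suc (Suc k)))"
    using x(2)[of "Suc k"] y(2)[of k] y(2)[of "Suc k"] Suc.prems(1) by auto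
  have "d (Suc k) \<odot> (a \<odot> e k) = Mzero D (Y k) (X (Suc (Suc k)))"
    using comp_reduce[OF Suc.prems(4) Suc.prems(2) t(1), of "e k" "Y k"] t Suc.prems y(3)[of k]
    by (simp add: cat_simps)
  then obtain c where c: "hm c (Y k) (X k)" "a \<odot> e k = d k \<odot> c"
    using exactD(3)[OF X y(1)[of k] k(1), of "a \<odot> e k"] Suc.prems t k by (auto simp: cat_simps)
  obtain g where g: "g k = c" "g (Suc k) = a" "\<forall>i\<le>Suc k. hm (g i) (Y i) (X i)"
      "\<forall>i\<le>k. g (Suc i) \<odot> e i = d i \<odot> g i"
    using Suc.IH[OF k(2) c(1) Suc.prems(2)] c(2) by metis
  then show ?case using Suc.prems
    by (intro exI[of _ "g(Suc (Suc k) := b)"]) (auto simp: le_Suc_eq)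
qed

text \<open>To the left of a given square, exactness of the target under \<open>D(T, -)\<close>
  supplies the next component, as in \<open>lift_down\<close>. To the right it is exactness of the
  source under \<open>D(-, T)\<close>.\<close>

lemma lift_up:
  assumes Y: "exact_in_B Y e" and X: "complex_in_B X d"
  shows "k \<le> n \<Longrightarrow> hm a (Y k) (X k) \<Longrightarrow> hm b (Y (Suc k)) (X (Suc k)) \<Longrightarrow> d k \<odot> a = b \<odot> e k \<Longrightarrow>
    \<exists>g. g k = a \<and> g (Suc k) = b \<and> (\<forall>i. k \<le> i \<and> i \<le> Suc n \<longrightarrow> hm (g i) (Y i) (X i)) \<and>
      (\<forall>i. k \<le> i \<and> i \<le> n \<longrightarrow> g (Suc i) \<odot> e i = d i \<odot> g i)"
proof (induction "n - k" arbitrary: k a b)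
  case 0
  then have "k = n" by simp
  with 0 show ?case by (intro exI[of _ "\<lambda>i. if i = n then a else b"]) (auto simp: le_Suc_eq)
next
  case (Suc j)
  note y = complexD[OF exactD(1)[OF Y]] and x = complexD[OF X]
  have k: "k < n" "Suc k \<le> n" "j = n - Suc k" using Suc.hyps by auto
  have t: "hm (d k) (X k) (X (Suc k))" "hm (d (Suc k)) (X (Suc k)) (X (Suc (Suc k)))"
      "hm (e k) (Y k) (Y (Suc k))"
    using x(2)[of k] x(2)[of "Suc k"] y(2)[of k] k by auto
  have "(d (Suc k) \<odot> b) \<odot> e k = d (Suc k) \<odot> (d k \<odot> a)" using t Suc.prems by (simp add: cat_simps)
  also have "\<dots> = Mzero D (Y k) (X (Suc (Suc k)))"
    using comp_reduce[OF x(3)[OF k(2)] t(1,2), of a "Y k"] Suc.prems(2) t by (simp add: cat_simps)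
  finally obtain c where c: "hm c (Y (Suc (Suc k))) (X (Suc (Suc k)))"
      "d (Suc k) \<odot> b = c \<odot> e (Suc k)"
    using exactD(5)[OF Y x(1)[of "Suc (Suc k)"] k(1), of "d (Suc k) \<odot> b"] Suc.prems(3) t k
        by (auto simp: cat_simps)
  obtain g where g: "g (Suc k) = b" "g (Suc (Suc k)) = c"
      "\<forall>i. Suc k \<le> i \<and> i \<le> Suc n \<longrightarrow> hm (g i) (Y i) (X i)"
    "\<forall>i. Suc k \<le> i \<and> i \<le> n \<longrightarrow> g (Suc i) \<odot> e i = d i \<odot> g i"
    using Suc.hyps(1)[OF k(3,2) Suc.prems(3) c] by auto
  have "hm ((g(k := a)) i) (Y i) (X i)" if "k \<le> i" "i \<le> Suc n" for i
    using that g(3) Suc.prems(2) by (cases "i = k") auto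
  moreover have "(g(k := a)) (Suc i) \<odot> e i = d i \<odot> (g(k := a)) i" if "k \<le> i" "i \<le> n" for i
    using that g(1,4) Suc.prems(4) by (cases "i = k") auto
  ultimately show ?case using g(1) by (intro exI[of _ "g(k := a)"]) simp
qed

lemma lift:
  assumes Y: "exact_in_B Y e" and X: "exact_in_B X d" and k: "k \<le> n"
    and ab: "hm a (Y k) (X k)" "hm b (Y (Suc k)) (X (Suc k))" "d k \<odot> a = b \<odot> e k"
  obtains g where "g k = a" "g (Suc k) = b" "\<And>i. i \<le> Suc n \<Longrightarrow> hm (g i) (Y i) (X i)"
    "\<And>i. i \<le> n \<Longrightarrow> g (Suc i) \<odot> e i = d i \<odot> g i"
proof -
  obtain g where g: "g k = a" "g (Suc k) = b" "\<forall>i\<le>Suc k. hm (g i) (Y i) (X i)"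
      "\<forall>i\<le>k. g (Suc i) \<odot> e i = d i \<odot> g i"
    using lift_down[OF exactD(1)[OF Y] X k ab] by blast
  obtain g' where g': "g' k = a" "g' (Suc k) = b" "\<forall>i. k \<le> i \<and> i \<le> Suc n \<longrightarrow> hm (g' i) (Y i) (X i)"
     "\<forall>i. k \<le> i \<and> i \<le> n \<longrightarrow> g' (Suc i) \<odot> e i = d i \<odot> g' i"
    using lift_up[OF Y exactD(1)[OF X] k ab] by blast
  let ?g = "\<lambda>i. if i \<le> k then g i else g' i"
  show ?thesis
  proof (rule that[of ?g])
    show "hm (?g i) (Y i) (X i)" if "i \<le> Suc n" for i using g(3) g'(3) that by auto
    show "?g (Suc i) \<odot> e i = d i \<odot> ?g i" if "i \<le> n" for i
      using g g' that by (cases i k rule: linorder_cases) auto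
  qed (use g g' in auto)
qed

definition nullh :: "(nat \<Rightarrow> 'o) \<Rightarrow> (nat \<Rightarrow> 'm) \<Rightarrow> (nat \<Rightarrow> 'o) \<Rightarrow> (nat \<Rightarrow> 'm) \<Rightarrow> (nat \<Rightarrow> 'm) \<Rightarrow> (nat \<Rightarrow> 'm) \<Rightarrow>
    bool" where
  "nullh X d Y e u h \<longleftrightarrow> (\<forall>i. 1 \<le> i \<and> i \<le> Suc n \<longrightarrow> hm (h i) (X i) (Y (i - 1))) \<and>
    u 0 = h 1 \<odot> d 0 \<and>
    (\<forall>i. 1 \<le> i \<and> i \<le> n \<longrightarrow> u i = e (i - 1) \<odot> h i \<boxplus> h (Suc i) \<odot> d i) \<and>
    u (Suc n) = e n \<odot> h (Suc n)"

text \<open>The component \<open>t\<close> in position \<open>k + 1\<close> is prescribed, and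
  \<open>u k - t \<odot> d k\<close> is only required to be killed by \<open>e k\<close>. Exactness
  then factors it through the preceding map of \<open>Y\<close>, which is the next component, and at
  position \<open>0\<close> makes it zero. A nonzero \<open>t\<close> is what the obstruction
  argument for weak isomorphisms starts from.\<close>

lemma homotopy_down:
  assumes X: "complex_in_B X d" and Y: "exact_in_B Y e"
    and u: "\<And>i. i \<le> Suc n \<Longrightarrow> hm (u i) (X i) (Y i)" "\<And>i. i \<le> n \<Longrightarrow> u (Suc i) \<odot> d i = e i \<odot> u i"
  shows "k \<le> n \<Longrightarrow> hm t (X (Suc k)) (Y k) \<Longrightarrow> e k \<odot> u k = e k \<odot> (t \<odot> d k) \<Longrightarrow>
    \<exists>h. h (Suc k) = t \<and> (\<forall>i. 1 \<le> i \<and> i \<le> Suc k \<longrightarrow> hm (h i) (X i) (Y (i - 1))) \<and> u 0 = h 1 \<odot> d 0 \<and>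
    (\<forall>i. 1 \<le> i \<and> i \<le> k \<longrightarrow> u i = e (i - 1) \<odot> h i \<boxplus> h (Suc i) \<odot> d i)"
proof (induction k arbitrary: t)
  case 0
  note x = complexD[OF X] and y = complexD[OF exactD(1)[OF Y]]
  have t: "hm (d 0) (X 0) (X (Suc 0))" "hm (e 0) (Y 0) (Y (Suc 0))" "hm (u 0) (X 0) (Y 0)"
    using x(2)[of 0] y(2)[of 0] u(1)[of 0] by auto
  have "u 0 \<boxplus> neg (t \<odot> d 0) = Mzero D (X 0) (Y 0)"
    by (rule exactD(2)[OF Y x(1)[of 0]]) (use t 0 in \<open>auto simp: cat_simps\<close>)
  from eq_add_if_diff[OF this] have "u 0 = t \<odot> d 0" using t 0 by (simp add: cat_simps)
  then show ?case using 0 by (intro exI[of _ "\<lambda>_. t"]) (auto simp: le_Suc_eq)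
next
  case (Suc k)
  note x = complexD[OF X] and y = complexD[OF exactD(1)[OF Y]]
  have k: "k < n" "k \<le> n" using Suc.prems by auto
  have t: "hm (d k) (X k) (X (Suc k))" "hm (d (Suc k)) (X (Suc k)) (X (Suc (Suc k)))"
    "hm (e k) (Y k) (Y (Suc k))" "hm (e (Suc k)) (Y (Suc k)) (Y (Suc (Suc k)))"
    "hm (u k) (X k) (Y k)" "hm (u (Suc k)) (X (Suc k)) (Y (Suc k))"
    using x(2)[of k] x(2)[of "Suc k"] y(2)[of k] y(2)[of "Suc k"] u(1)[of k] u(1)[of "Suc k"] k
        by auto
  have w: "hm (u (Suc k) \<boxplus> neg (t \<odot> d (Suc k))) (X (Suc k)) (Y (Suc k))"
    using t Suc.prems by (simp add: cat_simps)
  have "e (Suc k) \<odot> (u (Suc k) \<boxplus> neg (t \<odot> d (Suc k))) = Mzero D (X (Suc k)) (Y (Suc (Suc k)))"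
    using t Suc.prems by (simp add: cat_simps)
  then obtain s where s: "hm s (X (Suc k)) (Y k)" "u (Suc k) \<boxplus> neg (t \<odot> d (Suc k)) = e k \<odot> s"
    using exactD(3)[OF Y x(1)[of "Suc k"] k(1) w] k by auto
  have us: "u (Suc k) = e k \<odot> s \<boxplus> t \<odot> d (Suc k)"
    using eq_add_if_diff[OF s(2)] t Suc.prems by (simp add: cat_simps)
  have "e k \<odot> u k = (e k \<odot> s \<boxplus> t \<odot> d (Suc k)) \<odot> d k" using u(2)[OF k(2)] us by simp
  also have "\<dots> = e k \<odot> (s \<odot> d k)" using t s(1) Suc.prems x(3)[of k] by (simp add: cat_simps)
  finally obtain h where h: "h (Suc k) = s" "\<forall>i. 1 \<le> i \<and> i \<le> Suc k \<longrightarrow> hm (h i) (X i) (Y (i - 1))"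
      "u 0 = h 1 \<odot> d 0"
    "\<forall>i. 1 \<le> i \<and> i \<le> k \<longrightarrow> u i = e (i - 1) \<odot> h i \<boxplus> h (Suc i) \<odot> d i"
    using Suc.IH[OF k(2) s(1)] by blast
  show ?case using h us Suc.prems(2)
    by (intro exI[of _ "h(Suc (Suc k) := t)"]) (auto simp: le_Suc_eq)
qed

lemma homotopy_up:
  assumes X: "exact_in_B X d" and Y: "complex_in_B Y e"
    and u: "\<And>i. i \<le> Suc n \<Longrightarrow> hm (u i) (X i) (Y i)" "\<And>i. i \<le> n \<Longrightarrow> u (Suc i) \<odot> d i = e i \<odot> u i"
  shows "k \<le> n \<Longrightarrow> hm t (X (Suc k)) (Y k) \<Longrightarrow> u (Suc k) \<odot> d k = e k \<odot> (t \<odot> d k) \<Longrightarrow>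
    \<exists>h. h (Suc k) = t \<and> (\<forall>i. Suc k \<le> i \<and> i \<le> Suc n \<longrightarrow> hm (h i) (X i) (Y (i - 1))) \<and>
    u (Suc n) = e n \<odot> h (Suc n) \<and>
    (\<forall>i. Suc k \<le> i \<and> i \<le> n \<longrightarrow> u i = e (i - 1) \<odot> h i \<boxplus> h (Suc i) \<odot> d i)"
proof (induction "n - k" arbitrary: k t)
  case 0
  note x = complexD[OF exactD(1)[OF X]] and y = complexD[OF Y]
  have k: "k = n" using 0 by simp
  have t: "hm (d n) (X n) (X (Suc n))" "hm (e n) (Y n) (Y (Suc n))"
      "hm (u (Suc n)) (X (Suc n)) (Y (Suc n))"
    using x(2)[of n] y(2)[of n] u(1)[of "Suc n"] by auto
  have "u (Suc n) \<boxplus> neg (e n \<odot> t) = Mzero D (X (Suc n)) (Y (Suc n))"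
    by (rule exactD(4)[OF X y(1)[of "Suc n"]]) (use t 0 k in \<open>auto simp: cat_simps\<close>)
  from eq_add_if_diff[OF this] have "u (Suc n) = e n \<odot> t" using t 0 k by (simp add: cat_simps)
  then show ?case using 0 k by (intro exI[of _ "\<lambda>_. t"]) (auto simp: le_Suc_eq)
next
  case (Suc j)
  note x = complexD[OF exactD(1)[OF X]] and y = complexD[OF Y]
  have k: "k < n" "Suc k \<le> n" "j = n - Suc k" using Suc.hyps by auto
  have t: "hm (d k) (X k) (X (Suc k))" "hm (d (Suc k)) (X (Suc k)) (X (Suc (Suc k)))"
    "hm (e k) (Y k) (Y (Suc k))" "hm (e (Suc k)) (Y (Suc k)) (Y (Suc (Suc k)))"
    "hm (u k) (X k) (Y k)" "hm (u (Suc k)) (X (Suc k)) (Y (Suc k))"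
    using x(2)[of k] x(2)[of "Suc k"] y(2)[of k] y(2)[of "Suc k"] u(1)[of k] u(1)[of "Suc k"] k
        by auto
  have w: "hm (u (Suc k) \<boxplus> neg (e k \<odot> t)) (X (Suc k)) (Y (Suc k))"
    using t Suc.prems by (simp add: cat_simps)
  have "(u (Suc k) \<boxplus> neg (e k \<odot> t)) \<odot> d k = Mzero D (X k) (Y (Suc k))"
    using t Suc.prems by (simp add: cat_simps)
  then obtain s where s: "hm s (X (Suc (Suc k))) (Y (Suc k))"
      "u (Suc k) \<boxplus> neg (e k \<odot> t) = s \<odot> d (Suc k)"
    using exactD(5)[OF X y(1)[of "Suc k"] k(1) w] k by auto
  have us: "u (Suc k) = s \<odot> d (Suc k) \<boxplus> e k \<odot> t"
    using eq_add_if_diff[OF s(2)] t Suc.prems by (simp add: cat_simps)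
  have us': "u (Suc k) = e k \<odot> t \<boxplus> s \<odot> d (Suc k)"
    unfolding us by (rule add_comm) (use t s(1) Suc.prems in \<open>auto simp: cat_simps\<close>)
  have "u (Suc (Suc k)) \<odot> d (Suc k) = e (Suc k) \<odot> (s \<odot> d (Suc k) \<boxplus> e k \<odot> t)" using u(2)[OF k(2)] us
      by simp
  also have "\<dots> = e (Suc k) \<odot> (s \<odot> d (Suc k))"
    using t s(1) Suc.prems comp_reduce[OF y(3)[OF k(2)] t(3,4), of t "X (Suc k)"]
        by (simp add: cat_simps)
  finally obtain h where h: "h (Suc (Suc k)) = s"
      "\<forall>i. Suc (Suc k) \<le> i \<and> i \<le> Suc n \<longrightarrow> hm (h i) (X i) (Y (i - 1))"
    "u (Suc n) = e n \<odot> h (Suc n)"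
    "\<forall>i. Suc (Suc k) \<le> i \<and> i \<le> n \<longrightarrow> u i = e (i - 1) \<odot> h i \<boxplus> h (Suc i) \<odot> d i"
    using Suc.hyps(1)[OF k(3,2) s(1)] by blast
  let ?h = "h(Suc k := t)"
  have "hm (?h i) (X i) (Y (i - 1))" if "Suc k \<le> i" "i \<le> Suc n" for i
    using that h(2) Suc.prems(2) by (cases "i = Suc k") auto
  moreover have "u i = e (i - 1) \<odot> ?h i \<boxplus> ?h (Suc i) \<odot> d i" if "Suc k \<le> i" "i \<le> n" for i
    using that h(1,4) us' by (cases "i = Suc k") auto
  ultimately show ?case using h(3) k by (intro exI[of _ ?h]) simp
qed

text \<open>Exactness spreads a null-homotopy from a single position in both directions.\<close>

lemma null_homotopy:
  assumes X: "exact_in_B X d" and Y: "exact_in_B Y e"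
    and u: "\<And>i. i \<le> Suc n \<Longrightarrow> hm (u i) (X i) (Y i)" "\<And>i. i \<le> n \<Longrightarrow> u (Suc i) \<odot> d i = e i \<odot> u i"
    and k: "k \<le> Suc n" "u k = Mzero D (X k) (Y k)"
  shows "\<exists>h. nullh X d Y e u h"
proof -
  note x = complexD[OF exactD(1)[OF X]] and y = complexD[OF exactD(1)[OF Y]]
  \<comment> \<open>Homotopy components start at \<open>X (l + 1)\<close> with
    \<open>l \<le> n\<close>. For \<open>k = n + 1\<close> the recursions begin one position
    earlier, where \<open>e n \<odot> u n = u (n + 1) \<odot> d n\<close> is zero as well.\<close>
  define l where "l = min k n"
  have l: "l \<le> n" by (simp add: l_def)
  have t: "hm (d l) (X l) (X (Suc l))" "hm (e l) (Y l) (Y (Suc l))" using x(2) y(2) l by auto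
  have z: "e l \<odot> u l = Mzero D (X l) (Y (Suc l))"
  proof (cases "k = Suc n")
    case True
    then have "l = n" by (simp add: l_def)
    then show ?thesis using u(2)[of n] k True t by (simp add: cat_simps flip: u(2))
  next
    case False
    then have "l = k" using k by (simp add: l_def)
    then show ?thesis using k t x(4)[of k] by (simp add: cat_simps)
  qed
  let ?t = "Mzero D (X (Suc l)) (Y l)"
  have t': "hm ?t (X (Suc l)) (Y l)" "e l \<odot> (?t \<odot> d l) = Mzero D (X l) (Y (Suc l))" using t
      by (simp_all add: cat_simps)
  obtain h where h: "h (Suc l) = ?t" "\<forall>i. 1 \<le> i \<and> i \<le> Suc l \<longrightarrow> hm (h i) (X i) (Y (i - 1))"
      "u 0 = h 1 \<odot> d 0"
    "\<forall>i. 1 \<le> i \<and> i \<le> l \<longrightarrow> u i = e (i - 1) \<odot> h i \<boxplus> h (Suc i) \<odot> d i"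
    using homotopy_down[OF exactD(1)[OF X] Y u l t'(1)] z t'(2) by auto
  obtain h' where h': "h' (Suc l) = ?t" "\<forall>i. Suc l \<le> i \<and> i \<le> Suc n \<longrightarrow> hm (h' i) (X i) (Y (i - 1))"
    "u (Suc n) = e n \<odot> h' (Suc n)"
    "\<forall>i. Suc l \<le> i \<and> i \<le> n \<longrightarrow> u i = e (i - 1) \<odot> h' i \<boxplus> h' (Suc i) \<odot> d i"
    using homotopy_up[OF X exactD(1)[OF Y] u l t'(1)] z t'(2) u(2)[OF l] by auto
  let ?h = "\<lambda>i. if i \<le> Suc l then h i else h' i"
  have "u i = e (i - 1) \<odot> ?h i \<boxplus> ?h (Suc i) \<odot> d i" if "1 \<le> i" "i \<le> n" for i
  proof -
    consider "i \<le> l" | "i = Suc l" | "Suc l < i" by linarith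
    then show ?thesis by cases (use that h h' in auto)
  qed
  moreover have "hm (?h i) (X i) (Y (i - 1))" if "1 \<le> i" "i \<le> Suc n" for i using that h(2) h'(2)
      by auto
  moreover have "u (Suc n) = e n \<odot> ?h (Suc n)" using h(1) h'(1,3) l by (auto simp: le_Suc_eq)
  ultimately have "nullh X d Y e u ?h" unfolding nullh_def using h(3) by auto
  then show ?thesis by blast
qed

text \<open>The connecting morphism is transported along \<open>g (n + 1)\<close> and
  \<open>f 0\<close>. With it \<open>f\<close> and \<open>g\<close> commute in the last square as
  well: the homotopy corrections pass through \<open>\<alpha> n\<close> or
  \<open>SM (\<alpha> 0)\<close>, both of which compose to zero with
  \<open>\<alpha> (n + 1)\<close>. So \<open>Y\<close> is a homotopy retract of an angle.\<close>

lemma homotopy_equivalent_in_P: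
  assumes X: "(X, \<alpha>) \<in> P" and Y: "complex_in_B Y e"
    and f: "\<And>i. i \<le> Suc n \<Longrightarrow> hm (f i) (X i) (Y i)" "\<And>i. i \<le> n \<Longrightarrow> f (Suc i) \<odot> \<alpha> i = e i \<odot> f i"
    and g: "\<And>i. i \<le> Suc n \<Longrightarrow> hm (g i) (Y i) (X i)" "\<And>i. i \<le> n \<Longrightarrow> g (Suc i) \<odot> e i = \<alpha> i \<odot> g i"
    and hX: "nullh X \<alpha> X \<alpha> (\<lambda>i. g i \<odot> f i \<boxplus> neg (Idm D (X i))) h"
    and hY: "nullh Y e Y e (\<lambda>i. f i \<odot> g i \<boxplus> neg (Idm D (Y i))) h'"
  shows "(Y, e(Suc n := SM (f 0) \<odot> (\<alpha> (Suc n) \<odot> g (Suc n)))) \<in> P"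
proof -
  let ?\<delta> = "SM (f 0) \<odot> (\<alpha> (Suc n) \<odot> g (Suc n))"
  let ?\<beta> = "e(Suc n := ?\<delta>)"
  note Xs = P_seq[OF X] note x = seqD[OF Xs] and y = complexD[OF Y]
  have t: "hm (\<alpha> 0) (X 0) (X 1)" "hm (\<alpha> n) (X n) (X (Suc n))"
      "hm (\<alpha> (Suc n)) (X (Suc n)) (SO (X 0))"
    "hm (e 0) (Y 0) (Y 1)" "hm (e n) (Y n) (Y (Suc n))"
    "hm (f 0) (X 0) (Y 0)" "hm (f 1) (X 1) (Y 1)" "hm (f (Suc n)) (X (Suc n)) (Y (Suc n))"
    "hm (g 0) (Y 0) (X 0)" "hm (g n) (Y n) (X n)" "hm (g (Suc n)) (Y (Suc n)) (X (Suc n))"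
    "hm (h 1) (X 1) (X 0)" "hm (h (Suc n)) (X (Suc n)) (X n)"
    using x(4)[of 0] x(4)[of n] x(5) y(2)[of 0] y(2)[of n] f(1)[of 0] f(1)[of 1] f(1)[of "Suc n"]
      g(1)[of 0] g(1)[of n] g(1)[of
          "Suc n"] hX[unfolded nullh_def, THEN conjunct1, rule_format, of 1]
      hX[unfolded nullh_def, THEN conjunct1, rule_format, of "Suc n"] by auto
  have z: "\<alpha> (Suc n) \<odot> \<alpha> n = Mzero D (X n) (SO (X 0))"
      "SM (\<alpha> 0) \<odot> \<alpha> (Suc n) = Mzero D (X (Suc n)) (SO (X 1))"
    using sigma_complex_in_P[OF X] by (auto simp: sigma_complex_def xo_last)
  have sm: "hm (SM (\<alpha> 0)) (SO (X 0)) (SO (X 1))" using t by (simp add: ang_simps)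
  note z' = comp_reduce[OF z(1) t(2,3)] comp_reduce[OF z(2) t(3) sm]
  have gfn: "g (Suc n) \<odot> f (Suc n) = \<alpha> n \<odot> h (Suc n) \<boxplus> Idm D (X (Suc n))"
    by (rule eq_add_if_diff[of _ _ _ "X (Suc n)" "X (Suc n)"]) (use hX t
        in \<open>auto simp: nullh_def cat_simps\<close>)
  have gf0: "g 0 \<odot> f 0 = h 1 \<odot> \<alpha> 0 \<boxplus> Idm D (X 0)"
    by (rule eq_add_if_diff[of _ _ _ "X 0" "X 0"]) (use hX t in \<open>auto simp: nullh_def cat_simps\<close>)
  have \<delta>: "hm ?\<delta> (Y (Suc n)) (SO (Y 0))" using t by (simp add: ang_simps)
  have Ys: "sigma_seq n D SO Y ?\<beta>" unfolding seq_iff using y(2,4) \<delta> by (auto simp: xo_def le_Suc_eq)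
  have fl: "SM (f 0) \<odot> \<alpha> (Suc n) = ?\<delta> \<odot> f (Suc n)"
  proof -
    have "?\<delta> \<odot> f (Suc n) = SM (f 0) \<odot> (\<alpha> (Suc n) \<odot> (g (Suc n) \<odot> f (Suc n)))" using t
        by (simp add: ang_simps)
    also have "\<dots> = SM (f 0) \<odot> \<alpha> (Suc n)" unfolding gfn using t z' by (simp add: ang_simps)
    finally show ?thesis by simp
  qed
  have gl: "SM (g 0) \<odot> ?\<delta> = \<alpha> (Suc n) \<odot> g (Suc n)"
  proof -
    have "SM (g 0) \<odot> ?\<delta> = SM (g 0 \<odot> f 0) \<odot> (\<alpha> (Suc n) \<odot> g (Suc n))" using t by (simp add: ang_simps)
    also have "\<dots> = \<alpha> (Suc n) \<odot> g (Suc n)" unfolding gf0 using t z' by (simp add: ang_simps)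
    finally show ?thesis .
  qed
  have fm: "sigma_map n D SM X \<alpha> Y ?\<beta> f" unfolding map_iff[OF Xs Ys]
    using f fl by (auto simp: xm_def le_Suc_eq)
  have gm: "sigma_map n D SM Y ?\<beta> X \<alpha> g" unfolding map_iff[OF Ys Xs]
    using g gl by (auto simp: xm_def le_Suc_eq)
  have sc: "sigma_complex Y ?\<beta>" unfolding sigma_complex_def
  proof (intro conjI allI impI)
    fix i assume i: "i \<le> n"
    have "?\<delta> \<odot> e n = SM (f 0) \<odot> (\<alpha> (Suc n) \<odot> (g (Suc n) \<odot> e n))" using t by (simp add: ang_simps)
    also have "\<dots> = Mzero D (Y n) (SO (Y 0))" using g(2)[of n] t z' by (simp add: ang_simps)
    finally show "?\<beta> (Suc i) \<odot> ?\<beta> i = Mzero D (Y i) (xo Y (Suc (Suc i)))"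
      using i y(3)[of i] by (cases "i = n") (auto simp: xo_def)
  next
    have "SM (e 0) \<odot> ?\<delta> = SM (e 0 \<odot> f 0) \<odot> (\<alpha> (Suc n) \<odot> g (Suc n))" using t by (simp add: ang_simps)
    also have "\<dots> = SM (f 1 \<odot> \<alpha> 0) \<odot> (\<alpha> (Suc n) \<odot> g (Suc n))" using f(2)[of 0] by simp
    also have "\<dots> = Mzero D (Y (Suc n)) (SO (Y 1))" using t z' by (simp add: ang_simps)
    finally show "SM (?\<beta> 0) \<odot> ?\<beta> (Suc n) = Mzero D (Y (Suc n)) (SO (Y 1))" by simp
  qed (rule Ys)
  have h': "hm (h' i) (Y i) (Y (i - 1))" if "1 \<le> i" "i \<le> Suc n" for i using hY that
      by (simp add: nullh_def)
  \<comment> \<open>\<open>hY\<close> writes \<open>f \<odot> g - 1\<close> as a homotopy, while the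
    retract lemma adds its homotopy to \<open>f \<odot> g\<close>; hence the negated
    components.\<close>
  show ?thesis
  proof (rule homotopy_retract_in_P[OF sc X fm gm, where h = "\<lambda>i. neg (h' i)"])
    show "hm (neg (h' i)) (Y i) (Y (i - 1))" if "1 \<le> i" "i \<le> Suc n" for i
      using h'[OF that] by (simp add: cat_simps)
    fix i assume i: "i \<le> Suc n"
    have fgi: "hm (f i \<odot> g i) (Y i) (Y i)" using f(1)[OF i] g(1)[OF i] by (simp add: cat_simps)
    note yo = y(4)[OF i]
    consider "i = 0" | "1 \<le> i" "i \<le> n" | "i = Suc n" using i by linarith
    then show "f i \<odot> g i \<boxplus> homotopy_part Y ?\<beta> (\<lambda>i. neg (h' i)) (Suc n) i = Idm D (Y i)"
    proof cases
      case 1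
      have a: "hm (h' 1 \<odot> e 0) (Y 0) (Y 0)" using h'[of 1] t by (simp add: cat_simps)
      have "f 0 \<odot> g 0 \<boxplus> neg (Idm D (Y 0)) = h' 1 \<odot> e 0" using hY by (simp add: nullh_def)
      from eq_add_if_diff[OF this] have fg: "f i \<odot> g i = h' 1 \<odot> e 0 \<boxplus> Idm D (Y 0)"
        using fgi yo 1 by (simp add: cat_simps)
      have hp: "homotopy_part Y ?\<beta> (\<lambda>i. neg (h' i)) (Suc n) i = neg (h' 1 \<odot> e 0)"
        using 1 t h'[of 1] by (simp add: homotopy_part_def cat_simps)
      show ?thesis unfolding fg hp using a yo[unfolded 1] unfolding 1 hm_def by algebra
    next
      case 2
      have a: "hm (e (i - 1) \<odot> h' i) (Y i) (Y i)" "hm (h' (Suc i) \<odot> e i) (Y i) (Y i)"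
        using h'[of i] h'[of "Suc i"] y(2)[of "i - 1"] y(2)[of i] 2 by (simp_all add: cat_simps)
      have "f i \<odot> g i \<boxplus> neg (Idm D (Y i)) = e (i - 1) \<odot> h' i \<boxplus> h' (Suc i) \<odot> e i"
        using hY 2 by (simp add: nullh_def)
      from eq_add_if_diff[OF this] have fg:
          "f i \<odot> g i = (e (i - 1) \<odot> h' i \<boxplus> h' (Suc i) \<odot> e i) \<boxplus> Idm D (Y i)"
        using fgi yo by (simp add: cat_simps)
      have hp: "homotopy_part Y ?\<beta> (\<lambda>i. neg (h' i)) (Suc n) i = neg (e (i - 1) \<odot> h' i) \<boxplus> neg (h'
          (Suc i) \<odot> e i)"
        using 2 y(2)[of "i - 1"] y(2)[of i] h'[of i] h'[of "Suc i"]
            by (auto simp: homotopy_part_def cat_simps)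
      show ?thesis unfolding fg hp using a yo unfolding hm_def by algebra
    next
      case 3
      have a: "hm (e n \<odot> h' (Suc n)) (Y (Suc n)) (Y (Suc n))" using h'[of "Suc n"] t
          by (simp add: cat_simps)
      have "f (Suc n) \<odot> g (Suc n) \<boxplus> neg (Idm D (Y (Suc n))) = e n \<odot> h' (Suc n)" using hY
          by (simp add: nullh_def)
      from eq_add_if_diff[OF this] have fg: "f i \<odot> g i = e n \<odot> h' (Suc n) \<boxplus> Idm D (Y (Suc n))"
        using fgi yo 3 by (simp add: cat_simps)
      have hp: "homotopy_part Y ?\<beta> (\<lambda>i. neg (h' i)) (Suc n) i = neg (e n \<odot> h' (Suc n))"
        using 3 t h'[of "Suc n"] by (simp add: homotopy_part_def cat_simps)
      show ?thesis unfolding fg hp using a yo[unfolded 3] unfolding 3 hm_def by algebra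
    qed
  qed
qed

text \<open>The difference from the identity is a chain map that vanishes in position
  \<open>k\<close>, so \<open>null_homotopy\<close> applies.\<close>

lemma comp_null_homotopy:
  assumes X: "exact_in_B X d" and Y: "complex_in_B Y e"
    and f: "\<And>i. i \<le> Suc n \<Longrightarrow> hm (f i) (X i) (Y i)" "\<And>i. i \<le> n \<Longrightarrow> f (Suc i) \<odot> d i = e i \<odot> f i"
    and g: "\<And>i. i \<le> Suc n \<Longrightarrow> hm (g i) (Y i) (X i)" "\<And>i. i \<le> n \<Longrightarrow> g (Suc i) \<odot> e i = d i \<odot> g i"
    and k: "k \<le> Suc n" "g k \<odot> f k = Idm D (X k)"
  shows "\<exists>h. nullh X d X d (\<lambda>i. g i \<odot> f i \<boxplus> neg (Idm D (X i))) h"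
proof (rule null_homotopy[OF X X])
  note x = complexD[OF exactD(1)[OF X]] and y = complexD[OF Y]
  show "hm (g i \<odot> f i \<boxplus> neg (Idm D (X i))) (X i) (X i)" if "i \<le> Suc n" for i
    using f(1)[OF that] g(1)[OF that] by (simp add: cat_simps)
  show "(g (Suc i) \<odot> f (Suc i) \<boxplus> neg (Idm D (X (Suc i)))) \<odot> d i = d i \<odot> (g i \<odot> f i \<boxplus> neg (Idm D (X
      i)))" if i: "i \<le> n" for i
  proof -
    have t: "hm (d i) (X i) (X (Suc i))" "hm (e i) (Y i) (Y (Suc i))" "hm (f i) (X i) (Y i)"
        "hm (g i) (Y i) (X i)"
      "hm (f (Suc i)) (X (Suc i)) (Y (Suc i))" "hm (g (Suc i)) (Y (Suc i)) (X (Suc i))"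
      using x(2) y(2) f(1) g(1) i by auto
    have "(g (Suc i) \<odot> f (Suc i)) \<odot> d i = g (Suc i) \<odot> (f (Suc i) \<odot> d i)" using t
        by (simp add: cat_simps)
    also have "\<dots> = (g (Suc i) \<odot> e i) \<odot> f i" unfolding f(2)[OF i] using t by (simp add: cat_simps)
    also have "\<dots> = d i \<odot> (g i \<odot> f i)" unfolding g(2)[OF i] using t by (simp add: cat_simps)
    finally show ?thesis using t by (simp add: cat_simps)
  qed
  show "g k \<odot> f k \<boxplus> neg (Idm D (X k)) = Mzero D (X k) (X k)"
    unfolding k(2) using x(4)[OF k(1)] by (simp add: cat_simps)
qed (rule k(1))

text \<open>Being mutually inverse in the single position \<open>k\<close> already makes
  \<open>f\<close> and \<open>g\<close> homotopy inverse, since both sequences are exact; the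
  connecting morphism of \<open>X\<close> can then be transported to \<open>Y\<close>.\<close>

lemma homotopy_equivalent_in_ext:
  assumes X: "(X, d) \<in> \<X>" and Y: "exact_in_B Y e"
    and f: "\<And>i. i \<le> Suc n \<Longrightarrow> hm (f i) (X i) (Y i)" "\<And>i. i \<le> n \<Longrightarrow> f (Suc i) \<odot> d i = e i \<odot> f i"
    and g: "\<And>i. i \<le> Suc n \<Longrightarrow> hm (g i) (Y i) (X i)" "\<And>i. i \<le> n \<Longrightarrow> g (Suc i) \<odot> e i = d i \<odot> g i"
    and k: "k \<le> Suc n" "g k \<odot> f k = Idm D (X k)" "f k \<odot> g k = Idm D (Y k)"
  shows "(Y, e) \<in> \<X>"
proof -
  obtain \<alpha> where X': "(X, \<alpha>) \<in> P" and d: "\<And>i. i \<le> n \<Longrightarrow> \<alpha> i = d i" and XB: "\<And>i. i \<le> Suc n \<Longrightarrow> X i \<in> B"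
    using ext_sequencesE[OF X] by blast
  have Xe: "exact_in_B X \<alpha>" by (rule ext_sequences_exact, rule ext_sequencesI[OF X' XB refl])
  have f': "\<And>i. i \<le> n \<Longrightarrow> f (Suc i) \<odot> \<alpha> i = e i \<odot> f i"
      and g': "\<And>i. i \<le> n \<Longrightarrow> g (Suc i) \<odot> e i = \<alpha> i \<odot> g i"
    using f(2) g(2) d by auto
  obtain h where h: "nullh X \<alpha> X \<alpha> (\<lambda>i. g i \<odot> f i \<boxplus> neg (Idm D (X i))) h"
    using comp_null_homotopy[OF Xe exactD(1)[OF Y] f(1) f' g(1) g' k(1,2)] by blast
  obtain h' where h': "nullh Y e Y e (\<lambda>i. f i \<odot> g i \<boxplus> neg (Idm D (Y i))) h'"
    using comp_null_homotopy[OF Y exactD(1)[OF Xe] g(1) g' f(1) f' k(1,3)] by blast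
  from homotopy_equivalent_in_P[OF X' exactD(1)[OF Y] f(1) f' g(1) g' h h']
  show ?thesis by (rule ext_sequencesI) (use complexD(1)[OF exactD(1)[OF Y]] in auto)
qed

text \<open>
  The remaining weak isomorphisms are those whose two outer components are invertible.  The
  obstruction to lifting the inverse of an outer component is an extension class; it vanishes,
  since its realization maps to both sequences and is therefore split.
\<close>

lemma weak_iso_outer_source:
  assumes X: "(X, d) \<in> \<X>" and Y: "exact_in_B Y e"
    and f: "\<And>i. i \<le> Suc n \<Longrightarrow> hm (f i) (X i) (Y i)" "\<And>i. i \<le> n \<Longrightarrow> f (Suc i) \<odot> d i = e i \<odot> f i"
    and b: "hm b (Y 0) (X 0)" "b \<odot> f 0 = Idm D (X 0)"
    and c: "hm c (Y (Suc n)) (X (Suc n))" "c \<odot> f (Suc n) = Idm D (X (Suc n))"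
        "f (Suc n) \<odot> c = Idm D (Y (Suc n))"
  shows "(Y, e) \<in> \<X>"
proof -
  obtain \<alpha> where X': "(X, \<alpha>) \<in> P" and d: "\<And>i. i \<le> n \<Longrightarrow> \<alpha> i = d i" and XB: "\<And>i. i \<le> Suc n \<Longrightarrow> X i \<in> B"
    using ext_sequencesE[OF X] by blast
  note x = seqD[OF P_seq[OF X']] and y = complexD[OF exactD(1)[OF Y]]
  note Xe = ext_sequences_exact[OF X]
  have t: "hm (\<alpha> n) (X n) (X (Suc n))" "hm (\<alpha> (Suc n)) (X (Suc n)) (SO (X 0))"
      "hm (e n) (Y n) (Y (Suc n))"
    "hm (f 0) (X 0) (Y 0)" "hm (f n) (X n) (Y n)" "hm (f (Suc n)) (X (Suc n)) (Y (Suc n))"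
    using x(4)[of n] x(5) y(2)[of n] f(1)[of 0] f(1)[of n] f(1)[of "Suc n"] by auto
  \<comment> \<open>By exactness of the angle \<open>X\<close> this class is zero iff
    \<open>c \<odot> e n\<close> factors through \<open>\<alpha> n\<close>, that is, iff
    \<open>c\<close> lifts to position \<open>n\<close>.\<close>
  let ?\<epsilon> = "\<alpha> (Suc n) \<odot> (c \<odot> e n)"
  have \<epsilon>: "hm ?\<epsilon> (Y n) (SO (X 0))" using t c by (simp add: cat_simps)
  obtain E \<eta> where E: "(E, \<eta>) \<in> P" "E 0 = X 0" "E (Suc n) = Y n" "\<eta> (Suc n) = ?\<epsilon>"
      "\<And>i. i \<le> Suc n \<Longrightarrow> E i \<in> B" "(E, \<eta>) \<in> \<X>"
    using extensionE[OF XB[of 0] y(1)[of n] \<epsilon>] by auto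
  note Es = seqD[OF P_seq[OF E(1)]]
  obtain s where s: "s 0 = Idm D (X 0)" "s (Suc n) = c \<odot> e n" "sigma_map n D SM E \<eta> X \<alpha> s"
    using F3_last[OF E(1) X', of "Idm D (X 0)" "c \<odot> e n"] E x(1)[of 0] t c \<epsilon>
    by (auto simp: ang_simps)
  note sD = mapD[OF s(3) P_seq[OF E(1)] P_seq[OF X']]
  define u where "u i = f i \<odot> s i" for i
  have u: "hm (u i) (E i) (Y i)" if "i \<le> Suc n" for i using sD(1)[OF that] f(1)[OF that]
      by (simp add: u_def cat_simps)
  have uc: "u (Suc i) \<odot> \<eta> i = e i \<odot> u i" if i: "i \<le> n" for i
  proof -
    have w: "hm (f (Suc i)) (X (Suc i)) (Y (Suc i))" "hm (s (Suc i)) (E (Suc i)) (X (Suc i))"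
        "hm (\<eta> i) (E i) (E (Suc i))"
      "hm (\<alpha> i) (X i) (X (Suc i))" "hm (s i) (E i) (X i)" "hm (f i) (X i) (Y i)"
          "hm (e i) (Y i) (Y (Suc i))"
      using f(1) sD(1) Es(4) x(4) y(2) i by auto
    have "u (Suc i) \<odot> \<eta> i = f (Suc i) \<odot> (s (Suc i) \<odot> \<eta> i)" using w by (simp add: u_def cat_simps)
    also have "\<dots> = (f (Suc i) \<odot> \<alpha> i) \<odot> s i" unfolding sD(4)[OF i] using w by (simp add: cat_simps)
    also have "\<dots> = e i \<odot> u i" using f(2)[OF i] d[OF i] w by (simp add: u_def cat_simps)
    finally show ?thesis .
  qed
  have "u (Suc n) = (f (Suc n) \<odot> c) \<odot> e n" using t c(1) by (simp add: u_def s(2) cat_simps)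
  then have "u (Suc n) = e n" using t c(3) by (simp add: cat_simps)
  \<comment> \<open>As \<open>u (n + 1) = e n\<close>, the identity of \<open>Y n\<close> can serve
    as the last homotopy component. The recursion down to position \<open>0\<close> then factors
    \<open>u 0\<close> through \<open>\<eta> 0\<close>.\<close>
  then have "e n \<odot> u n = e n \<odot> (Idm D (Y n) \<odot> \<eta> n)"
    using uc[of n] Es(4)[of n] E(3) by (simp add: cat_simps)
  moreover have "hm (Idm D (Y n)) (E (Suc n)) (Y n)" using E(3) y(4)[of n] by (simp add: cat_simps)
  ultimately obtain h where "\<forall>i. 1 \<le> i \<and> i \<le> Suc n \<longrightarrow> hm (h i) (E i) (Y (i - 1))" "u 0 = h 1 \<odot> \<eta> 0"
    using homotopy_down[OF exactD(1)[OF ext_sequences_exact[OF E(6)]] Y u uc order_refl, of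
        "Idm D (Y n)"] by blast
  then have h: "hm (h 1) (E 1) (Y 0)" "u 0 = h 1 \<odot> \<eta> 0" by auto
  \<comment> \<open>In an angle the suspended first map kills the connecting morphism. So
    \<open>SM (f 0)\<close> kills the class, and the left inverse \<open>b\<close> of
    \<open>f 0\<close> shows that it is zero.\<close>
  have "f 0 = h 1 \<odot> \<eta> 0" using h(2) s(1) t by (simp add: u_def cat_simps)
  moreover have "hm (\<eta> 0) (X 0) (E 1)" using Es(4)[of 0] E(2) by simp
  moreover have z: "SM (\<eta> 0) \<odot> ?\<epsilon> = Mzero D (Y n) (SO (E 1))"
    using sigma_complex_in_P[OF E(1)] E by (simp add: sigma_complex_def)
  ultimately have "SM (f 0) \<odot> ?\<epsilon> = Mzero D (Y n) (SO (Y 0))"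
    using h(1) \<epsilon> comp_assoc[of ?\<epsilon> "Y n" "SO (X 0)" "SM (\<eta> 0)" "SO (E 1)" "SM (h 1)" "SO (Y 0)"]
    by (simp add: ang_simps del: comp_assoc)
  then have "SM b \<odot> (SM (f 0) \<odot> ?\<epsilon>) = Mzero D (Y n) (SO (X 0))"
    using b(1) y(4)[of n] by (simp add: ang_simps)
  moreover have "SM b \<odot> (SM (f 0) \<odot> ?\<epsilon>) = SM (b \<odot> f 0) \<odot> ?\<epsilon>"
    using b(1) t \<epsilon> c(1) by (simp add: ang_simps)
  ultimately have "?\<epsilon> = Mzero D (Y n) (SO (X 0))"
    unfolding b(2) using \<epsilon> x(1)[of 0] by (simp add: SM_id id_comp hm_def)
  then obtain gn where gn: "hm gn (Y n) (X n)" "c \<odot> e n = \<alpha> n \<odot> gn"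
    using cov_exact_in_P[OF X', of n "c \<odot> e n" "Y n"] t c(1) by (auto simp: xo_last cat_simps)
  then have sq: "d n \<odot> gn = c \<odot> e n" using d[of n] by simp
  obtain g where g: "g (Suc n) = c" "\<And>i. i \<le> Suc n \<Longrightarrow> hm (g i) (Y i) (X i)"
      "\<And>i. i \<le> n \<Longrightarrow> g (Suc i) \<odot> e i = d i \<odot> g i"
    using lift[OF Y Xe order_refl gn(1) c(1) sq] by metis
  show ?thesis
    by (rule homotopy_equivalent_in_ext[OF X Y f g(2,3), of "Suc n"]) (use g(1) c(2,3) in auto)
qed

text \<open>The mirror image: the obstruction to extending \<open>b\<close> to position
  \<open>1\<close> is \<open>SM (d 0 \<odot> b) \<odot> \<gamma> (n + 1)\<close>. The composite from
  \<open>X\<close> through \<open>Y\<close> to its realization shows that \<open>f (n + 1)\<close>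
  factors through the last map before the connecting morphism, and the right inverse
  \<open>c\<close> makes the class zero.\<close>

lemma weak_iso_outer_target:
  assumes X: "exact_in_B X d" and Y: "(Y, e) \<in> \<X>"
    and f: "\<And>i. i \<le> Suc n \<Longrightarrow> hm (f i) (X i) (Y i)" "\<And>i. i \<le> n \<Longrightarrow> f (Suc i) \<odot> d i = e i \<odot> f i"
    and b: "hm b (Y 0) (X 0)" "b \<odot> f 0 = Idm D (X 0)" "f 0 \<odot> b = Idm D (Y 0)"
    and c: "hm c (Y (Suc n)) (X (Suc n))" "f (Suc n) \<odot> c = Idm D (Y (Suc n))"
  shows "(X, d) \<in> \<X>"
proof -
  obtain \<gamma> where Y': "(Y, \<gamma>) \<in> P" and e: "\<And>i. i \<le> n \<Longrightarrow> \<gamma> i = e i" and YB: "\<And>i. i \<le> Suc n \<Longrightarrow> Y i \<in> B"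
    using ext_sequencesE[OF Y] by blast
  note y = seqD[OF P_seq[OF Y']] and x = complexD[OF exactD(1)[OF X]]
  note Ye = ext_sequences_exact[OF Y]
  have t: "hm (d 0) (X 0) (X 1)" "hm (\<gamma> (Suc n)) (Y (Suc n)) (SO (Y 0))"
    "hm (f 0) (X 0) (Y 0)" "hm (f (Suc n)) (X (Suc n)) (Y (Suc n))"
    using y(5) x(2)[of 0] f(1)[of 0] f(1)[of "Suc n"] by auto
  have db: "hm (d 0 \<odot> b) (Y 0) (X 1)" using t b by (simp add: cat_simps)
  let ?\<epsilon> = "SM (d 0 \<odot> b) \<odot> \<gamma> (Suc n)"
  have \<epsilon>: "hm ?\<epsilon> (Y (Suc n)) (SO (X 1))" using t db by (simp add: hm_def ty_SM ty_comp SO_in)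
  obtain E \<eta> where E: "(E, \<eta>) \<in> P" "E 0 = X 1" "E (Suc n) = Y (Suc n)" "\<eta> (Suc n) = ?\<epsilon>"
      "\<And>i. i \<le> Suc n \<Longrightarrow> E i \<in> B" "(E, \<eta>) \<in> \<X>"
    using extensionE[OF x(1)[of 1] YB[of "Suc n"] \<epsilon>] by auto
  note Es = seqD[OF P_seq[OF E(1)]]
  obtain s where s: "s 0 = d 0 \<odot> b" "s (Suc n) = Idm D (Y (Suc n))" "sigma_map n D SM Y \<gamma> E \<eta> s"
    using F3_last[OF Y' E(1), of "d 0 \<odot> b" "Idm D (Y (Suc n))"] E y(1)[of "Suc n"] db \<epsilon>
    by (auto simp: hm_def ty_id comp_id)
  note sD = mapD[OF s(3) P_seq[OF Y'] P_seq[OF E(1)]]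
  define u where "u i = s i \<odot> f i" for i
  have u: "hm (u i) (X i) (E i)" if "i \<le> Suc n" for i using sD(1)[OF that] f(1)[OF that]
      by (simp add: u_def cat_simps)
  have uc: "u (Suc i) \<odot> d i = \<eta> i \<odot> u i" if i: "i \<le> n" for i
  proof -
    have w: "hm (f (Suc i)) (X (Suc i)) (Y (Suc i))" "hm (s (Suc i)) (Y (Suc i)) (E (Suc i))"
        "hm (\<eta> i) (E i) (E (Suc i))"
      "hm (d i) (X i) (X (Suc i))" "hm (s i) (Y i) (E i)" "hm (f i) (X i) (Y i)"
          "hm (\<gamma> i) (Y i) (Y (Suc i))"
      using f(1) sD(1) Es(4) x(2) y(4) i by auto
    have "u (Suc i) \<odot> d i = s (Suc i) \<odot> (f (Suc i) \<odot> d i)" using w by (simp add: u_def cat_simps)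
    also have "\<dots> = (s (Suc i) \<odot> \<gamma> i) \<odot> f i" unfolding f(2)[OF i] using e[OF i] w
        by (simp add: cat_simps)
    also have "\<dots> = \<eta> i \<odot> u i" unfolding sD(4)[OF i] using w by (simp add: u_def cat_simps)
    finally show ?thesis .
  qed
  have "u 0 = d 0 \<odot> (b \<odot> f 0)" using t b(1) by (simp add: u_def s(1) cat_simps)
  then have "u 0 = d 0" using t b(2) by (simp add: cat_simps)
  then have "u (Suc 0) \<odot> d 0 = \<eta> 0 \<odot> (Idm D (X 1) \<odot> d 0)"
    using uc[of 0] t by (simp add: cat_simps)
  moreover have "hm (Idm D (X 1)) (X (Suc 0)) (E 0)" using E(2) x(4)[of 1] by (simp add: cat_simps)
  ultimately obtain h where "\<forall>i. Suc 0 \<le> i \<and> i \<le> Suc n \<longrightarrow> hm (h i) (X i) (E (i - 1))"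
      "u (Suc n) = \<eta> n \<odot> h (Suc n)"
    using homotopy_up[OF X exactD(1)[OF ext_sequences_exact[OF E(6)]] u uc le0, of "Idm D (X 1)"]
        by blast
  then have h: "hm (h (Suc n)) (X (Suc n)) (E n)" "u (Suc n) = \<eta> n \<odot> h (Suc n)" by auto
  have fh: "f (Suc n) = \<eta> n \<odot> h (Suc n)" using h(2) s(2) t by (simp add: u_def cat_simps)
  have en: "hm (\<eta> n) (E n) (Y (Suc n))" using Es(4)[of n] E(3) by simp
  have z: "?\<epsilon> \<odot> \<eta> n = Mzero D (E n) (SO (X 1))"
    using comp_zero_in_P[OF E(1), of n] E by (simp add: xo_last)
  have "?\<epsilon> \<odot> f (Suc n) = Mzero D (X (Suc n)) (SO (X 1))"
    unfolding fh using comp_reduce[OF z en \<epsilon>, of "h (Suc n)" "X (Suc n)"] h(1) \<epsilon>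
        by (simp add: hm_def zero_comp)
  then have "(?\<epsilon> \<odot> f (Suc n)) \<odot> c = Mzero D (Y (Suc n)) (SO (X 1))"
    using c(1) \<epsilon> by (simp add: hm_def zero_comp)
  moreover have "(?\<epsilon> \<odot> f (Suc n)) \<odot> c = ?\<epsilon> \<odot> (f (Suc n) \<odot> c)"
    using c(1) t \<epsilon> by (intro comp_assoc) (auto simp: hm_def)
  ultimately have "?\<epsilon> = Mzero D (Y (Suc n)) (SO (X 1))"
    unfolding c(2) using \<epsilon> by (simp add: hm_def comp_id)
  then obtain g1 where g1: "hm g1 (Y 1) (X 1)" "d 0 \<odot> b = g1 \<odot> \<gamma> 0"
    using contra_exact_last_in_P[OF Y' db] by auto
  then have sq: "d 0 \<odot> b = g1 \<odot> e 0" using e[of 0] by simp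
  obtain g where g: "g 0 = b" "\<And>i. i \<le> Suc n \<Longrightarrow> hm (g i) (Y i) (X i)"
      "\<And>i. i \<le> n \<Longrightarrow> g (Suc i) \<odot> e i = d i \<odot> g i"
    using lift[OF Ye X, of 0 b g1] b(1) g1(1) sq by auto
  show ?thesis
    by (rule homotopy_equivalent_in_ext[OF Y X g(2,3) f, of 0]) (use g(1) b(2,3) in auto)
qed

text \<open>For \<open>k \<le> n\<close> the two inverses commute with the differential between them
  and form a square that \<open>lift\<close> extends. For \<open>k = n + 1\<close> the invertible
  components are the two outer ones.\<close>

lemma weak_iso_closed_ext:
  assumes X: "exact_in_B X d" and Y: "exact_in_B Y e" and w: "weak_iso n (full_sub D B) X d Y e \<phi>"
  shows "(X, d) \<in> \<X> \<longleftrightarrow> (Y, e) \<in> \<X>"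
proof -
  note x = complexD[OF exactD(1)[OF X]] and y = complexD[OF exactD(1)[OF Y]]
  have "chain_map D (Suc n) X d Y e \<phi>" using w by (simp add: weak_iso_def)
  then have f: "\<And>i. i \<le> Suc n \<Longrightarrow> hm (\<phi> i) (X i) (Y i)" "\<And>i. i \<le> n \<Longrightarrow> \<phi> (Suc i) \<odot> d i = e i \<odot> \<phi> i"
    by (subst (asm) chain_map_hm; use x(4) y(4) in auto)+
  obtain k where k: "k \<le> Suc n" "isomor D (X k) (Y k) (\<phi> k)"
    "isomor D (X (Suc k mod Suc (Suc n))) (Y (Suc k mod Suc (Suc n))) (\<phi> (Suc k mod Suc (Suc n)))"
    using w by (auto simp: weak_iso_def Let_def)
  obtain a where a: "hm a (Y k) (X k)" "a \<odot> \<phi> k = Idm D (X k)" "\<phi> k \<odot> a = Idm D (Y k)"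
    using k(2) isomor_iff[OF x(4) y(4), OF k(1) k(1)] by blast
  show ?thesis
  proof (cases "k = Suc n")
    case True
    then have "isomor D (X 0) (Y 0) (\<phi> 0)" using k(3) by simp
    then obtain b where b: "hm b (Y 0) (X 0)" "b \<odot> \<phi> 0 = Idm D (X 0)" "\<phi> 0 \<odot> b = Idm D (Y 0)"
      using isomor_iff[OF x(4)[of 0] y(4)[of 0]] by auto
    show ?thesis
      using weak_iso_outer_source[OF _ Y f b(1,2) a[unfolded True]]
        weak_iso_outer_target[OF X _ f b a(1,3)[unfolded True]] by blast
  next
    case False
    then have k': "k \<le> n" using k by simp
    then have "isomor D (X (Suc k)) (Y (Suc k)) (\<phi> (Suc k))" using k(3) by simp
    then obtain b where b: "hm b (Y (Suc k)) (X (Suc k))" "b \<odot> \<phi> (Suc k) = Idm D (X (Suc k))"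
        "\<phi> (Suc k) \<odot> b = Idm D (Y (Suc k))"
      using isomor_iff[OF x(4) y(4)] k' by auto
    have t: "hm (\<phi> k) (X k) (Y k)" "hm (\<phi> (Suc k)) (X (Suc k)) (Y (Suc k))"
        "hm (d k) (X k) (X (Suc k))" "hm (e k) (Y k) (Y (Suc k))"
      using f(1) x(2) y(2) k' by auto
    have "d k \<odot> a = (b \<odot> \<phi> (Suc k)) \<odot> (d k \<odot> a)" unfolding b(2) using t a(1)
        by (simp add: cat_simps)
    also have "\<dots> = b \<odot> ((\<phi> (Suc k) \<odot> d k) \<odot> a)" using t a(1) b(1) by (simp add: cat_simps)
    also have "\<dots> = (b \<odot> e k) \<odot> (\<phi> k \<odot> a)" unfolding f(2)[OF k'] using t a(1) b(1)
        by (simp add: cat_simps)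
    also have "\<dots> = b \<odot> e k" unfolding a(3) using t b(1) by (simp add: cat_simps)
    finally have sq: "d k \<odot> a = b \<odot> e k" .
    obtain g where g: "g k = a" "\<And>i. i \<le> Suc n \<Longrightarrow> hm (g i) (Y i) (X i)"
        "\<And>i. i \<le> n \<Longrightarrow> g (Suc i) \<odot> e i = d i \<odot> g i"
      using lift[OF Y X k' a(1) b(1) sq] by metis
    show ?thesis
      using homotopy_equivalent_in_ext[OF _ Y f g(2,3) k(1)] homotopy_equivalent_in_ext[OF _ X
          g(2,3) f k(1)] g(1) a(2,3)
      by auto
  qed
qed

section \<open>Homotopy classes and smallness\<close>

lemma null_homotopic_iff:
  assumes X: "complex_in_B X d" and Y: "complex_in_B Y e"
  shows "null_homotopic n (full_sub D B) X d Y e u \<longleftrightarrow> (\<exists>h. nullh X d Y e u h)"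
proof -
  note x = complexD[OF X] and y = complexD[OF Y]
  have "h i \<in> Hom D (X i) (Y (i - 1)) \<longleftrightarrow> hm (h i) (X i) (Y (i - 1))" if "1 \<le> i" "i \<le> Suc n" for h i
    using x(4)[of i] y(4)[of "i - 1"] that by (simp add: hm_iff)
  then show ?thesis unfolding null_homotopic_def nullh_def
      by (simp add: Ball_def atLeastAtMost_iff conj_ac cong: conj_cong imp_cong)
qed

lemma homotopic_id_iff:
  assumes X: "complex_in_B X d"
  shows "homotopic n (full_sub D B) X d X d u (\<lambda>i. Idm D (X i)) \<longleftrightarrow>
    (\<exists>h. nullh X d X d (\<lambda>i. u i \<boxplus> neg (Idm D (X i))) h)"
proof -
  note x = complexD[OF X]
  have *: "mneg D (X i) (X i) (Idm D (X i)) = neg (Idm D (X i))" if "i \<le> Suc n" for i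
    using x(4)[OF that] by (simp add: mneg_eq ty_id)
  have "nullh X d X d (\<lambda>i. u i \<boxplus> mneg D (X i) (X i) (Idm D (X i))) h \<longleftrightarrow>
    nullh X d X d (\<lambda>i. u i \<boxplus> neg (Idm D (X i))) h" for h
    unfolding nullh_def using * by auto
  then show ?thesis using null_homotopic_iff[OF X X] by (simp add: homotopic_def)
qed

text \<open>A homotopy equivalence with identities at the ends transports \<open>\<delta>\<close> to
  itself. Conversely, \<open>F3_last\<close> with identities at both ends gives chain maps in both
  directions, and their composites are homotopic to identities because they are identities in
  position \<open>0\<close>.\<close>

lemma htpy_class_eq:
  assumes X: "(X, d(Suc n := \<delta>)) \<in> P" and c: "(X, d) \<in> complexes_between n (full_sub D B) A C"
  shows "htpy_class n (full_sub D B) A C (X, d) =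
    {(Y, e) \<in> complexes_between n (full_sub D B) A C. (Y, e(Suc n := \<delta>)) \<in> P}"
proof -
  have Xc: "complex_in_B X d" and X0: "X 0 = A" "X (Suc n) = C" using c
      by (auto simp: complexes_between_def)
  note x = complexD[OF Xc]
  have Xe: "exact_in_B X d" by (rule ext_sequences_exact, rule ext_sequencesI[OF X x(1)]) auto
  have \<delta>: "hm \<delta> C (SO A)" using seqD(5)[OF P_seq[OF X]] X0 by simp
  have o: "A \<in> Obj D" "C \<in> Obj D" using \<delta> x(4)[of 0] X0 by (auto simp: hm_def)
  have "(\<exists>f g. map_between n (full_sub D B) A C X d Y e f \<and>
      map_between n (full_sub D B) A C Y e X d g \<and>
      homotopic n (full_sub D B) X d X d (\<lambda>i. g i \<odot> f i) (\<lambda>i. Idm D (X i)) \<and>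
      homotopic n (full_sub D B) Y e Y e (\<lambda>i. f i \<odot> g i) (\<lambda>i. Idm D (Y i))) \<longleftrightarrow>
          (Y, e(Suc n := \<delta>)) \<in> P"
    if Y: "(Y, e) \<in> complexes_between n (full_sub D B) A C" for Y e
  proof -
    have Yc: "complex_in_B Y e" and Y0: "Y 0 = A" "Y (Suc n) = C" using Y
        by (auto simp: complexes_between_def)
    note y = complexD[OF Yc]
    have mb: "map_between n (full_sub D B) A C X' d' Y' e' f \<longleftrightarrow>
      (\<forall>i\<le>Suc n. hm (f i) (X' i) (Y' i)) \<and> (\<forall>i\<le>n. f (Suc i) \<odot> d' i = e' i \<odot> f i) \<and> f 0 = Idm D A \<and>
          f (Suc n) = Idm D C"
      if "complex_in_B X' d'" "complex_in_B Y' e'" for X' d' Y' e' f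
      unfolding map_between_def full_sub_cone full_sub_simps Suc_eq_plus1[symmetric]
      by (subst chain_map_hm) (use complexD(4) that in \<open>auto simp: less_Suc_eq_le\<close>)
    show ?thesis
    proof
      assume "\<exists>f g. map_between n (full_sub D B) A C X d Y e f \<and>
          map_between n (full_sub D B) A C Y e X d g \<and>
        homotopic n (full_sub D B) X d X d (\<lambda>i. g i \<odot> f i) (\<lambda>i. Idm D (X i)) \<and>
        homotopic n (full_sub D B) Y e Y e (\<lambda>i. f i \<odot> g i) (\<lambda>i. Idm D (Y i))"
      then obtain f g h h' where f: "\<forall>i\<le>Suc n. hm (f i) (X i) (Y i)"
          "\<forall>i\<le>n. f (Suc i) \<odot> d i = e i \<odot> f i" "f 0 = Idm D A"
        and g: "\<forall>i\<le>Suc n. hm (g i) (Y i) (X i)" "\<forall>i\<le>n. g (Suc i) \<odot> e i = d i \<odot> g i"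
            "g (Suc n) = Idm D C"
        and h: "nullh X d X d (\<lambda>i. g i \<odot> f i \<boxplus> neg (Idm D (X i))) h"
            "nullh Y e Y e (\<lambda>i. f i \<odot> g i \<boxplus> neg (Idm D (Y i))) h'"
        unfolding mb[OF Xc Yc] mb[OF Yc Xc] homotopic_id_iff[OF Xc] homotopic_id_iff[OF Yc] by blast
      have "nullh X (d(Suc n := \<delta>)) X (d(Suc n := \<delta>)) (\<lambda>i. g i \<odot> f i \<boxplus> neg (Idm D (X i))) h"
        using h(1) unfolding nullh_def by auto
      from homotopy_equivalent_in_P[OF X Yc _ _ _ _ this h(2)]
      have "(Y, e(Suc n := SM (f 0) \<odot> (\<delta> \<odot> g (Suc n)))) \<in> P" using f g by simp
      then show "(Y, e(Suc n := \<delta>)) \<in> P" unfolding f(3) g(3) using \<delta> o by (simp add: ang_simps)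
    next
      assume YP: "(Y, e(Suc n := \<delta>)) \<in> P"
      have Ye: "exact_in_B Y e" by (rule ext_sequences_exact, rule ext_sequencesI[OF YP y(1)]) auto
      have ex: "\<exists>f. (\<forall>i\<le>Suc n. hm (f i) (X' i) (Y' i)) \<and> (\<forall>i\<le>n. f (Suc i) \<odot> d' i = e' i \<odot> f i) \<and>
          f 0 = Idm D A \<and> f (Suc n) = Idm D C"
        if w: "(X', d'(Suc n := \<delta>)) \<in> P" "(Y', e'(Suc n := \<delta>)) \<in> P" "X' 0 = A" "Y' 0 = A"
            "X' (Suc n) = C" "Y' (Suc n) = C"
        for X' d' Y' e'
      proof -
        obtain f where f: "f 0 = Idm D A" "f (Suc n) = Idm D C"
            "sigma_map n D SM X' (d'(Suc n := \<delta>)) Y' (e'(Suc n := \<delta>)) f"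
          using F3_last[OF w(1,2), of "Idm D A" "Idm D C"] w(3-6) o \<delta> by (auto simp: ang_simps)
        note m = mapD[OF f(3) P_seq[OF w(1)] P_seq[OF w(2)]]
        have "f (Suc i) \<odot> d' i = e' i \<odot> f i" if "i \<le> n" for i using m(4)[OF that] that by simp
        then show ?thesis using f m(1) by blast
      qed
      obtain f where f: "\<forall>i\<le>Suc n. hm (f i) (X i) (Y i)" "\<forall>i\<le>n. f (Suc i) \<odot> d i = e i \<odot> f i"
          "f 0 = Idm D A" "f (Suc n) = Idm D C"
        using ex[OF X YP] X0 Y0 by blast
      obtain g where g: "\<forall>i\<le>Suc n. hm (g i) (Y i) (X i)" "\<forall>i\<le>n. g (Suc i) \<odot> e i = d i \<odot> g i"
          "g 0 = Idm D A" "g (Suc n) = Idm D C"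
        using ex[OF YP X] X0 Y0 by blast
      have i: "Idm D A \<odot> Idm D A = Idm D A" using o by (simp add: cat_simps)
      have hX: "\<exists>h. nullh X d X d (\<lambda>i. g i \<odot> f i \<boxplus> neg (Idm D (X i))) h"
        by (rule comp_null_homotopy[OF Xe Yc, where k = 0]) (use f g i X0 in auto)
      have hY: "\<exists>h. nullh Y e Y e (\<lambda>i. f i \<odot> g i \<boxplus> neg (Idm D (Y i))) h"
        by (rule comp_null_homotopy[OF Ye Xc, where k = 0]) (use f g i Y0 in auto)
      show "\<exists>f g. map_between n (full_sub D B) A C X d Y e f \<and>
          map_between n (full_sub D B) A C Y e X d g \<and>
        homotopic n (full_sub D B) X d X d (\<lambda>i. g i \<odot> f i) (\<lambda>i. Idm D (X i)) \<and>
        homotopic n (full_sub D B) Y e Y e (\<lambda>i. f i \<odot> g i) (\<lambda>i. Idm D (Y i))"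
        unfolding mb[OF Xc Yc] mb[OF Yc Xc] homotopic_id_iff[OF Xc] homotopic_id_iff[OF Yc]
        by (rule exI[of _ f], rule exI[of _ g], intro conjI) (rule f g hX hY)+
    qed
  qed
  note * = this
  have "(Y, e) \<in> htpy_class n (full_sub D B) A C (X, d) \<longleftrightarrow>
    (Y, e) \<in> {(Y, e) \<in> complexes_between n (full_sub D B) A C. (Y, e(Suc n := \<delta>)) \<in> P}" for Y e
    unfolding htpy_class_def prod.case mem_Collect_eq full_sub_simps(3,4) using *[of Y e] by argo
  then show ?thesis unfolding set_eq_iff split_paired_All by blast
qed

lemma ext_sequences_small:
  assumes "locally_small U D"
  shows "small_extension_groups U n (full_sub D B) \<X>"
  unfolding small_extension_groups_def
proof (intro ballI)
  fix A C assume "A \<in> Obj (full_sub D B)" "C \<in> Obj (full_sub D B)"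
  then have o: "A \<in> Obj D" "C \<in> Obj D" using B_Obj by auto
  let ?B = "full_sub D B"
  let ?K = "\<lambda>\<delta>. {(Y, e) \<in> complexes_between n ?B A C. (Y, e(Suc n := \<delta>)) \<in> P}"
  \<comment> \<open>By \<open>htpy_class_eq\<close> a class is recovered from any connecting
    morphism of its representative, so the classes lie in the image of one hom-set.\<close>
  have "htpy_class n ?B A C ` (\<X> \<inter> complexes_between n ?B A C) \<subseteq> ?K ` Hom D C (SO A)"
  proof
    fix S assume "S \<in> htpy_class n ?B A C ` (\<X> \<inter> complexes_between n ?B A C)"
    then obtain X d where X: "(X, d) \<in> \<X>" "(X, d) \<in> complexes_between n ?B A C"
        "S = htpy_class n ?B A C (X, d)" by auto
    then obtain \<delta> where "\<delta> \<in> Hom D (X (n + 1)) (SO (X 0))" "(X, d(Suc n := \<delta>)) \<in> P"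
      unfolding ext_sequences_def by auto
    then show "S \<in> ?K ` Hom D C (SO A)" using X htpy_class_eq by (auto simp: complexes_between_def)
  qed
  then have "htpy_class n ?B A C ` (\<X> \<inter> complexes_between n ?B A C) \<lesssim> Hom D C (SO A)"
    by (meson image_lepoll lepoll_trans subset_imp_lepoll)
  moreover have "Hom D C (SO A) \<prec> U"
    using assms o SO_in unfolding locally_small_def small_def by blast
  ultimately show "small U (htpy_class n ?B A C ` (\<X> \<inter> complexes_between n ?B A C))"
    unfolding small_def by (rule lesspoll_trans1)
qed

lemma ext_sequences_n_exact: "n_exact_category n (full_sub D B) \<X>"
proof (intro n_exact_category.intro full_sub_additive n_exact_category_axioms.intro)
  have h: "hm f A C" if "A \<in> B" "C \<in> B" "f \<in> Hom D A C" for f A C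
    using that B_Obj by (simp add: hm_iff)
  show "g \<odot>\<^bsub>full_sub D B\<^esub> f \<in> adm_mono \<X>"
    if "A \<in> Obj (full_sub D B)" "C \<in> Obj (full_sub D B)" "E \<in> Obj (full_sub D B)"
        "f \<in> Hom (full_sub D B) A C"
      "g \<in> Hom (full_sub D B) C E" "f \<in> adm_mono \<X>" "g \<in> adm_mono \<X>" for A C E f g
    using adm_mono_comp[of f A C g E] h that by simp
  show "g \<odot>\<^bsub>full_sub D B\<^esub> f \<in> adm_epi n \<X>"
    if "A \<in> Obj (full_sub D B)" "C \<in> Obj (full_sub D B)" "E \<in> Obj (full_sub D B)"
        "f \<in> Hom (full_sub D B) A C"
      "g \<in> Hom (full_sub D B) C E" "f \<in> adm_epi n \<X>" "g \<in> adm_epi n \<X>" for A C E f g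
    using adm_epi_comp[of f A C g E] h that by simp
  show "n_exact_seq n (full_sub D B) X d" if "(X, d) \<in> \<X>" for X d
    using that by (rule ext_sequences_exact)
  show "(X, d) \<in> \<X> \<longleftrightarrow> (Y, e) \<in> \<X>"
    if "n_exact_seq n (full_sub D B) X d" "n_exact_seq n (full_sub D B) Y e"
        "weak_iso n (full_sub D B) X d Y e \<phi>"
    for X d Y e \<phi>
    using that by (rule weak_iso_closed_ext)
  show "((\<lambda>i. Zobj (full_sub D B)), (\<lambda>i. Mzero (full_sub D B) (Zobj (full_sub D B)) (Zobj (full_sub
      D B)))) \<in> \<X>"
    using ext_sequences_zero by simp
  show "\<exists>Y e \<phi>. n_pushout n (full_sub D B) X d Y e \<phi> \<and> Y 0 = Y0 \<and> \<phi> 0 = f \<and> e 0 \<in> adm_mono \<X>"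
    if "(X, d) \<in> \<X>" "Y0 \<in> Obj (full_sub D B)" "f \<in> Hom (full_sub D B) (X 0) Y0" for X d Y0 f
    using that unfolding full_sub_simps(1,2) by (rule ext_sequences_pushout)
  show "\<exists>Y e \<phi>. n_pullback n (full_sub D B) Y e (\<lambda>i. X (i + 1)) (\<lambda>i. d (i + 1)) \<phi> \<and>
      Y n = Y' \<and> \<phi> n = g \<and> e (n - 1) \<in> adm_epi n \<X>"
    if "(X, d) \<in> \<X>" "Y' \<in> Obj (full_sub D B)" "g \<in> Hom (full_sub D B) Y' (X (n + 1))" for X d Y' g
    using that unfolding full_sub_simps(1,2) by (rule ext_sequences_pullback)
qed

end

theorem corollary5p5:
  fixes n :: nat
    and D :: "('o, 'm) addcat"
    and SO :: "'o \<Rightarrow> 'o" and SM :: "'m \<Rightarrow> 'm"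
    and P :: "('o, 'm) sq set"
    and B :: "'o set"
    and U :: "'u set"
  assumes "n \<ge> 1"
    and "n_angulated_category n D SO SM P"
    and "locally_small U D"
    and "additive_subcategory D B"
    and "n_extension_closed n D SO P B"
    and "\<forall>A \<in> B. \<forall>A' \<in> B. Hom D (SO A) A' = {Mzero D (SO A) A'}"
  shows "n_exact_category n (full_sub D B) (ext_sequences n D SO P B) \<and>
    small_extension_groups U n (full_sub D B) (ext_sequences n D SO P B)"
proof -
  interpret extension_closed n D SO SM P B
    by (intro extension_closed.intro angulated.intro angulated_axioms.intro
        extension_closed_axioms.intro) fact+
  show ?thesis using ext_sequences_n_exact ext_sequences_small[OF assms(3)] by blast
qed

end
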